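(* Let $c > 2$ be a non-integer real number. For any $A \geq 1$, if $B = \frac{A+2}{c}$ and $M = \frac{N^{1/c}}{\log^B N}$, then, as $N \to \infty$, \[ \mathop{\mathbb{E}}_{m \leq M} \mathop{\mathbb{E}}_{n \leq N} \Lambda(n)\, \Lambda\bigl(n + \lfloor m^c \rfloor\bigr) = 1 + O\!\left(\frac{1}{\log^A N}\right). \]
   Context: $\Lambda$ denotes the von Mangoldt function: $\Lambda(n) = \log p$ if $n = p^k$ for a prime $p$ and an integer $k \geq 1$, and $\Lambda(n) = 0$ otherwise. For a function $f$ and real $x \geq 1$, the Cesàro average is $\mathop{\mathbb{E}}_{n \leq x} f(n) = \frac{1}{\lfloor x \rfloor}\sum_{n=1}^{\lfloor x \rfloor} f(n)$. $\lfloor \cdot \rfloor$ is the floor function. The implied constant in $O(\cdot)$ may depend on $c$ and $A$ but not on $N$. *)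

theory Defs
  imports
    "HOL-Number_Theory.Prime_Powers"
    "HOL-Library.Landau_Symbols"
begin

(* The Cesaro average over n <= x. It is only meaningful for x >= 1;
   for smaller x the sum is empty and the value is 0. *)
definition cesaro :: "real \<Rightarrow> (nat \<Rightarrow> real) \<Rightarrow> real" where
  "cesaro x f = (1 / real_of_int \<lfloor>x\<rfloor>) * (\<Sum>n = 1..nat \<lfloor>x\<rfloor>. f n)"

end

theory Submission
  imports Defs "HOL-Complex_Analysis.Complex_Analysis" "HOL-Real_Asymp.Real_Asymp"
begin

text \<open>
  Write $\Lambda = 1 + (\Lambda - 1)$ in the second factor. The term $1$ gives the main term by the
  prime number theorem. For the other one, expand over the frequencies $a/q$ with $q = 4N + 1$.

  Unless $|a/q|$ is at most $\log^K N / N$, the sum of $e(a \lfloor m^c \rfloor / q)$ over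
  $m \le M$ saves a power of $\log N$, so Cauchy-Schwarz and Parseval suffice. The saving comes from
  van der Corput's method for $\sum_m e(\beta m^c)$, which works at every scale because $c$ is not an
  integer, so that no derivative of $x^c$ vanishes. At the remaining frequencies,
  partial summation reduces the claim to $\sum_{k \le x} (\Lambda(k) - 1) = O(x / \log^p x)$.

  The latter is obtained without a zero-free region in the usual form: all derivatives of
  $-\zeta'/\zeta - \zeta$ are $O(|t|^{1/2})$ uniformly for $\mathrm{Re}(s) > 1$, by the
  inequality $3 + 4 \cos x + \cos 2x \ge 0$ and Cauchy's estimate. The $k$-th derivative inserts a weight
  $\log^k n$ into the sum, and Perron's formula then bounds the weighted sum by $O(x)$, which saves
  almost all of the logarithms.
\<close>

section \<open>Exponential sums and forward differences\<close>

text \<open>No frequency other than 0 resonates: the integer parts of m^c are equidistributed in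
  residue classes, so every frequency far from 0 is minor, and counting primes without arithmetic
  progressions suffices. The price is that the exceptional neighbourhood of 0 has width log^K N / N
  with K growing with A, and passing through it costs log^(2K) N; hence an arbitrary power of the
  logarithm is needed in the prime number theorem. The size of M enters twice: M^c = N / log^(A+2) N
  keeps all shifts below N, yet is so close to N that the frequency from which the exponential sum
  saves is only a power of log N away from 1/N. On the analytic side, the kernel 1/s^2 makes
  Perron's integral converge for a growth |t|^(1/2); as this growth is the same for all derivatives,
  any number of logarithms can be gained. Half of them are lost on the way from logarithmic means
  back to sums: with the weight log^(2p), the logarithmic mean of Lambda - 1 is O(x), its plain sum
  O(x log^p x), and dividing the weight out leaves O(x / log^p x).\<close>

definition ee :: "real \<Rightarrow> complex" where "ee x = cis (2 * pi * x)"

lemma norm_ee [simp]: "norm (ee x) = 1" by (simp add: ee_def)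
lemma ee_0 [simp]: "ee 0 = 1" by (simp add: ee_def)
lemma ee_add: "ee (x + y) = ee x * ee y" by (simp add: ee_def cis_mult distrib_left)
lemma ee_minus: "ee (- x) = cnj (ee x)" by (simp add: ee_def cis_cnj)
lemma ee_diff: "ee (x - y) = ee x * cnj (ee y)" by (metis ee_add ee_minus uminus_add_conv_diff add.commute)
lemma ee_of_int [simp]: "ee (of_int k) = 1"
  using cos_int_2pin[of k] sin_int_2pin[of k]
  by (simp add: ee_def complex_eq_iff mult_ac)

definition fdiff :: "(nat \<Rightarrow> real) \<Rightarrow> nat \<Rightarrow> real" where
  "fdiff f n = f (Suc n) - f n"

section \<open>The Kusmin-Landau inequality for a monotone first difference\<close>

lemma x_cos_le_sin:
  fixes x :: real assumes "0 \<le> x" "x \<le> pi" shows "x * cos x \<le> sin x"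
proof -
  have "(\<lambda>x. sin x - x * cos x) 0 \<le> (\<lambda>x. sin x - x * cos x) x"
  proof (rule DERIV_nonneg_imp_nondecreasing[OF assms(1)])
    fix y assume y: "0 \<le> y" "y \<le> x"
    show "\<exists>d. ((\<lambda>x. sin x - x * cos x) has_real_derivative d) (at y) \<and> 0 \<le> d"
      by (rule exI[of _ "y * sin y"], rule conjI, (rule derivative_eq_intros refl | simp)+)
         (use y assms in \<open>auto intro!: mult_nonneg_nonneg sin_ge_zero\<close>)
  qed
  thus ?thesis by simp
qed

text \<open>The real part does not depend on \<open>g\<close>. Differences of such reciprocals are
  therefore purely imaginary, and monotonicity of the cotangent turns their total variation into a
  difference of end values.\<close>

lemma inverse_ee_minus_one:
  assumes "0 < g" "g \<le> 1/2"
  shows "1 / (ee g - 1) = Complex (- 1/2) (- cot (pi * g) / 2)"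
proof -
  define x where "x = pi * g"
  have x: "0 < x" "x < pi"
    using assms unfolding x_def by (auto simp: mult_less_cancel_left1 intro!: mult_less_cancel_left1[THEN iffD2])
  have s: "sin x > 0" using x by (rule sin_gt_zero)
  have "ee g = Complex (cos (2 * x)) (sin (2 * x))"
    by (simp add: ee_def x_def complex_eq_iff mult.assoc)
  hence e: "ee g - 1 = Complex (- 2 * (sin x)\<^sup>2) (2 * sin x * cos x)"
    using cos_double_sin[of x] by (simp add: complex_eq_iff sin_double)
  have "(ee g - 1) * Complex (- 1/2) (- cot x / 2) = 1"
  proof -
    have "(sin x)\<^sup>2 + (cos x)\<^sup>2 = 1" by simp
    thus ?thesis using s unfolding e cot_def by (simp add: complex_eq_iff field_simps power2_eq_square)
  qed
  moreover have "ee g - 1 \<noteq> 0" using s unfolding e by (auto simp: complex_eq_iff)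
  ultimately show ?thesis unfolding x_def by (simp add: field_simps)
qed

lemma cot_mono_bound:
  fixes x y :: real assumes "0 < x" "x \<le> y" "y < pi" shows "cot y \<le> cot x"
proof -
  have s: "sin x > 0" "sin y > 0" using assms by (auto intro!: sin_gt_zero)
  have "sin (y - x) \<ge> 0" using assms by (intro sin_ge_zero) auto
  hence "sin y * cos x - cos y * sin x \<ge> 0" by (simp add: sin_diff)
  thus ?thesis using s unfolding cot_def by (simp add: field_simps)
qed

lemma sum_abs_diff_mono:
  fixes u :: "nat \<Rightarrow> real"
  assumes "(\<forall>n. Suc n < N \<longrightarrow> u n \<le> u (Suc n)) \<or> (\<forall>n. Suc n < N \<longrightarrow> u n \<ge> u (Suc n))"
  shows "(\<Sum>n<N-1. \<bar>u (Suc n) - u n\<bar>) = \<bar>u (N-1) - u 0\<bar>"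
  using assms
proof
  assume a: "\<forall>n. Suc n < N \<longrightarrow> u n \<le> u (Suc n)"
  have "(\<Sum>n<N-1. \<bar>u (Suc n) - u n\<bar>) = (\<Sum>n<N-1. u (Suc n) - u n)"
    using a by (intro sum.cong) auto
  also have "\<dots> = u (N-1) - u 0" by (rule sum_lessThan_telescope)
  finally have "(\<Sum>n<N-1. \<bar>u (Suc n) - u n\<bar>) = u (N-1) - u 0" .
  moreover have "(\<Sum>n<N-1. \<bar>u (Suc n) - u n\<bar>) \<ge> 0" by (intro sum_nonneg) auto
  ultimately show ?thesis by simp
next
  assume a: "\<forall>n. Suc n < N \<longrightarrow> u n \<ge> u (Suc n)"
  have "(\<Sum>n<N-1. \<bar>u (Suc n) - u n\<bar>) = (\<Sum>n<N-1. u n - u (Suc n))"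
    using a by (intro sum.cong) auto
  also have "\<dots> = u 0 - u (N-1)" by (rule sum_lessThan_telescope')
  finally have "(\<Sum>n<N-1. \<bar>u (Suc n) - u n\<bar>) = u 0 - u (N-1)" .
  moreover have "(\<Sum>n<N-1. \<bar>u (Suc n) - u n\<bar>) \<ge> 0" by (intro sum_nonneg) auto
  ultimately show ?thesis by simp
qed

lemma summation_by_parts_forward:
  fixes G z :: "nat \<Rightarrow> complex"
  assumes "N > 0"
  shows "(\<Sum>n<N. G n * (z (Suc n) - z n)) =
     G (N-1) * z N - G 0 * z 0 - (\<Sum>n<N-1. (G (Suc n) - G n) * z (Suc n))"
  using assms
proof (induction N)
  case (Suc N)
  show ?case
  proof (cases "N = 0")
    case False
    then obtain M where M: "N = Suc M" by (cases N) auto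
    show ?thesis using Suc M by (simp add: algebra_simps)
  qed (simp add: algebra_simps)
qed simp

text \<open>As \<open>z (Suc n) = z n * ee (fdiff f n)\<close>, each term is
  \<open>G n * (z (Suc n) - z n)\<close> with \<open>G n = 1 / (ee (fdiff f n) - 1)\<close>.
  Summation by parts leaves boundary terms and the variation of \<open>G\<close>, which is that of a
  monotone cotangent. The sum includes \<open>N\<close>, so that the differences at
  \<open>n < N\<close> are exactly those that occur.\<close>

lemma kusmin_landau_aux:
  fixes f :: "nat \<Rightarrow> real"
  assumes lam: "0 < l" "l \<le> 1/2"
    and g: "\<And>n. n < N \<Longrightarrow> l \<le> fdiff f n \<and> fdiff f n \<le> 1/2"
    and mono: "(\<forall>n. Suc n < N \<longrightarrow> fdiff f n \<le> fdiff f (Suc n)) \<or>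
               (\<forall>n. Suc n < N \<longrightarrow> fdiff f n \<ge> fdiff f (Suc n))"
  shows "norm (\<Sum>n\<le>N. ee (f n)) \<le> 2 / l"
proof (cases "N = 0")
  case True
  thus ?thesis using lam by (simp add: field_simps)
next
  case N: False
  define z where "z n = ee (f n)" for n
  define G where "G n = 1 / (ee (fdiff f n) - 1)" for n
  define u where "u n = - cot (pi * fdiff f n) / 2" for n
  \<comment> \<open>Half of \<open>cot x \<le> 1 / x\<close> at
    \<open>x = pi * fdiff f n \<ge> 3 * l\<close>.\<close>
  define U where "U = 1 / (6 * l)"
  have G: "G n = Complex (-1/2) (u n)" if "n < N" for n
    unfolding G_def u_def using g[OF that] lam by (intro inverse_ee_minus_one) auto
  have ub: "\<bar>u n\<bar> \<le> U \<and> u n \<le> 0" if "n < N" for n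
  proof -
    define x where "x = pi * fdiff f n"
    have x: "0 < x" "x \<le> pi / 2" using g[OF that] lam by (auto simp: x_def)
    have c: "cos x \<ge> 0" using x by (intro cos_ge_zero) auto
    have s: "sin x > 0" using x by (intro sin_gt_zero) auto
    have "cot x \<ge> 0" unfolding cot_def using c s by simp
    moreover have "cot x \<le> 1 / x"
      using x_cos_le_sin[of x] x s unfolding cot_def by (simp add: field_simps)
    moreover have "1 / x \<le> 1 / (3 * l)"
    proof (rule divide_left_mono)
      have "3 * l \<le> pi * fdiff f n" using g[OF that] lam pi_gt3 by (intro mult_mono) auto
      thus "3 * l \<le> x" by (simp add: x_def)
    qed (use lam x in auto)
    ultimately show ?thesis unfolding u_def U_def x_def by (auto simp: field_simps)
  qed
  have nG: "norm (G n) \<le> 1/2 + U" if "n < N" for n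
    using G[OF that] ub[OF that] cmod_le[of "G n"] by (simp add: abs_if split: if_splits)
  have zz: "z n = G n * (z (Suc n) - z n)" if "n < N" for n
  proof -
    have "ee (fdiff f n) - 1 \<noteq> 0"
    proof
      assume "ee (fdiff f n) - 1 = 0"
      hence "G n = 0" by (simp add: G_def)
      thus False using G[OF that] by (simp add: complex_eq_iff)
    qed
    moreover have "z (Suc n) = z n * ee (fdiff f n)"
      unfolding z_def fdiff_def by (metis ee_add add.commute diff_add_cancel)
    ultimately show ?thesis unfolding G_def by (simp add: field_simps)
  qed
  have m: "(\<forall>n. Suc n < N \<longrightarrow> u n \<le> u (Suc n)) \<or> (\<forall>n. Suc n < N \<longrightarrow> u n \<ge> u (Suc n))"
  proof -
    have cm: "cot (pi * y) \<le> cot (pi * x)" if "l \<le> x" "x \<le> y" "y \<le> 1/2" for x y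
    proof (rule cot_mono_bound)
      have "pi * y \<le> pi * (1/2)" using that by (intro mult_left_mono) auto
      thus "pi * y < pi" using pi_gt_zero by linarith
    qed (use that lam in auto)
    from mono show ?thesis
    proof
      assume a: "\<forall>n. Suc n < N \<longrightarrow> fdiff f n \<le> fdiff f (Suc n)"
      have "u n \<le> u (Suc n)" if "Suc n < N" for n
        using cm[of "fdiff f n" "fdiff f (Suc n)"] g[of n] g[of "Suc n"] a that unfolding u_def by auto
      thus ?thesis by auto
    next
      assume a: "\<forall>n. Suc n < N \<longrightarrow> fdiff f n \<ge> fdiff f (Suc n)"
      have "u n \<ge> u (Suc n)" if "Suc n < N" for n
        using cm[of "fdiff f (Suc n)" "fdiff f n"] g[of n] g[of "Suc n"] a that unfolding u_def by auto
      thus ?thesis by auto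
    qed
  qed
  have "(\<Sum>n\<le>N. z n) = (\<Sum>n<N. z n) + z N" by (simp add: lessThan_Suc_atMost[symmetric])
  also have "(\<Sum>n<N. z n) = (\<Sum>n<N. G n * (z (Suc n) - z n))" using zz by (intro sum.cong) auto
  also have "\<dots> = G (N-1) * z N - G 0 * z 0 - (\<Sum>n<N-1. (G (Suc n) - G n) * z (Suc n))"
    using N by (intro summation_by_parts_forward) auto
  finally have "norm (\<Sum>n\<le>N. z n) = norm (G (N-1) * z N - G 0 * z 0 - (\<Sum>n<N-1. (G (Suc n) - G n) * z (Suc n)) + z N)"
    by simp
  also have "\<dots> \<le> norm (G (N-1) * z N) + norm (G 0 * z 0) + norm (\<Sum>n<N-1. (G (Suc n) - G n) * z (Suc n)) + norm (z N)"
    by (intro norm_triangle_mono norm_triangle_le_diff order.refl norm_triangle_ineq)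
       (smt (verit) norm_triangle_ineq4)+
  also have "norm (\<Sum>n<N-1. (G (Suc n) - G n) * z (Suc n)) \<le> (\<Sum>n<N-1. \<bar>u (Suc n) - u n\<bar>)"
  proof (rule order.trans[OF norm_sum], rule sum_mono)
    fix n assume "n \<in> {..<N-1}"
    hence "G (Suc n) - G n = Complex 0 (u (Suc n) - u n)"
      using G[of n] G[of "Suc n"] by (simp add: complex_eq_iff)
    hence "norm (G (Suc n) - G n) = \<bar>u (Suc n) - u n\<bar>" by (simp add: cmod_def)
    thus "norm ((G (Suc n) - G n) * z (Suc n)) \<le> \<bar>u (Suc n) - u n\<bar>"
      by (simp add: norm_mult z_def)
  qed
  also have "\<dots> = \<bar>u (N-1) - u 0\<bar>" by (rule sum_abs_diff_mono[OF m])
  \<comment> \<open>Both end values lie in \<open>[- U, 0]\<close>, so their difference costs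
    \<open>U\<close> rather than \<open>2 * U\<close>.\<close>
  also have "\<dots> \<le> U" using ub[of "N-1"] ub[of 0] N by auto
  also have "norm (G (N-1) * z N) \<le> 1/2 + U" using nG[of "N-1"] N by (simp add: norm_mult z_def)
  also have "norm (G 0 * z 0) \<le> 1/2 + U" using nG[of 0] N by (simp add: norm_mult z_def)
  also have "norm (z N) = 1" by (simp add: z_def)
  also have "1/2 + U + (1/2 + U) + U + 1 \<le> 2 / l"
    using lam unfolding U_def by (simp add: field_simps)
  finally show ?thesis unfolding z_def by simp
qed

lemma kusmin_landau:
  fixes f :: "nat \<Rightarrow> real"
  assumes lam: "0 < l" "l \<le> 1/2"
    and g: "\<And>n. Suc n < N \<Longrightarrow> l \<le> fdiff f n \<and> fdiff f n \<le> 1/2"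
    and mono: "(\<forall>n. Suc (Suc n) < N \<longrightarrow> fdiff f n \<le> fdiff f (Suc n)) \<or>
               (\<forall>n. Suc (Suc n) < N \<longrightarrow> fdiff f n \<ge> fdiff f (Suc n))"
  shows "norm (\<Sum>n<N. ee (f n)) \<le> 2 / l"
proof (cases N)
  case 0
  thus ?thesis using lam by simp
next
  case (Suc M)
  have "norm (\<Sum>n\<le>M. ee (f n)) \<le> 2 / l"
    by (rule kusmin_landau_aux[OF lam]) (use g mono Suc in auto)
  thus ?thesis by (simp add: Suc lessThan_Suc_atMost)
qed

section \<open>Van der Corput differencing and tests of higher order\<close>

text \<open>Extend \<open>z\<close> by zero to \<open>y\<close>. Every shift by \<open>h < H\<close>
  has the same total, so \<open>H\<close> times the sum is the sum of the windows \<open>W i\<close>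
  over only \<open>N + H\<close> indices. Cauchy-Schwarz in \<open>i\<close> and expansion of the
  square leave correlations that depend on the distance of the two shifts alone.\<close>

lemma van_der_corput_inequality:
  fixes z :: "nat \<Rightarrow> complex" and N H :: nat
  assumes z: "\<And>n. norm (z n) \<le> 1" and H: "H > 0"
  defines "c \<equiv> (\<lambda>j::nat. norm (\<Sum>n<N-j. z (n + j) * cnj (z n)))"
  shows "real H * (norm (\<Sum>n<N. z n))\<^sup>2 \<le> (real N + real H) * (real N + 2 * (\<Sum>j=1..<H. c j))"
proof -
  \<comment> \<open>Integer indices, since \<open>i - int h\<close> has to become negative without
    truncation.\<close>
  define y where "y i = (if 0 \<le> i \<and> i < int N then z (nat i) else 0)" for i :: int
  define I where "I = {0..<int (N + H)}"
  define S where "S = (\<Sum>n<N. z n)"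
  have sh: "(\<Sum>i\<in>I. y (i - int h)) = S" if "h < H" for h
  proof -
    have "S = (\<Sum>i\<in>(\<lambda>n. int n + int h) ` {..<N}. y (i - int h))"
      unfolding S_def by (subst sum.reindex) (auto simp: inj_on_def y_def)
    also have "\<dots> = (\<Sum>i\<in>I. y (i - int h))"
    proof (rule sum.mono_neutral_left)
      show "\<forall>i\<in>I - (\<lambda>n. int n + int h) ` {..<N}. y (i - int h) = 0"
      proof
        fix i assume i: "i \<in> I - (\<lambda>n. int n + int h) ` {..<N}"
        show "y (i - int h) = 0"
        proof (rule ccontr)
          assume "y (i - int h) \<noteq> 0"
          hence "0 \<le> i - int h" "i - int h < int N" by (auto simp: y_def split: if_splits)
          hence "i = int (nat (i - int h)) + int h" "nat (i - int h) < N" by auto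
          thus False using i by blast
        qed
      qed
    qed (use that in \<open>auto simp: I_def\<close>)
    finally show ?thesis by simp
  qed
  have c0: "norm (\<Sum>i\<in>I. y (i - int h) * cnj (y (i - int h'))) = c (h' - h)"
    if "h \<le> h'" "h' < H" for h h'
  proof -
    define j where "j = h' - h"
    have hj: "h' = h + j" using that by (simp add: j_def)
    have "(\<Sum>n<N-j. z (n + j) * cnj (z n)) =
      (\<Sum>i\<in>(\<lambda>n. int n + int h') ` {..<N-j}. y (i - int h) * cnj (y (i - int h')))"
      by (subst sum.reindex) (auto simp: inj_on_def y_def hj nat_add_distrib intro!: sum.cong)
    also have "\<dots> = (\<Sum>i\<in>I. y (i - int h) * cnj (y (i - int h')))"
    proof (rule sum.mono_neutral_left)
      show "\<forall>i\<in>I - (\<lambda>n. int n + int h') ` {..<N-j}. y (i - int h) * cnj (y (i - int h')) = 0"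
      proof
        fix i assume i: "i \<in> I - (\<lambda>n. int n + int h') ` {..<N-j}"
        show "y (i - int h) * cnj (y (i - int h')) = 0"
        proof (rule ccontr)
          assume "y (i - int h) * cnj (y (i - int h')) \<noteq> 0"
          hence "0 \<le> i - int h'" "i - int h < int N" by (auto simp: y_def split: if_splits)
          hence "i = int (nat (i - int h')) + int h'" "nat (i - int h') < N - j" by (auto simp: hj)
          thus False using i by blast
        qed
      qed
    qed (use that in \<open>auto simp: I_def\<close>)
    finally show ?thesis by (simp add: c_def j_def)
  qed
  have cc: "norm (\<Sum>i\<in>I. y (i - int h) * cnj (y (i - int h'))) = c (if h \<le> h' then h' - h else h - h')"
    if "h < H" "h' < H" for h h'
  proof (cases "h \<le> h'")
    case True thus ?thesis using c0[of h h'] that by simp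
  next
    case False
    have "norm (\<Sum>i\<in>I. y (i - int h) * cnj (y (i - int h'))) =
          norm (cnj (\<Sum>i\<in>I. y (i - int h') * cnj (y (i - int h))))"
      by (simp add: mult.commute)
    also have "\<dots> = c (h - h')" unfolding complex_mod_cnj using False that by (intro c0) auto
    finally show ?thesis using False by simp
  qed
  have c_nonneg: "c j \<ge> 0" for j by (simp add: c_def)
  have cle: "c 0 \<le> real N"
  proof -
    have "c 0 \<le> (\<Sum>n<N. norm (z n * cnj (z n)))" unfolding c_def by (simp add: norm_sum)
    also have "\<dots> \<le> (\<Sum>n<N. 1)"
      by (intro sum_mono) (auto simp: norm_mult intro!: mult_le_one z)
    finally show ?thesis by simp
  qed
  \<comment> \<open>A row of the matrix of correlations meets each distance \<open>j > 0\<close> at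
    most twice, once on either side of the diagonal.\<close>
  have row: "(\<Sum>h'<H. c (if h \<le> h' then h' - h else h - h')) \<le> c 0 + 2 * (\<Sum>j=1..<H. c j)" if h: "h < H" for h
  proof -
    have "(\<Sum>h'<H. w h') = (\<Sum>h'<h. w h') + w h + (\<Sum>h'=Suc h..<H. w h')" for w :: "nat \<Rightarrow> real"
      using sum.atLeastLessThan_concat[of 0 h H w] sum.atLeast_Suc_lessThan[of h H w] h
      by (simp add: atLeast0LessThan)
    from this[of "\<lambda>h'. c (if h \<le> h' then h' - h else h - h')"]
    have "(\<Sum>h'<H. c (if h \<le> h' then h' - h else h - h')) =
       (\<Sum>h'<h. c (if h \<le> h' then h' - h else h - h')) + c 0 +
       (\<Sum>h'=Suc h..<H. c (if h \<le> h' then h' - h else h - h'))"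
      by simp
    also have "(\<Sum>h'<h. c (if h \<le> h' then h' - h else h - h')) = (\<Sum>j\<in>(\<lambda>h'. h - h') ` {..<h}. c j)"
      by (subst sum.reindex) (auto simp: inj_on_def)
    also have "\<dots> \<le> (\<Sum>j=1..<H. c j)"
      by (rule sum_mono2) (use h c_nonneg in auto)
    also have "(\<Sum>h'=Suc h..<H. c (if h \<le> h' then h' - h else h - h')) = (\<Sum>j\<in>(\<lambda>h'. h' - h) ` {Suc h..<H}. c j)"
      by (subst sum.reindex) (auto simp: inj_on_def)
    also have "\<dots> \<le> (\<Sum>j=1..<H. c j)"
      by (rule sum_mono2) (use h c_nonneg in auto)
    finally show ?thesis by simp
  qed
  define W where "W i = (\<Sum>h<H. y (i - int h))" for i
  have "of_nat H * S = (\<Sum>h<H. \<Sum>i\<in>I. y (i - int h))" using sh by simp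
  also have "\<dots> = (\<Sum>i\<in>I. W i)" unfolding W_def by (rule sum.swap)
  finally have HS: "of_nat H * S = (\<Sum>i\<in>I. W i)" .
  have "(real H * norm S)\<^sup>2 = (norm (\<Sum>i\<in>I. W i))\<^sup>2"
    by (simp add: HS[symmetric] norm_mult)
  also have "\<dots> \<le> (\<Sum>i\<in>I. 1 * norm (W i))\<^sup>2"
    by (intro power_mono) (auto intro: norm_sum)
  also have "\<dots> \<le> (\<Sum>i\<in>I. 1\<^sup>2) * (\<Sum>i\<in>I. (norm (W i))\<^sup>2)" by (rule Cauchy_Schwarz_ineq_sum)
  also have "(\<Sum>i\<in>I. (norm (W i))\<^sup>2) \<le> real H * (real N + 2 * (\<Sum>j=1..<H. c j))"
  proof -
    have "of_real (\<Sum>i\<in>I. (norm (W i))\<^sup>2) = (\<Sum>i\<in>I. W i * cnj (W i))"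
      by (simp add: complex_norm_square[symmetric] flip: of_real_power)
    also have "\<dots> = (\<Sum>i\<in>I. \<Sum>h<H. \<Sum>h'<H. y (i - int h) * cnj (y (i - int h')))"
      unfolding W_def by (simp add: sum_product)
    also have "\<dots> = (\<Sum>h<H. \<Sum>h'<H. \<Sum>i\<in>I. y (i - int h) * cnj (y (i - int h')))"
      by (subst sum.swap, rule sum.cong[OF refl], rule sum.swap)
    finally have "\<bar>\<Sum>i\<in>I. (norm (W i))\<^sup>2\<bar> = norm \<dots>" by (metis norm_of_real)
    also have "\<dots> \<le> (\<Sum>h<H. \<Sum>h'<H. norm (\<Sum>i\<in>I. y (i - int h) * cnj (y (i - int h'))))"
      by (intro order.trans[OF norm_sum] sum_mono order.refl)
    also have "\<dots> = (\<Sum>h<H. \<Sum>h'<H. c (if h \<le> h' then h' - h else h - h'))"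
      using cc by (intro sum.cong) auto
    also have "\<dots> \<le> (\<Sum>h<H. c 0 + 2 * (\<Sum>j=1..<H. c j))"
      by (intro sum_mono row) auto
    also have "\<dots> = real H * (c 0 + 2 * (\<Sum>j=1..<H. c j))" by simp
    also have "\<dots> \<le> real H * (real N + 2 * (\<Sum>j=1..<H. c j))"
      using cle by (intro mult_left_mono add_right_mono) auto
    finally show ?thesis by simp
  qed
  also have "(\<Sum>i\<in>I. 1\<^sup>2) = real N + real H" by (simp add: I_def)
  finally have "(real H * norm S)\<^sup>2 \<le> (real N + real H) * (real H * (real N + 2 * (\<Sum>j=1..<H. c j)))"
    by (simp add: mult_left_mono)
  hence "real H * (real H * (norm S)\<^sup>2) \<le> real H * ((real N + real H) * (real N + 2 * (\<Sum>j=1..<H. c j)))"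
    by (simp add: power2_eq_square mult_ac)
  thus ?thesis using H by (simp add: S_def)
qed

text \<open>Iterated differences commute with shifts, and the difference of two shifts telescopes.
  Hence one Weyl step lowers the order that has to be controlled by one, at the price of a factor
  \<open>h\<close> in its size.\<close>

lemma fdiff_funpow_shift_diff:
  "(fdiff ^^ j) (\<lambda>n. f (n + h) - f n) n = (\<Sum>i<h. (fdiff ^^ Suc j) f (n + i))"
proof -
  have *: "(fdiff ^^ j) (\<lambda>n. f (n + h) - f n) n = (fdiff ^^ j) f (n + h) - (fdiff ^^ j) f n" for n
    by (induction j arbitrary: n) (simp_all add: fdiff_def)
  have "(\<Sum>i<h. (fdiff ^^ Suc j) f (n + i)) = (\<Sum>i<h. (fdiff ^^ j) f (n + Suc i) - (fdiff ^^ j) f (n + i))"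
    by (simp add: fdiff_def)
  also have "\<dots> = (fdiff ^^ j) f (n + h) - (fdiff ^^ j) f (n + 0)"
    by (rule sum_lessThan_telescope)
  finally show ?thesis using * by simp
qed

text \<open>The \<open>k\<close>-th and \<open>(k+1)\<close>-st forward differences play the role of the derivatives
  in van der Corput's method; they are only required at points all of whose shifts lie below \<open>N\<close>.\<close>
definition diff_bounds :: "nat \<Rightarrow> (nat \<Rightarrow> real) \<Rightarrow> nat \<Rightarrow> real \<Rightarrow> real \<Rightarrow> bool" where
  "diff_bounds k f N l C \<longleftrightarrow>
     (\<forall>n. n + k < N \<longrightarrow> l \<le> (fdiff ^^ k) f n \<and> (fdiff ^^ k) f n \<le> C * l) \<and>
     ((\<forall>n. n + Suc k < N \<longrightarrow> 0 \<le> (fdiff ^^ Suc k) f n) \<or>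
      (\<forall>n. n + Suc k < N \<longrightarrow> (fdiff ^^ Suc k) f n \<le> 0))"

lemma diff_bounds_shift:
  assumes "diff_bounds (Suc k) f N l C"
  shows "diff_bounds k (\<lambda>n. f (n + h) - f n) (N - h) (real h * l) C"
proof -
  have b: "l \<le> (fdiff ^^ Suc k) f (n + i)" "(fdiff ^^ Suc k) f (n + i) \<le> C * l"
    if "n + k < N - h" "i < h" for n i
    using assms that unfolding diff_bounds_def by auto
  have 1: "real h * l \<le> (fdiff ^^ k) (\<lambda>n. f (n + h) - f n) n"
          "(fdiff ^^ k) (\<lambda>n. f (n + h) - f n) n \<le> C * (real h * l)" if "n + k < N - h" for n
  proof -
    have "(\<Sum>i<h. l) \<le> (\<Sum>i<h. (fdiff ^^ Suc k) f (n + i))"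
      using b(1)[OF that] by (intro sum_mono) auto
    thus "real h * l \<le> (fdiff ^^ k) (\<lambda>n. f (n + h) - f n) n"
      unfolding fdiff_funpow_shift_diff by simp
    have "(\<Sum>i<h. (fdiff ^^ Suc k) f (n + i)) \<le> (\<Sum>i<h. C * l)"
      using b(2)[OF that] by (intro sum_mono) auto
    thus "(fdiff ^^ k) (\<lambda>n. f (n + h) - f n) n \<le> C * (real h * l)"
      unfolding fdiff_funpow_shift_diff by (simp add: algebra_simps)
  qed
  have 2: "((\<forall>n. n + Suc k < N - h \<longrightarrow> 0 \<le> (fdiff ^^ Suc k) (\<lambda>n. f (n + h) - f n) n) \<or>
      (\<forall>n. n + Suc k < N - h \<longrightarrow> (fdiff ^^ Suc k) (\<lambda>n. f (n + h) - f n) n \<le> 0))"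
  proof -
    from assms consider "\<forall>n. n + Suc (Suc k) < N \<longrightarrow> 0 \<le> (fdiff ^^ Suc (Suc k)) f n"
      | "\<forall>n. n + Suc (Suc k) < N \<longrightarrow> (fdiff ^^ Suc (Suc k)) f n \<le> 0"
      unfolding diff_bounds_def by blast
    thus ?thesis
    proof cases
      case 1
      thus ?thesis unfolding fdiff_funpow_shift_diff by (intro disjI1 allI impI sum_nonneg) auto
    next
      case 2
      thus ?thesis unfolding fdiff_funpow_shift_diff by (intro disjI2 allI impI sum_nonpos) auto
    qed
  qed
  show ?thesis unfolding diff_bounds_def using 1 2 by blast
qed

lemma kusmin_landau_diff_bounds:
  assumes "diff_bounds 1 f N l C" "0 < l" "C * l \<le> 1/2" "1 \<le> C"
  shows "norm (\<Sum>n<N. ee (f n)) \<le> 2 / l"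
proof (rule kusmin_landau)
  have "1 * l \<le> C * l" using assms by (intro mult_right_mono) auto
  thus "l \<le> 1/2" using assms by linarith
  show "l \<le> fdiff f n \<and> fdiff f n \<le> 1/2" if "Suc n < N" for n
    using assms that unfolding diff_bounds_def by force
  have "(\<forall>n. n + Suc 1 < N \<longrightarrow> 0 \<le> (fdiff ^^ Suc 1) f n) \<or>
        (\<forall>n. n + Suc 1 < N \<longrightarrow> (fdiff ^^ Suc 1) f n \<le> 0)"
    using assms(1) unfolding diff_bounds_def by blast
  moreover have "(fdiff ^^ Suc 1) f n = fdiff f (Suc n) - fdiff f n" for n
    by (simp add: fdiff_def[of "fdiff f"])
  ultimately show "(\<forall>n. Suc (Suc n) < N \<longrightarrow> fdiff f n \<le> fdiff f (Suc n)) \<or>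
    (\<forall>n. Suc (Suc n) < N \<longrightarrow> fdiff f (Suc n) \<le> fdiff f n)" by auto
qed (use assms in auto)

text \<open>The left side grows only logarithmically. A square root is affordable against the factor
  \<open>1 / H\<close> in van der Corput's inequality and keeps all bounds pure powers.\<close>

lemma sum_inverse_le_sqrt: "(\<Sum>h=1..<H. 1 / real h) \<le> 3 * sqrt (real H)"
proof (induction H)
  case (Suc H)
  show ?case
  proof (cases "H = 0")
    case False
    have "1 / real H \<le> 3 * (sqrt (real (Suc H)) - sqrt (real H))"
    proof -
      define x where "x = sqrt (real H)"
      define y where "y = sqrt (real (Suc H))"
      have x: "x \<ge> 1" using False by (simp add: x_def)
      have xy: "y\<^sup>2 = x\<^sup>2 + 1" "x \<le> y" "real H = x\<^sup>2" by (auto simp: x_def y_def)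
      have "1 \<le> x\<^sup>2" using x by simp
      have "y \<le> 2 * x"
      proof (rule power2_le_imp_le)
        show "y\<^sup>2 \<le> (2 * x)\<^sup>2" using xy \<open>1 \<le> x\<^sup>2\<close> by (simp add: power_mult_distrib)
      qed (use x in auto)
      have "1 = (y - x) * (y + x)" using xy by (simp add: power2_eq_square algebra_simps)
      also have "\<dots> \<le> (y - x) * (3 * x)" using xy \<open>y \<le> 2 * x\<close> by (intro mult_left_mono) auto
      also have "\<dots> \<le> (y - x) * (3 * (x * x))" using x xy by (intro mult_left_mono) auto
      finally have "1 \<le> 3 * (y - x) * x\<^sup>2" by (simp add: power2_eq_square algebra_simps)
      hence "1 / x\<^sup>2 \<le> 3 * (y - x)" using x by (simp add: field_simps)
      thus ?thesis unfolding xy(3)[symmetric] by (simp only: x_def y_def)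
    qed
    thus ?thesis using Suc False by (simp add: algebra_simps)
  qed simp
qed simp

lemma weyl_sum_shift:
  fixes f :: "nat \<Rightarrow> real"
  shows "norm (\<Sum>n<N-j. ee (f (n + j)) * cnj (ee (f n))) = norm (\<Sum>n<N-j. ee (f (n + j) - f n))"
  by (simp add: ee_diff)

lemma weyl_van_der_corput:
  fixes f :: "nat \<Rightarrow> real"
  assumes "real N \<le> M" "real H \<le> M" "H > 0"
  shows "(norm (\<Sum>n<N. ee (f n)))\<^sup>2 \<le>
     2 * M\<^sup>2 / H + 4 * M / H * (\<Sum>h=1..<H. norm (\<Sum>n<N-h. ee (f (n + h) - f n)))"
proof -
  let ?T = "\<Sum>h=1..<H. norm (\<Sum>n<N-h. ee (f (n + h) - f n))"
  have T: "?T \<ge> 0" by (intro sum_nonneg) auto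
  have "real H * (norm (\<Sum>n<N. ee (f n)))\<^sup>2 \<le> (real N + real H) * (real N + 2 * ?T)"
    using van_der_corput_inequality[of "\<lambda>n. ee (f n)" H N] assms by (simp add: weyl_sum_shift)
  also have "\<dots> \<le> (2 * M) * (M + 2 * ?T)"
    using assms T by (intro mult_mono) auto
  finally show ?thesis using assms by (simp add: field_simps power2_eq_square)
qed

text \<open>For \<open>k = 2\<close> one differencing step reduces to Kusmin-Landau. Each further
  step bounds the square of the sum by sums of lower order, so the exponent of \<open>R\<close> is
  halved. Replacing \<open>l\<close> by \<open>h * l\<close> with \<open>1 \<le> h \<le> R\<close>
  preserves the lower bounds on \<open>l\<close>, while the upper bound loses a factor
  \<open>R\<close>, whence \<open>R ^ (k - 1)\<close>. The constant 5 reproduces itself because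
  \<open>4 + 4 * 5 \<le> 5 * 5\<close>.\<close>

lemma weyl_bound:
  assumes "k \<ge> 2" "diff_bounds k f N l C" "real N \<le> M" "C \<ge> 1" "R \<ge> 1" "l > 0"
    and "M \<ge> 2 * R" "l * M\<^sup>2 \<ge> 16 * C * R\<^sup>2" "l\<^sup>2 * M^3 \<ge> 8 * R\<^sup>2" "4 * C * l * R ^ (k - 1) \<le> 1"
  shows "norm (\<Sum>n<N. ee (f n)) \<le> 5 * M * R powr (-((1/2) ^ (k - 1)))"
  using assms
proof (induction k arbitrary: f N l rule: nat_induct_at_least)
  case base
  \<comment> \<open>The longest differencing range compatible with both \<open>H \<le> M\<close> and
    the condition \<open>C * (h * l) \<le> 1/2\<close> of Kusmin-Landau.\<close>
  define m where "m = min M (1 / (2 * C * l))"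
  define H where "H = nat \<lfloor>m\<rfloor>"
  have pos: "M > 0" "C > 0" "l > 0" "R > 0" using base by auto
  have mR: "m \<ge> R"
    using base pos unfolding m_def by (auto simp: field_simps)
  have "1 / (2 * C * l) \<ge> 2 * R" using base pos by (auto simp: field_simps)
  hence "m \<ge> 2" using base unfolding m_def by auto
  hence H: "real H \<ge> m / 2" "real H \<le> m" "H > 0"
    unfolding H_def by linarith+
  have HM: "real H \<le> M" "2 * C * l * real H \<le> 1"
  proof -
    have "real H \<le> 1 / (2 * C * l)" using H(2) by (simp add: m_def)
    thus "2 * C * l * real H \<le> 1" using pos by (simp add: field_simps)
  qed (use H(2) in \<open>simp add: m_def\<close>)
  have Sh: "norm (\<Sum>n<N-h. ee (f (n + h) - f n)) \<le> 2 / (real h * l)" if "h \<in> {1..<H}" for h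
  proof (rule kusmin_landau_diff_bounds)
    show "diff_bounds 1 (\<lambda>n. f (n + h) - f n) (N - h) (real h * l) C"
      using diff_bounds_shift[of 1 f N l C h] base by (simp add: numeral_2_eq_2)
    have "2 * C * l * real h \<le> 2 * C * l * real H" using that pos by (intro mult_left_mono) auto
    thus "C * (real h * l) \<le> 1 / 2" using HM(2) by (simp add: algebra_simps)
  qed (use that pos base in auto)
  have "(\<Sum>h=1..<H. norm (\<Sum>n<N-h. ee (f (n + h) - f n))) \<le> (\<Sum>h=1..<H. 2 / l * (1 / real h))"
    using Sh by (intro sum_mono) (auto simp: field_simps)
  also have "\<dots> = 2 / l * (\<Sum>h=1..<H. 1 / real h)" by (simp only: sum_distrib_left)
  also have "\<dots> \<le> 2 / l * (3 * sqrt (real H))"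
    using pos by (intro mult_left_mono sum_inverse_le_sqrt) auto
  finally have T: "(\<Sum>h=1..<H. norm (\<Sum>n<N-h. ee (f (n + h) - f n))) \<le> 6 * sqrt (real H) / l" by simp
  have "(norm (\<Sum>n<N. ee (f n)))\<^sup>2 \<le>
     2 * M\<^sup>2 / H + 4 * M / H * (\<Sum>h=1..<H. norm (\<Sum>n<N-h. ee (f (n + h) - f n)))"
    using base HM H by (intro weyl_van_der_corput) auto
  also have "\<dots> \<le> 2 * M\<^sup>2 / H + 4 * M / H * (6 * sqrt (real H) / l)"
    using T pos H by (intro add_left_mono mult_left_mono) auto
  also have "2 * M\<^sup>2 / H \<le> 4 * M\<^sup>2 / R"
  proof -
    have "real H \<ge> R / 2" using H mR by linarith
    hence "M\<^sup>2 * R \<le> M\<^sup>2 * (2 * H)" by (intro mult_left_mono) auto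
    thus ?thesis using H pos by (simp add: field_simps)
  qed
  also have "4 * M / H * (6 * sqrt (real H) / l) \<le> 12 * M\<^sup>2 / R"
  proof -
    \<comment> \<open>The two cases of the minimum consume one hypothesis each:
      \<open>l\<^sup>2 * M^3 \<ge> 8 * R\<^sup>2\<close> if it is \<open>M\<close>, and
      \<open>l * M\<^sup>2 \<ge> 16 * C * R\<^sup>2\<close> otherwise.\<close>
    have "(2 * R)\<^sup>2 \<le> l\<^sup>2 * M\<^sup>2 * (m / 2)"
    proof (cases "M \<le> 1 / (2 * C * l)")
      case True
      hence "m = M" by (simp add: m_def)
      thus ?thesis using base(8) by (simp add: power2_eq_square power3_eq_cube)
    next
      case False
      hence "m = 1 / (2 * C * l)" by (simp add: m_def)
      hence "l\<^sup>2 * M\<^sup>2 * (m / 2) = l * M\<^sup>2 / (4 * C)" using pos by (simp add: power2_eq_square field_simps)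
      moreover have "(2 * R)\<^sup>2 \<le> l * M\<^sup>2 / (4 * C)"
        using base(7) pos by (simp add: field_simps power2_eq_square)
      ultimately show ?thesis by (simp only:)
    qed
    also have "\<dots> \<le> l\<^sup>2 * M\<^sup>2 * real H" using H by (intro mult_left_mono) auto
    also have "\<dots> = (l * M * sqrt (real H))\<^sup>2" by (simp add: power_mult_distrib)
    finally have le: "2 * R \<le> l * M * sqrt (real H)"
      by (rule power2_le_imp_le) (use pos in auto)
    have "4 * M / H * (6 * sqrt (real H) / l) = 24 * M / (l * sqrt (real H))"
    proof -
      define s where "s = sqrt (real H)"
      have "s > 0" "real H = s * s" using H by (auto simp: s_def)
      thus ?thesis unfolding s_def[symmetric] using pos by (simp add: field_simps)
    qed
    also have "\<dots> \<le> 12 * M\<^sup>2 / R"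
    proof -
      have "M * (2 * R) \<le> M * (l * M * sqrt (real H))" using le pos by (intro mult_left_mono) auto
      thus ?thesis using H pos by (simp add: field_simps power2_eq_square)
    qed
    finally show ?thesis .
  qed
  also have "4 * M\<^sup>2 / R + 12 * M\<^sup>2 / R \<le> 25 * M\<^sup>2 / R" using pos by (simp add: field_simps)
  also have "25 * M\<^sup>2 / R = (5 * M * R powr (-(1/2)))\<^sup>2"
    using pos by (simp add: power_mult_distrib powr_minus powr_half_sqrt power_divide field_simps)
  finally have "norm (\<Sum>n<N. ee (f n)) \<le> 5 * M * R powr (-(1/2))"
    by (rule power2_le_imp_le) (use pos in auto)
  thus ?case by simp
next
  case (Suc k)
  have pos: "M > 0" "C > 0" "l > 0" "R > 0" using Suc by auto
  \<comment> \<open>A range of length about \<open>R\<close> suffices: the diagonal term, of order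
    \<open>M\<^sup>2 / R\<close>, is already within the target.\<close>
  define H where "H = nat \<lfloor>R\<rfloor>"
  have "1 \<le> \<lfloor>R\<rfloor>" using Suc.prems(4) by (simp add: le_floor_iff)
  hence H: "real H \<ge> R / 2" "real H \<le> R" "H > 0" unfolding H_def by linarith+
  define B where "B = 5 * M * R powr (-((1/2) ^ (k - 1)))"
  have B: "B \<ge> 0" using pos by (simp add: B_def)
  have Sh: "norm (\<Sum>n<N-h. ee (f (n + h) - f n)) \<le> B" if "h \<in> {1..<H}" for h
    unfolding B_def
  proof (rule Suc.IH)
    show "diff_bounds k (\<lambda>n. f (n + h) - f n) (N - h) (real h * l) C"
      using diff_bounds_shift[of k f N l C h] Suc by simp
    have h: "real h \<ge> 1" "real h \<le> R" using that H by auto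
    hence hl: "l \<le> real h * l" "real h * l \<le> R * l" using pos by auto
    have "l * M\<^sup>2 \<le> real h * l * M\<^sup>2" using hl by (intro mult_right_mono) auto
    thus "16 * C * R\<^sup>2 \<le> real h * l * M\<^sup>2" using Suc.prems by linarith
    have "l\<^sup>2 * M ^ 3 \<le> (real h * l)\<^sup>2 * M ^ 3" using hl pos by (intro mult_right_mono power_mono) auto
    thus "8 * R\<^sup>2 \<le> (real h * l)\<^sup>2 * M ^ 3" using Suc.prems by linarith
    have "4 * C * (real h * l) * R ^ (k - 1) \<le> 4 * C * (R * l) * R ^ (k - 1)"
      using hl pos by (intro mult_right_mono mult_left_mono) auto
    also have "\<dots> = 4 * C * l * R ^ (Suc k - 1)" using \<open>k \<ge> 2\<close> by (cases k) auto
    also have "\<dots> \<le> 1" by fact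
    finally show "4 * C * (real h * l) * R ^ (k - 1) \<le> 1" .
    show "real h * l > 0" using h pos by simp
    show "real (N - h) \<le> M" using Suc.prems(2) by (simp add: of_nat_diff)
  qed (use Suc in auto)
  have "(norm (\<Sum>n<N. ee (f n)))\<^sup>2 \<le>
     2 * M\<^sup>2 / H + 4 * M / H * (\<Sum>h=1..<H. norm (\<Sum>n<N-h. ee (f (n + h) - f n)))"
    using Suc.prems H by (intro weyl_van_der_corput) auto
  also have "\<dots> \<le> 2 * M\<^sup>2 / H + 4 * M / H * (\<Sum>h=1..<H. B)"
    using Sh pos by (intro add_left_mono mult_left_mono sum_mono) auto
  also have "(\<Sum>h=1..<H. B) \<le> real H * B" using B H by (simp add: mult_right_mono)
  hence "2 * M\<^sup>2 / H + 4 * M / H * (\<Sum>h=1..<H. B) \<le> 2 * M\<^sup>2 / H + 4 * M / H * (real H * B)"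
    using pos H by (intro add_left_mono mult_left_mono) auto
  also have "2 * M\<^sup>2 / H \<le> 4 * M\<^sup>2 * R powr (-((1/2) ^ (k - 1)))"
  proof -
    have "1 / R = R powr (-1)" using pos by (simp add: powr_minus field_simps)
    also have "\<dots> \<le> R powr (-((1/2) ^ (k - 1)))"
      using Suc.prems by (intro powr_mono) (auto simp: power_le_one)
    finally have r: "1 / R \<le> R powr (-((1/2) ^ (k - 1)))" .
    have "M\<^sup>2 * R \<le> M\<^sup>2 * (2 * H)" using H by (intro mult_left_mono) auto
    hence "2 * M\<^sup>2 / H \<le> 4 * M\<^sup>2 * (1 / R)" using H pos by (simp add: field_simps)
    also have "\<dots> \<le> 4 * M\<^sup>2 * R powr (-((1/2) ^ (k - 1)))" using r by (intro mult_left_mono) auto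
    finally show ?thesis .
  qed
  also have "4 * M / H * (real H * B) = 20 * M\<^sup>2 * R powr (-((1/2) ^ (k - 1)))"
    using H by (simp add: B_def power2_eq_square)
  also have "4 * M\<^sup>2 * R powr (-((1/2) ^ (k - 1))) + 20 * M\<^sup>2 * R powr (-((1/2) ^ (k - 1)))
      \<le> 25 * M\<^sup>2 * R powr (-((1/2) ^ (k - 1)))"
    by (simp add: algebra_simps)
  also have "R powr (-((1/2) ^ (k - 1))) = (R powr (-((1/2) ^ k)))\<^sup>2"
  proof -
    have "(1/2::real) ^ (k - 1) = 2 * (1/2) ^ k" using \<open>k \<ge> 2\<close> by (cases k) auto
    thus ?thesis using pos by (simp add: power2_eq_square powr_add[symmetric])
  qed
  also have "25 * M\<^sup>2 * (R powr (-((1/2) ^ k)))\<^sup>2 = (5 * M * R powr (-((1/2) ^ k)))\<^sup>2"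
    by (simp add: power_mult_distrib)
  finally have "norm (\<Sum>n<N. ee (f n)) \<le> 5 * M * R powr (-((1/2) ^ k))"
    by (rule power2_le_imp_le) (use pos in auto)
  thus ?case by simp
qed

section \<open>Power phases \<open>b * x powr c\<close>\<close>

text \<open>The induction hypothesis, applied to \<open>G i x = F i (x + 1) - F i x\<close>, leaves
  one ordinary mean value step. The family \<open>F\<close> lists the successive derivatives, so no
  iterated derivative has to be formed.\<close>

lemma fdiff_funpow_mean_value:
  fixes F :: "nat \<Rightarrow> real \<Rightarrow> real"
  assumes "\<And>i x. x > 0 \<Longrightarrow> (F i has_real_derivative F (Suc i) x) (at x)" and "a + real n > 0"
  shows "\<exists>\<xi>. a + real n \<le> \<xi> \<and> \<xi> \<le> a + real n + real k \<and> (fdiff ^^ k) (\<lambda>n. F 0 (a + real n)) n = F k \<xi>"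
  using assms
proof (induction k arbitrary: F)
  case 0
  thus ?case by auto
next
  case (Suc k)
  define G where "G i x = F i (x + 1) - F i x" for i x
  have "\<exists>\<xi>. a + real n \<le> \<xi> \<and> \<xi> \<le> a + real n + real k \<and> (fdiff ^^ k) (\<lambda>n. G 0 (a + real n)) n = G k \<xi>"
  proof (rule Suc.IH)
    fix i :: nat and x :: real assume "x > 0"
    have "((\<lambda>x. F i (x + 1)) has_real_derivative F (Suc i) (x + 1)) (at x)"
      by (rule DERIV_shift[THEN iffD1], rule Suc.prems(1)) (use \<open>x > 0\<close> in simp)
    thus "(G i has_real_derivative G (Suc i) x) (at x)"
      unfolding G_def by (rule DERIV_diff) (rule Suc.prems(1)[OF \<open>x > 0\<close>])
  qed fact
  then obtain \<xi> where \<xi>: "a + real n \<le> \<xi>" "\<xi> \<le> a + real n + real k"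
      "(fdiff ^^ k) (\<lambda>n. G 0 (a + real n)) n = G k \<xi>" by blast
  have "fdiff (\<lambda>n. F 0 (a + real n)) = (\<lambda>n. G 0 (a + real n))"
    by (rule ext) (simp add: fdiff_def G_def add_ac)
  hence eq: "(fdiff ^^ Suc k) (\<lambda>n. F 0 (a + real n)) n = G k \<xi>"
    using \<xi>(3) by (simp only: funpow_Suc_right comp_def)
  have "\<exists>z. \<xi> < z \<and> z < \<xi> + 1 \<and> F k (\<xi> + 1) - F k \<xi> = (\<xi> + 1 - \<xi>) * F (Suc k) z"
    using \<xi>(1) Suc.prems by (intro MVT2) auto
  then obtain z where "\<xi> < z" "z < \<xi> + 1" "G k \<xi> = F (Suc k) z" by (auto simp: G_def)
  thus ?case using \<xi> eq by (intro exI[of _ z]) auto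
qed

definition fallfac :: "real \<Rightarrow> nat \<Rightarrow> real" where
  "fallfac c k = (\<Prod>j<k. c - real j)"

text \<open>This is how non-integrality of \<open>c\<close> enters: \<open>fallfac c k\<close> is
  the coefficient of the \<open>k\<close>-th derivative of \<open>x powr c\<close>, so a test of
  every order is available.\<close>

lemma fallfac_nonzero: "c \<notin> \<int> \<Longrightarrow> fallfac c k \<noteq> 0"
  by (auto simp: fallfac_def)

lemma fallfac_Suc: "fallfac c (Suc k) = fallfac c k * (c - real k)"
  by (simp add: fallfac_def)

text \<open>The exponent may have either sign, as \<open>c - k\<close> does; comparing through
  \<open>y = M / x\<close> in \<open>[1, R]\<close> treats both at once.\<close>

lemma powr_between:
  fixes x M R d D :: real
  assumes "M / R \<le> x" "x \<le> M" "M > 0" "R \<ge> 1" "\<bar>d\<bar> \<le> D"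
  shows "M powr d * R powr (-D) \<le> x powr d" "x powr d \<le> M powr d * R powr D"
proof -
  have x: "x > 0" using assms by (smt (verit) divide_pos_pos)
  define y where "y = M / x"
  have y: "1 \<le> y" "y \<le> R" using assms x by (auto simp: y_def field_simps)
  have eq: "x powr d = M powr d * y powr (-d)"
    using x assms by (simp add: y_def powr_divide powr_minus field_simps)
  have "R powr (-D) \<le> y powr (-D)" using y assms by (intro powr_mono2') auto
  also have "\<dots> \<le> y powr (-d)" using y assms by (intro powr_mono) auto
  finally show "M powr d * R powr (-D) \<le> x powr d" unfolding eq by (intro mult_left_mono) auto
  have "y powr (-d) \<le> y powr D" using y assms by (intro powr_mono) auto
  also have "\<dots> \<le> R powr D" using y assms by (intro powr_mono2) auto
  finally show "x powr d \<le> M powr d * R powr D" unfolding eq by (intro mult_left_mono) auto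
qed

text \<open>On \<open>[M / R, M]\<close> the power \<open>x powr (c - k)\<close> stays within a
  factor \<open>R powr D\<close> of its value at \<open>M\<close> in either direction, which
  accounts for the lower bound and for the ratio \<open>R powr (2 * D)\<close>. The sign of the next
  difference is that of the constant \<open>b * fallfac c (Suc k)\<close>.\<close>

lemma diff_bounds_powr:
  fixes c b M R :: real and a N k :: nat
  assumes c: "c \<notin> \<int>" and a: "M / R \<le> real a" and N: "real a + real N \<le> M + 1"
    and MR: "M > 0" "R \<ge> 1" and D: "\<bar>c - real k\<bar> \<le> D" and b: "b * fallfac c k > 0"
  shows "diff_bounds k (\<lambda>n. b * (real a + real n) powr c) N
           (b * fallfac c k * M powr (c - real k) * R powr (-D)) (R powr (2 * D))"
proof -
  define F where "F i x = b * fallfac c i * x powr (c - real i)" for i x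
  have a0: "real a > 0" using a MR by (smt (verit) divide_pos_pos)
  have F: "(F i has_real_derivative F (Suc i) x) (at x)" if "x > 0" for i x
    unfolding F_def fallfac_Suc using that
    by (auto intro!: derivative_eq_intros simp: algebra_simps)
  have F0: "(\<lambda>n. b * (real a + real n) powr c) = (\<lambda>n. F 0 (real a + real n))"
    by (simp add: F_def fallfac_def)
  have mv: "\<exists>\<xi>. real a + real n \<le> \<xi> \<and> \<xi> \<le> real a + real n + real j \<and> (fdiff ^^ j) (\<lambda>n. F 0 (real a + real n)) n = F j \<xi>" for j n
    by (rule fdiff_funpow_mean_value) (use F a0 in auto)
  have 1: "b * fallfac c k * M powr (c - real k) * R powr (-D) \<le> (fdiff ^^ k) (\<lambda>n. F 0 (real a + real n)) n \<and>
    (fdiff ^^ k) (\<lambda>n. F 0 (real a + real n)) n \<le> R powr (2 * D) * (b * fallfac c k * M powr (c - real k) * R powr (-D))"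
    if n: "n + k < N" for n
  proof -
    from mv[of n k] obtain \<xi> where xi: "real a + real n \<le> \<xi>" "\<xi> \<le> real a + real n + real k"
      "(fdiff ^^ k) (\<lambda>n. F 0 (real a + real n)) n = F k \<xi>" by blast
    \<comment> \<open>\<open>n + k < N\<close> gives \<open>\<xi> \<le> a + N - 1\<close>, hence the
      \<open>+ 1\<close> in the hypothesis on \<open>a + N\<close>.\<close>
    have "M / R \<le> \<xi>" "\<xi> \<le> M" using xi a N n by linarith+
    note pb = powr_between[OF this MR D]
    have "R powr (2 * D) * R powr (-D) = R powr D" using MR by (simp add: powr_add[symmetric])
    hence e: "R powr (2 * D) * (b * fallfac c k * M powr (c - real k) * R powr (-D)) =
       b * fallfac c k * (M powr (c - real k) * R powr D)" by (metis mult.assoc mult.left_commute)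
    have "(fdiff ^^ k) (\<lambda>n. F 0 (real a + real n)) n = b * fallfac c k * \<xi> powr (c - real k)"
      using xi(3) by (simp add: F_def)
    thus ?thesis unfolding e
      using mult_left_mono[OF pb(1), of "b * fallfac c k"] mult_left_mono[OF pb(2), of "b * fallfac c k"] b
      by (simp add: mult.assoc)
  qed
  have 2: "(\<forall>n. n + Suc k < N \<longrightarrow> 0 \<le> (fdiff ^^ Suc k) (\<lambda>n. F 0 (real a + real n)) n) \<or>
      (\<forall>n. n + Suc k < N \<longrightarrow> (fdiff ^^ Suc k) (\<lambda>n. F 0 (real a + real n)) n \<le> 0)"
  proof (cases "b * fallfac c (Suc k) \<ge> 0")
    case True
    have "0 \<le> (fdiff ^^ Suc k) (\<lambda>n. F 0 (real a + real n)) n" for n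
      using mv[of n "Suc k"] True unfolding F_def by (metis mult_nonneg_nonneg powr_ge_zero)
    thus ?thesis by blast
  next
    case False
    have "(fdiff ^^ Suc k) (\<lambda>n. F 0 (real a + real n)) n \<le> 0" for n
      using mv[of n "Suc k"] False unfolding F_def by (metis mult_nonpos_nonneg powr_ge_zero linear)
    thus ?thesis by blast
  qed
  show ?thesis unfolding diff_bounds_def F0 using 1 2 by blast
qed

lemma norm_sum_ee_sign:
  assumes "\<bar>b\<bar> = \<bar>b'\<bar>"
  shows "norm (\<Sum>n\<in>A. ee (b * g n)) = norm (\<Sum>n\<in>A. ee (b' * g n))"
proof -
  have "b = b' \<or> b = - b'" using assms by linarith
  thus ?thesis
  proof
    assume "b = - b'"
    hence "(\<Sum>n\<in>A. ee (b * g n)) = cnj (\<Sum>n\<in>A. ee (b' * g n))" by (simp add: ee_minus)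
    thus ?thesis by (simp only: complex_mod_cnj)
  qed simp
qed

text \<open>The exponents -5/4 and -1/4 differ by exactly one, so some integer order hits the
  window. For \<open>l\<close> of this size the hypotheses of \<open>weyl_bound\<close> have room:
  \<open>l * M\<^sup>2\<close> is at least \<open>M powr (3/4)\<close> and
  \<open>l\<^sup>2 * M^3\<close> at least \<open>M powr (1/2)\<close>, while \<open>l\<close> itself
  is at most \<open>M powr (-1/4)\<close>.\<close>

lemma scale_index:
  fixes b M c :: real
  assumes "M > 1" "b > 0"
  obtains k :: int where "b * M powr (c - real_of_int k) \<ge> M powr (-5/4)"
    "b * M powr (c - real_of_int k) \<le> M powr (-1/4)"
proof -
  define t where "t = log M b"
  have b: "b = M powr t" using assms by (simp add: t_def)
  define k where "k = \<lfloor>t + c + 5/4\<rfloor>"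
  have k: "t + c - real_of_int k \<ge> -5/4" "t + c - real_of_int k \<le> -1/4"
    unfolding k_def by linarith+
  have e: "b * M powr (c - real_of_int k) = M powr (t + c - real_of_int k)"
    using assms unfolding b by (simp add: powr_add[symmetric] add_diff_eq)
  show ?thesis
    by (rule that[of k]) (unfold e, (rule powr_mono; use k assms in simp)+)
qed

text \<open>If the derivative of the phase at \<open>M\<close> is at most 1/2, Kusmin-Landau applies
  directly. Otherwise \<open>scale_index\<close> selects an order \<open>k\<close>, and
  \<open>weyl_bound\<close> is used with a power \<open>R1\<close> of \<open>R\<close>. All losses
  are powers of \<open>R\<close> with exponents depending on \<open>c\<close> only, and
  \<open>M \<ge> R powr E\<close> makes the fourth root of \<open>M\<close> exceed each of
  them.\<close>

lemma exponential_sum_tail_bound: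
  fixes c :: real
  assumes c: "c > 1" "c \<notin> \<int>"
  shows "\<exists>C E. C > 0 \<and> E \<ge> 1 \<and> (\<forall>R M a N b. R \<ge> C \<longrightarrow> M \<ge> R powr E \<longrightarrow> R powr E / M powr c \<le> b \<longrightarrow> b \<le> R \<longrightarrow>
      M / R \<le> real a \<longrightarrow> real a + real N \<le> M + 1 \<longrightarrow>
      norm (\<Sum>n<N. ee (b * (real a + real n) powr c)) \<le> 5 * M / R)"
proof -
  \<comment> \<open>No order above \<open>c + 2\<close> is ever selected, as shown further down, so
    \<open>K\<close> bounds the orders.\<close>
  define K :: nat where "K = nat \<lceil>c\<rceil> + 2"
  have K: "real K \<ge> c + 2" unfolding K_def by linarith
  define Q where "Q = 1 + (\<Sum>k\<le>K. \<bar>fallfac c k\<bar> + 1 / \<bar>fallfac c k\<bar>)"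
  have Q: "\<bar>fallfac c k\<bar> \<le> Q" "1 / \<bar>fallfac c k\<bar> \<le> Q" if "k \<le> K" for k
  proof -
    have "\<bar>fallfac c k\<bar> + 1 / \<bar>fallfac c k\<bar> \<le> (\<Sum>k\<le>K. \<bar>fallfac c k\<bar> + 1 / \<bar>fallfac c k\<bar>)"
      using that by (intro member_le_sum) auto
    thus "\<bar>fallfac c k\<bar> \<le> Q" "1 / \<bar>fallfac c k\<bar> \<le> Q" unfolding Q_def
      by (smt (verit) zero_le_divide_1_iff abs_ge_zero)+
  qed
  have Q1: "Q \<ge> 1" unfolding Q_def by (simp add: sum_nonneg)
  \<comment> \<open>\<open>weyl_bound\<close> saves only a root of order \<open>2 ^ (k - 1)\<close>
    of its parameter; the parameter \<open>R ^ w\<close> turns this into at least a full factor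
    \<open>R\<close>.\<close>
  define w :: nat where "w = 2 ^ K"
  \<comment> \<open>Exceeds every exponent of \<open>R\<close> met when the hypotheses of
    \<open>weyl_bound\<close> are checked: \<open>3 + 3 * K + 2 * w\<close>,
    \<open>4 + 2 * K + 2 * w\<close> and \<open>2 + K + w * K\<close>.\<close>
  define e :: nat where "e = 4 + 3 * K + 2 * w + w * K"
  \<comment> \<open>The 4 absorbs numerical constants, \<open>Q\<close> the coefficients
    \<open>fallfac c k\<close>, and \<open>(2 * c) ^ 8\<close> ensures
    \<open>2 * c \<le> G\<close>.\<close>
  define C where "C = max 4 (max Q ((2 * c) ^ 8))"
  define E where "E = 4 * real e"
  have "norm (\<Sum>n<N. ee (b * (real a + real n) powr c)) \<le> 5 * M / R"
    if R: "R \<ge> C" and M: "M \<ge> R powr E" and b1: "R powr E / M powr c \<le> b" and b2: "b \<le> R"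
      and a: "M / R \<le> real a" and N: "real a + real N \<le> M + 1" for R M b :: real and a N :: nat
  proof -
    have R4: "R \<ge> 4" "R \<ge> Q" "R \<ge> (2 * c) ^ 8" using R by (auto simp: C_def)
    \<comment> \<open>All sizes are measured in this root; the window of \<open>scale_index\<close>
      becomes \<open>[1 / G ^ 5, 1 / G]\<close>.\<close>
    define G where "G = M powr (1/4)"
    have Mpos: "M > 0" using M R4 by (smt (verit) powr_gt_zero)
    have MG: "M = G ^ 4" using Mpos unfolding G_def
      by (simp add: powr_powr flip: powr_realpow)
    have Gpos: "G > 0" using Mpos by (simp add: G_def)
    have GRe: "G \<ge> R ^ e"
    proof -
      have "(R powr E) powr (1/4) \<le> G" unfolding G_def using M R4 by (intro powr_mono2) auto
      also have "(R powr E) powr (1/4) = R ^ e" using R4 by (simp add: powr_powr E_def powr_realpow)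
      finally show ?thesis .
    qed
    have GR: "G \<ge> R ^ j" if "j \<le> e" for j
      using GRe power_increasing[OF that, of R] R4 by linarith
    have "R powr E / M powr c > 0" using Mpos R4 by simp
    hence bpos: "b > 0" using b1 by linarith
    have GR1: "G \<ge> R" using GR[of 1] by (simp add: e_def)
    have MR: "M \<ge> G"
    proof -
      have "G ^ 1 \<le> G ^ 4" using GR1 R4 by (intro power_increasing) auto
      thus ?thesis by (simp add: MG)
    qed
    define S where "S = norm (\<Sum>n<N. ee (b * (real a + real n) powr c))"
    show ?thesis
    proof (cases "b * c * M powr (c - 1) \<le> 1/2")
      case True
      define l where "l = b * fallfac c 1 * M powr (c - real 1) * R powr (-(c - 1))"
      have ff: "fallfac c 1 = c" by (simp add: fallfac_def)
      have lpos: "l > 0" using bpos c Mpos R4 unfolding l_def ff by simp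
      have "diff_bounds 1 (\<lambda>n. b * (real a + real n) powr c) N l (R powr (2 * (c - 1)))"
        unfolding l_def by (rule diff_bounds_powr) (use c a N Mpos R4 bpos ff in auto)
      \<comment> \<open>The ratio from \<open>diff_bounds_powr\<close> is too weak for
        Kusmin-Landau. The case assumption bounds the first difference by 1/2 directly, which is the
        ratio \<open>1 / (2 * l)\<close>.\<close>
      hence db: "diff_bounds 1 (\<lambda>n. b * (real a + real n) powr c) N l (1 / (2 * l))"
      proof -
        have "(fdiff ^^ 1) (\<lambda>n. b * (real a + real n) powr c) n \<le> 1/2" if "n + 1 < N" for n
        proof -
          define F where "F i x = b * fallfac c i * x powr (c - real i)" for i x
          have a0: "real a > 0" using a Mpos R4 by (smt (verit) divide_pos_pos)
          have F: "(F i has_real_derivative F (Suc i) x) (at x)" if "x > 0" for i x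
            unfolding F_def fallfac_Suc using that
            by (auto intro!: derivative_eq_intros simp: algebra_simps)
          have "\<exists>\<xi>. real a + real n \<le> \<xi> \<and> \<xi> \<le> real a + real n + real 1 \<and> (fdiff ^^ 1) (\<lambda>n. F 0 (real a + real n)) n = F 1 \<xi>"
            by (rule fdiff_funpow_mean_value) (use F a0 in auto)
          then obtain \<xi> where xi: "real a + real n \<le> \<xi>" "\<xi> \<le> real a + real n + real 1"
             "(fdiff ^^ 1) (\<lambda>n. F 0 (real a + real n)) n = F 1 \<xi>" by blast
          have F0: "(\<lambda>n. b * (real a + real n) powr c) = (\<lambda>n. F 0 (real a + real n))"
            by (simp add: F_def fallfac_def)
          have "\<xi> \<le> M" using xi N that by linarith
          hence "b * c * \<xi> powr (c - 1) \<le> b * c * M powr (c - 1)"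
            using xi a0 c bpos by (intro mult_left_mono powr_mono2) auto
          hence "F 1 \<xi> \<le> 1/2" using True unfolding F_def ff by simp
          thus ?thesis unfolding F0 using xi by simp
        qed
        thus ?thesis using \<open>diff_bounds 1 _ N l _\<close> lpos unfolding diff_bounds_def by auto
      qed
      show ?thesis
      \<comment> \<open>For \<open>N \<le> 1\<close> no first difference is constrained, so
        \<open>l \<le> 1/2\<close> cannot be read off; the sum is trivial then.\<close>
      proof (cases "N \<le> 1")
        case True
        have "S \<le> (\<Sum>n<N. norm (ee (b * (real a + real n) powr c)))" unfolding S_def by (rule norm_sum)
        also have "\<dots> \<le> 1" using True by simp
        also have "1 \<le> M / R" using MR GR1 R4 by (simp add: field_simps)
        also have "\<dots> \<le> 5 * M / R" using Mpos R4 by (simp add: field_simps)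
        finally show ?thesis by (simp add: S_def)
      next
        case False
        hence "0 + 1 < N" by simp
        hence "l \<le> 1 / (2 * l) * l" using db unfolding diff_bounds_def by (meson order.trans)
        hence l12: "l \<le> 1/2" using lpos by simp
        have "S \<le> 2 / l" unfolding S_def
          by (rule kusmin_landau_diff_bounds[OF db lpos]) (use lpos l12 in \<open>auto simp: field_simps\<close>)
        also have "2 / l \<le> 2 * M / R"
        proof -
          have "R * R powr (c - 1) \<le> c * (b * M powr c)"
          proof -
            have "R * R powr (c - 1) = R powr c" using R4 by (simp add: powr_mult_base)
            also have "\<dots> \<le> R powr E"
            proof (rule powr_mono)
              have "real K \<le> real e" by (simp add: e_def)
              thus "c \<le> E" using K unfolding E_def by linarith
            qed (use R4 in auto)
            also have "\<dots> \<le> b * M powr c" using b1 Mpos by (simp add: field_simps)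
            also have "\<dots> \<le> c * (b * M powr c)" using c bpos mult_right_mono[of 1 c "b * M powr c"] by simp
            finally show ?thesis .
          qed
          hence "R \<le> c * (b * M powr c) / R powr (c - 1)" using R4 by (simp add: pos_le_divide_eq)
          also have "M powr c = M * M powr (c - 1)" using Mpos by (simp add: powr_mult_base)
          also have "c * (b * (M * M powr (c - 1))) / R powr (c - 1) = M * l"
            unfolding l_def ff powr_minus_divide by simp
          finally have "R \<le> M * l" .
          thus ?thesis using lpos R4 by (simp add: field_simps)
        qed
        also have "\<dots> \<le> 5 * M / R" using Mpos R4 by (simp add: field_simps)
        finally show ?thesis by (simp add: S_def)
      qed
    next
      case False
      have M1: "M > 1" using MR GR1 R4 by linarith
      obtain k0 :: int where k0: "b * M powr (c - real_of_int k0) \<ge> M powr (-5/4)"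
        "b * M powr (c - real_of_int k0) \<le> M powr (-1/4)"
        using scale_index[OF M1 bpos, of c] by blast
      \<comment> \<open>An order below 2 would make the derivative at \<open>M\<close> at most
        \<open>c / G \<le> 1/2\<close>, the case excluded here.\<close>
      have "k0 \<ge> 2"
      proof (rule ccontr)
        assume "\<not> k0 \<ge> 2"
        hence "M powr (c - 1) \<le> M powr (c - real_of_int k0)" using M1 by (intro powr_mono) auto
        hence "b * M powr (c - 1) \<le> M powr (-1/4)" using k0(2) bpos by (smt (verit) mult_left_mono)
        also have "\<dots> = 1 / G" using Mpos by (simp add: G_def powr_minus field_simps)
        also have "\<dots> \<le> 1 / (2 * c)"
        proof -
          have "(2 * c) ^ 1 \<le> (2 * c) ^ 8" using c by (intro power_increasing) auto
          thus ?thesis using GR1 R4 c by (intro divide_left_mono) auto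
        qed
        finally show False using False c by (simp add: field_simps)
      qed
      \<comment> \<open>A larger order would bring \<open>b * M powr (c - k0)\<close> below the
        window, as \<open>b \<le> R \<le> M powr (1/4)\<close>.\<close>
      have "real_of_int k0 \<le> c + 2"
      proof (rule ccontr)
        assume *: "\<not> real_of_int k0 \<le> c + 2"
        have "M powr (-5/4) \<le> b * M powr (c - real_of_int k0)" by fact
        also have "\<dots> < b * M powr (-2)" using * M1 bpos by (intro mult_strict_left_mono powr_less_mono) auto
        also have "\<dots> \<le> M powr (1/4) * M powr (-2)" using b2 GR1 by (intro mult_right_mono) (auto simp: G_def)
        also have "\<dots> = M powr (-7/4)" by (simp add: powr_add[symmetric])
        finally show False using M1 by simp
      qed
      define k where "k = nat k0"
      have k: "k \<ge> 2" "real k = real_of_int k0" "k \<le> K" using \<open>k0 \<ge> 2\<close> \<open>real_of_int k0 \<le> c + 2\<close> K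
        by (auto simp: k_def)
      \<comment> \<open>\<open>weyl_bound\<close> wants a positive \<open>k\<close>-th difference;
        changing the sign of the phase conjugates the sum and keeps its norm.\<close>
      define s where "s = sgn (fallfac c k)"
      have s: "s * fallfac c k = \<bar>fallfac c k\<bar>" "\<bar>s\<bar> = 1" using fallfac_nonzero[OF c(2), of k]
        by (auto simp: s_def sgn_if)
      define P where "P = \<bar>fallfac c k\<bar>"
      have P: "P > 0" "P \<le> R" "1 / R \<le> P"
        using fallfac_nonzero[OF c(2), of k] Q[OF k(3)] R4 Q1 unfolding P_def
        by (auto simp: field_simps) (smt (verit) mult_right_mono abs_ge_zero)
      define B where "B = b * M powr (c - real k)"
      have B: "1 / G ^ 5 \<le> B" "B \<le> 1 / G"
      proof -
        have "M powr (-1/4) = 1 / G" using Mpos by (simp add: G_def powr_minus field_simps)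
        thus "B \<le> 1 / G" using k0 by (simp add: B_def k)
        have "G ^ 5 = M powr (5/4)" using Mpos unfolding G_def by (simp add: powr_powr flip: powr_realpow)
        hence "M powr (-5/4) = 1 / G ^ 5" using Mpos by (simp add: powr_minus field_simps)
        thus "B \<ge> 1 / G ^ 5" using k0 by (simp add: B_def k)
      qed
      \<comment> \<open>The lower bound of \<open>diff_bounds_powr\<close> for \<open>D = K\<close>,
        which is allowed since \<open>\<bar>c - k\<bar> \<le> K\<close>.\<close>
      define l where "l = B * P / R ^ K"
      define CC where "CC = R ^ (2 * K)"
      have ck: "\<bar>c - real k\<bar> \<le> real K" using K k c by (simp add: abs_le_iff)
      have "diff_bounds k (\<lambda>n. (s * b) * (real a + real n) powr c) N
           ((s * b) * fallfac c k * M powr (c - real k) * R powr (-real K)) (R powr (2 * real K))"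
      proof (rule diff_bounds_powr[OF c(2) a N Mpos _ ck])
        have e: "(s * b) * fallfac c k = b * P" using s(1) by (simp add: P_def mult_ac)
        show "(s * b) * fallfac c k > 0" unfolding e using bpos P(1) by simp
      qed (use R4 in simp)
      moreover have "(s * b) * fallfac c k * M powr (c - real k) * R powr (-real K) = l"
      proof -
        have "(s * b) * fallfac c k = b * P" using s(1) by (simp add: P_def mult_ac)
        moreover have "R powr (- real K) = 1 / R ^ K" using R4 by (simp add: powr_minus_divide powr_realpow)
        ultimately show ?thesis by (simp only: l_def B_def) simp
      qed
      moreover have "R powr (2 * real K) = CC" using R4 by (simp add: CC_def flip: powr_realpow)
      ultimately have db: "diff_bounds k (\<lambda>n. (s * b) * (real a + real n) powr c) N l CC" by simp
      define R1 where "R1 = R ^ w"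
      have RR: "R ^ i \<le> R ^ j" if "i \<le> j" for i j using that R4 by (intro power_increasing) auto
      have R1p: "R ^ i \<ge> 1" for i using RR[of 0 i] by simp
      have lpos: "l > 0"
      proof -
        have "B > 0" using bpos Mpos by (simp add: B_def)
        thus ?thesis using P R4 by (simp add: l_def)
      qed
      have B0: "B \<ge> 0" using bpos by (simp add: B_def)
      have l_lower: "l * (G ^ 5 * R ^ Suc K) \<ge> 1"
      proof -
        have "1 = (1 / G ^ 5) * (1 / R) / R ^ K * (G ^ 5 * R ^ Suc K)" using Gpos R4 by simp
        also have "\<dots> \<le> l * (G ^ 5 * R ^ Suc K)" unfolding l_def
          using B B0 P Gpos R4 by (intro mult_right_mono divide_right_mono mult_mono) auto
        finally show ?thesis .
      qed
      have l_upper: "l * G * R ^ K \<le> R"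
      proof -
        have "l * G * R ^ K = (B * G) * P" using R4 by (simp add: l_def)
        also have "\<dots> \<le> 1 * R" using B P Gpos by (intro mult_mono) (auto simp: field_simps)
        finally show ?thesis by simp
      qed
      have four: "4 \<le> R" "16 \<le> R ^ 2" using R4 power_mono[of 4 R 2] by auto
      have "S = norm (\<Sum>n<N. ee ((s * b) * (real a + real n) powr c))"
        unfolding S_def by (rule norm_sum_ee_sign) (use s in \<open>simp add: abs_mult\<close>)
      also have "\<dots> \<le> 5 * M * R1 powr (-((1/2) ^ (k - 1)))"
      proof (rule weyl_bound[OF k(1) db])
        show "real N \<le> M" using N a Mpos R4 by (smt (verit) divide_pos_pos of_nat_less_0_iff of_nat_0_less_iff One_nat_def Suc_leI of_nat_1 of_nat_le_iff)
        show "CC \<ge> 1" unfolding CC_def by (rule R1p)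
        show R11: "R1 \<ge> 1" unfolding R1_def by (rule R1p)
        show "l > 0" by fact
        show "M \<ge> 2 * R1"
        proof -
          have "2 * R1 \<le> R * R ^ w" using R4 by (simp add: R1_def)
          also have "\<dots> \<le> G" using GR[of "Suc w"] by (simp add: e_def)
          finally show ?thesis using MR by linarith
        qed
        show "16 * CC * R1\<^sup>2 \<le> l * M\<^sup>2"
        proof -
          have "16 * CC * R1\<^sup>2 \<le> R ^ 2 * CC * R1\<^sup>2" using four by (intro mult_right_mono) (auto simp: CC_def R4(1))
          also have "\<dots> = R ^ (2 + 2 * K + 2 * w)" by (simp add: CC_def R1_def power_add power_mult power2_eq_square power_mult_distrib)
          finally have 1: "16 * CC * R1\<^sup>2 \<le> R ^ (2 + 2 * K + 2 * w)" .
          have "R ^ (2 + 2 * K + 2 * w) * R ^ Suc K = R ^ (3 + 3 * K + 2 * w)"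
            by (simp only: power_add[symmetric]) (rule arg_cong[of _ _ "power R"], simp)
          also have "\<dots> \<le> G ^ 3"
            using GR[of "3 + 3 * K + 2 * w"] GR1 R4 power_increasing[of 1 3 G] by (simp add: e_def)
          also have "\<dots> \<le> G ^ 3 * (l * (G ^ 5 * R ^ Suc K))"
            using mult_left_mono[OF l_lower, of "G ^ 3"] Gpos by simp
          also have "\<dots> = (l * M\<^sup>2) * R ^ Suc K" by (simp add: MG power_mult[symmetric] power_add[symmetric] mult_ac)
          finally have "R ^ (2 + 2 * K + 2 * w) \<le> l * M\<^sup>2" using R4 by (simp del: power_Suc)
          thus ?thesis using 1 by linarith
        qed
        show "8 * R1\<^sup>2 \<le> l\<^sup>2 * M ^ 3"
        proof -
          have "8 * R1\<^sup>2 \<le> R ^ 2 * R1\<^sup>2" using four by (intro mult_right_mono) auto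
          also have "\<dots> = R ^ (2 + 2 * w)" by (simp add: R1_def power_add power_mult power2_eq_square power_mult_distrib)
          finally have 1: "8 * R1\<^sup>2 \<le> R ^ (2 + 2 * w)" .
          have "R ^ (2 + 2 * w) * (R ^ Suc K)\<^sup>2 = R ^ (4 + 2 * K + 2 * w)"
            by (simp only: power_add[symmetric] power_mult[symmetric]) (rule arg_cong[of _ _ "power R"], simp)
          also have "\<dots> \<le> G ^ 2"
            using GR[of "4 + 2 * K + 2 * w"] GR1 R4 power_increasing[of 1 2 G] by (simp add: e_def)
          also have "\<dots> \<le> G ^ 2 * (l * (G ^ 5 * R ^ Suc K))\<^sup>2"
            using mult_left_mono[OF one_le_power[OF l_lower, of 2], of "G ^ 2"] Gpos by simp
          also have "\<dots> = (l\<^sup>2 * M ^ 3) * (R ^ Suc K)\<^sup>2"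
            by (simp add: MG power_mult[symmetric] power_mult_distrib power_add[symmetric] mult_ac del: power_Suc)
          finally have "R ^ (2 + 2 * w) \<le> l\<^sup>2 * M ^ 3" using R4 by (simp del: power_Suc)
          thus ?thesis using 1 by linarith
        qed
        show "4 * CC * l * R1 ^ (k - 1) \<le> 1"
        proof -
          have "R1 ^ (k - 1) \<le> R ^ (w * K)" unfolding R1_def power_mult[symmetric]
            using k by (intro RR) auto
          hence "4 * CC * l * R1 ^ (k - 1) \<le> R * CC * l * R ^ (w * K)"
            using four lpos R1p[of "2*K"] R11 by (intro mult_mono) (auto simp: CC_def)
          hence "4 * CC * l * R1 ^ (k - 1) * G \<le> (R * CC * l * R ^ (w * K)) * G"
            using Gpos by (intro mult_right_mono) auto
          also have "\<dots> = (l * G * R ^ K) * (R * R ^ K * R ^ (w * K))"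
          proof -
            have "CC = R ^ K * R ^ K" by (simp add: CC_def mult_2 power_add)
            thus ?thesis by (simp add: mult_ac)
          qed
          also have "\<dots> \<le> R * (R * R ^ K * R ^ (w * K))"
            using l_upper R4 by (intro mult_right_mono) auto
          also have "\<dots> = R ^ (2 + K + w * K)" by (simp add: power_add power2_eq_square)
          also have "\<dots> \<le> G" by (rule GR) (simp add: e_def)
          finally show ?thesis using Gpos by simp
        qed
      qed
      also have "R1 powr (-((1/2) ^ (k - 1))) \<le> 1 / R"
      proof -
        have "(2::real) ^ (k - 1) \<le> 2 ^ K" using k by (intro power_increasing) auto
        hence "real w * (1/2) ^ (k - 1) \<ge> 1" by (simp add: w_def power_divide)
        hence "R powr (- (real w * (1/2) ^ (k - 1))) \<le> R powr (-1)"
          using R4 by (intro powr_mono) auto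
        also have "\<dots> = 1 / R" using R4 by (simp add: powr_minus field_simps)
        finally show ?thesis using R4 by (simp add: R1_def powr_powr flip: powr_realpow)
      qed
      hence "5 * M * R1 powr (-((1/2) ^ (k - 1))) \<le> 5 * M * (1 / R)"
        using Mpos by (intro mult_left_mono) auto
      finally show ?thesis by (simp add: S_def)
    qed
  qed
  moreover have "C > 0" "E \<ge> 1" by (auto simp: C_def E_def e_def)
  ultimately show ?thesis by blast
qed

text \<open>The terms below \<open>M / R\<close>, where the derivatives are not of comparable size,
  are estimated trivially. Values \<open>R < C\<close> are covered by enlarging the constant,
  negative \<open>b\<close> by conjugation.\<close>

theorem exponential_sum_bound:
  fixes c :: real
  assumes c: "c > 1" "c \<notin> \<int>"
  shows "\<exists>C E. C > 0 \<and> E \<ge> 1 \<and> (\<forall>R (M::nat) b. R \<ge> 1 \<longrightarrow> real M \<ge> R powr E \<longrightarrow>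
      R powr E / real M powr c \<le> \<bar>b\<bar> \<longrightarrow> \<bar>b\<bar> \<le> R \<longrightarrow>
      norm (\<Sum>m=1..M. ee (b * real m powr c)) \<le> C * real M / R)"
proof -
  obtain C E where CE: "C > 0" "E \<ge> 1"
    and bd: "\<And>R M a N b. R \<ge> C \<Longrightarrow> M \<ge> R powr E \<Longrightarrow> R powr E / M powr c \<le> b \<Longrightarrow> b \<le> R \<Longrightarrow>
      M / R \<le> real a \<Longrightarrow> real a + real N \<le> M + 1 \<Longrightarrow>
      norm (\<Sum>n<N. ee (b * (real a + real n) powr c)) \<le> 5 * M / R"
    using exponential_sum_tail_bound[OF assms] by blast
  have "norm (\<Sum>m=1..M. ee (b * real m powr c)) \<le> (C + 6) * real M / R"
    if R: "R \<ge> 1" "real M \<ge> R powr E" "R powr E / real M powr c \<le> \<bar>b\<bar>" "\<bar>b\<bar> \<le> R" for R b and M :: nat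
  proof (cases "R \<ge> C")
    case False
    have "norm (\<Sum>m=1..M. ee (b * real m powr c)) \<le> (\<Sum>m=1..M. norm (ee (b * real m powr c)))" by (rule norm_sum)
    also have "\<dots> = real M" by simp
    also have "\<dots> \<le> (C + 6) * real M / R"
      using False R CE mult_right_mono[of R "C + 6" "real M"] by (simp add: field_simps)
    finally show ?thesis .
  next
    case True
    have "R powr 1 \<le> R powr E" using R CE by (intro powr_mono) auto
    hence MR: "real M \<ge> R" using R by simp
    define a where "a = nat \<lceil>real M / R\<rceil>"
    have "real M / R \<ge> 1" using MR R by (simp add: field_simps)
    hence a: "real a \<ge> M / R" "real a \<le> M / R + 1" "a \<ge> 1" "real a < M / R + 1" unfolding a_def by linarith+
    have "real M / R \<le> real M" using R mult_left_mono[of 1 R "real M"] by (simp add: field_simps)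
    hence aM: "a \<le> M" using a unfolding a_def by linarith
    define N where "N = Suc M - a"
    have "norm (\<Sum>m=1..M. ee (b * real m powr c)) = norm (\<Sum>m=1..M. ee (\<bar>b\<bar> * real m powr c))"
      by (rule norm_sum_ee_sign) auto
    also have "(\<Sum>m=1..M. ee (\<bar>b\<bar> * real m powr c)) =
       (\<Sum>m\<in>{1..<a}. ee (\<bar>b\<bar> * real m powr c)) + (\<Sum>m\<in>{a..M}. ee (\<bar>b\<bar> * real m powr c))"
    proof -
      have "{1..M} = {1..<a} \<union> {a..M}" using a aM by auto
      thus ?thesis by (simp only:) (rule sum.union_disjoint; auto)
    qed
    also have "(\<Sum>m\<in>{a..M}. ee (\<bar>b\<bar> * real m powr c)) = (\<Sum>n<N. ee (\<bar>b\<bar> * (real a + real n) powr c))"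
      by (rule sum.reindex_bij_witness[of _ "\<lambda>n. a + n" "\<lambda>m. m - a"]) (use aM in \<open>auto simp: N_def of_nat_diff\<close>)
    also have "norm ((\<Sum>m\<in>{1..<a}. ee (\<bar>b\<bar> * real m powr c)) + (\<Sum>n<N. ee (\<bar>b\<bar> * (real a + real n) powr c)))
       \<le> real M / R + 5 * real M / R"
    proof (rule norm_triangle_mono)
      have "norm (\<Sum>m\<in>{1..<a}. ee (\<bar>b\<bar> * real m powr c)) \<le> (\<Sum>m\<in>{1..<a}. norm (ee (\<bar>b\<bar> * real m powr c)))" by (rule norm_sum)
      also have "\<dots> = real a - 1" using a by (simp add: of_nat_diff)
      finally show "norm (\<Sum>m\<in>{1..<a}. ee (\<bar>b\<bar> * real m powr c)) \<le> M / R" using a by linarith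
      show "norm (\<Sum>n<N. ee (\<bar>b\<bar> * (real a + real n) powr c)) \<le> 5 * real M / R"
        by (rule bd) (use True R a aM in \<open>auto simp: N_def of_nat_diff\<close>)
    qed
    also have "real M / R + 5 * real M / R \<le> (C + 6) * real M / R" using CE R by (simp add: field_simps)
    finally show ?thesis .
  qed
  thus ?thesis using CE by (intro exI[of _ "C + 6"] exI[of _ E]) auto
qed

section \<open>Removing the floor function\<close>

lemma sin_ge_half:
  fixes x :: real assumes "0 \<le> x" "x \<le> pi / 2" shows "x / 2 \<le> sin x"
proof -
  define u where "u = x / 2"
  have u: "0 \<le> u" "u \<le> pi" "x = 2 * u" using assms pi_gt_zero by (auto simp: u_def)
  have "cos x \<ge> 0" using assms by (intro cos_ge_zero) auto
  hence c: "(cos u)\<^sup>2 \<ge> 1/2" using cos_double_cos[of u] u by simp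
  have c0: "cos u \<ge> 0" using assms by (intro cos_ge_zero) (auto simp: u_def)
  have "x / 2 = 2 * u * (1/2)" using u by simp
  also have "\<dots> \<le> 2 * u * (cos u)\<^sup>2" using c u by (intro mult_left_mono) auto
  also have "\<dots> = 2 * (u * cos u) * cos u" by (simp add: power2_eq_square)
  also have "\<dots> \<le> 2 * sin u * cos u"
    using x_cos_le_sin[of u] u c0 by (intro mult_right_mono mult_left_mono) auto
  also have "\<dots> = sin x" using u by (simp add: sin_double)
  finally show ?thesis .
qed

lemma norm_ee_minus_one: "norm (ee t - 1) = 2 * \<bar>sin (pi * t)\<bar>"
proof -
  define x where "x = pi * t"
  have e: "ee t - 1 = Complex (- 2 * (sin x)\<^sup>2) (2 * sin x * cos x)"
    using cos_double_sin[of x] by (simp add: ee_def x_def complex_eq_iff sin_double mult.assoc)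
  have "(- 2 * (sin x)\<^sup>2)\<^sup>2 + (2 * sin x * cos x)\<^sup>2 = (2 * sin x)\<^sup>2 * ((sin x)\<^sup>2 + (cos x)\<^sup>2)"
    by (simp only: power2_eq_square) algebra
  hence "norm (ee t - 1) = sqrt ((2 * sin x)\<^sup>2)"
    by (simp only: e cmod_def complex.sel sin_cos_squared_add mult_1_right)
  thus ?thesis by (simp only: real_sqrt_abs abs_mult x_def abs_numeral)
qed

lemma norm_ee_diff_le: "norm (ee s - ee t) \<le> 2 * pi * \<bar>s - t\<bar>"
proof -
  have "ee s - ee t = ee t * (ee (s - t) - 1)" by (simp add: ee_add[symmetric] algebra_simps)
  hence "norm (ee s - ee t) = 2 * \<bar>sin (pi * (s - t))\<bar>" by (simp add: norm_mult norm_ee_minus_one)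
  also have "\<dots> \<le> 2 * \<bar>pi * (s - t)\<bar>" by (intro mult_left_mono abs_sin_x_le_abs_x) auto
  finally show ?thesis by (simp add: abs_mult)
qed

text \<open>After reduction to the nearest integer, \<open>sin u \<ge> u / 2\<close> on
  \<open>[0, pi / 2]\<close> makes the chord at least \<open>pi\<close> times the distance.\<close>

lemma norm_ee_minus_one_ge:
  assumes d: "\<And>z::int. \<bar>y - of_int z\<bar> \<ge> d"
  shows "norm (ee y - 1) \<ge> 3 * d"
proof -
  define t where "t = y - of_int (round y)"
  have t: "\<bar>t\<bar> \<le> 1/2" unfolding t_def using of_int_round_abs_le[of y] by (simp add: abs_minus_commute)
  have "ee y = ee t" by (simp add: t_def ee_diff)
  hence "norm (ee y - 1) = 2 * \<bar>sin (pi * t)\<bar>" by (simp add: norm_ee_minus_one)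
  also have "\<bar>sin (pi * t)\<bar> = sin (pi * \<bar>t\<bar>)"
  proof -
    have "pi * \<bar>t\<bar> \<le> pi * 1" using t by (intro mult_left_mono) auto
    hence "sin (pi * \<bar>t\<bar>) \<ge> 0" by (intro sin_ge_zero) auto
    thus ?thesis by (cases "t \<ge> 0") auto
  qed
  also have "2 * sin (pi * \<bar>t\<bar>) \<ge> 2 * (pi * \<bar>t\<bar> / 2)"
    using t by (intro mult_left_mono sin_ge_half) auto
  hence "2 * sin (pi * \<bar>t\<bar>) \<ge> 3 * \<bar>t\<bar>"
    using mult_right_mono[of 3 pi "\<bar>t\<bar>"] pi_gt3 by simp
  moreover have "\<bar>t\<bar> \<ge> d" using d[of "round y"] by (simp add: t_def)
  ultimately show ?thesis by linarith
qed

section \<open>The Fejer kernel\<close>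

text \<open>Kept as a double sum of characters, so that sums over \<open>m\<close> can be moved
  inside; \<open>fejer_eq\<close> shows that it is real and nonnegative.\<close>

definition fejer :: "nat \<Rightarrow> real \<Rightarrow> complex" where
  "fejer K x = (1 / of_nat K) * (\<Sum>j<K. \<Sum>j'<K. ee ((real j - real j') * x))"

lemma fejer_eq: "fejer K x = of_real ((norm (\<Sum>j<K. ee (real j * x)))\<^sup>2 / real K)"
proof -
  have A: "(\<Sum>j<K. \<Sum>j'<K. ee ((real j - real j') * x)) = (\<Sum>j<K. ee (real j * x)) * cnj (\<Sum>j<K. ee (real j * x))"
    by (simp only: cnj_sum sum_product left_diff_distrib ee_diff)
  show ?thesis unfolding fejer_def A complex_norm_square[symmetric] by simp
qed

lemma of_real_norm_fejer: "of_real (norm (fejer K x)) = fejer K x"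
  by (subst (1 2) fejer_eq) (simp only: norm_of_real, simp)

lemma norm_fejer: "norm (fejer K x) = (norm (\<Sum>j<K. ee (real j * x)))\<^sup>2 / real K"
  by (simp add: fejer_eq norm_divide norm_power)

lemma ee_power: "ee (real j * x) = ee x ^ j"
  by (simp only: ee_def Complex.DeMoivre) (simp add: mult_ac)

text \<open>Away from the integers the geometric series is at most
  \<open>2 / norm (ee y - 1)\<close>, whatever its length.\<close>

lemma fejer_upper:
  assumes d: "\<And>z::int. \<bar>y - of_int z\<bar> \<ge> d" and "d > 0" "K > 0"
  shows "norm (fejer K y) \<le> 1 / (2 * d\<^sup>2 * real K)"
proof -
  have n: "norm (ee y - 1) \<ge> 3 * d" by (rule norm_ee_minus_one_ge[OF d])
  hence ne: "ee y \<noteq> 1" using assms by auto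
  have "(\<Sum>j<K. ee (real j * y)) = (ee y ^ K - 1) / (ee y - 1)"
    unfolding ee_power using geometric_sum[OF ne, of K] by simp
  hence "norm (\<Sum>j<K. ee (real j * y)) = norm (ee y ^ K - 1) / norm (ee y - 1)"
    by (simp add: norm_divide)
  also have "\<dots> \<le> 2 / (3 * d)"
  proof (rule frac_le)
    show "norm (ee y ^ K - 1) \<le> 2" using norm_triangle_ineq4[of "ee y ^ K" 1] by (simp add: norm_power)
  qed (use n assms in auto)
  finally have "(norm (\<Sum>j<K. ee (real j * y)))\<^sup>2 \<le> (2 / (3 * d))\<^sup>2" by (intro power_mono) auto
  hence "norm (fejer K y) \<le> (2 / (3 * d))\<^sup>2 / real K" unfolding norm_fejer by (intro divide_right_mono) auto
  also have "\<dots> \<le> 1 / (2 * d\<^sup>2 * real K)" using assms by (simp add: field_simps power2_eq_square)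
  finally show ?thesis .
qed

text \<open>Close to an integer all phases stay within an angle \<open>pi / 3\<close>, so every
  summand has real part at least 1/2. This lets the kernel count points near the integers.\<close>

lemma fejer_lower:
  assumes "\<bar>y - of_int z\<bar> \<le> 1 / (6 * real K)" "K > 0"
  shows "norm (fejer K y) \<ge> real K / 4"
proof -
  define t where "t = y - of_int z"
  have "ee (real j * y) = ee (real j * t)" for j
  proof -
    have "real j * y = real j * t + of_int (int j * z)" by (simp add: t_def algebra_simps)
    thus ?thesis by (simp only: ee_add ee_of_int mult_1_right)
  qed
  hence eq: "(\<Sum>j<K. ee (real j * y)) = (\<Sum>j<K. ee (real j * t))" by simp
  have c: "Re (ee (real j * t)) \<ge> 1/2" if "j < K" for j
  proof -
    have "real j * \<bar>t\<bar> \<le> real K * (1 / (6 * real K))" using assms that by (intro mult_mono) (auto simp: t_def)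
    hence "real j * \<bar>t\<bar> \<le> 1/6" using assms by simp
    hence le: "2 * pi * (real j * \<bar>t\<bar>) \<le> pi / 3" using mult_left_mono[of "real j * \<bar>t\<bar>" "1/6" "2*pi"] by simp
    have "Re (ee (real j * t)) = cos (2 * pi * (real j * \<bar>t\<bar>))"
      by (cases "t \<ge> 0") (auto simp: ee_def)
    also have "\<dots> \<ge> cos (pi / 3)" using le by (intro cos_monotone_0_pi_le) auto
    finally show ?thesis by (simp add: cos_60)
  qed
  have "real K / 2 = (\<Sum>j<K. 1/2)" by simp
  also have "\<dots> \<le> (\<Sum>j<K. Re (ee (real j * t)))" by (intro sum_mono c) auto
  also have "\<dots> = Re (\<Sum>j<K. ee (real j * t))" by simp
  also have "\<dots> \<le> norm (\<Sum>j<K. ee (real j * t))" by (rule complex_Re_le_cmod)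
  finally have "(real K / 2)\<^sup>2 \<le> (norm (\<Sum>j<K. ee (real j * t)))\<^sup>2" by (intro power_mono) auto
  thus ?thesis unfolding norm_fejer eq using assms by (simp add: field_simps power2_eq_square)
qed

lemma sum_ee_roots:
  assumes "\<not> int Q dvd j" "Q > 0"
  shows "(\<Sum>r<Q. ee (of_int j * (real r / real Q))) = 0"
proof -
  define y where "y = of_int j / real Q"
  have "ee y \<noteq> 1"
  proof
    assume "ee y = 1"
    hence "sin (pi * y) = 0" using norm_ee_minus_one[of y] by simp
    then obtain k :: int where "pi * y = of_int k * pi" by (auto simp: sin_zero_iff_int2)
    hence "y = of_int k" by simp
    hence "real_of_int j = real_of_int (k * int Q)" using assms by (simp add: y_def field_simps)
    hence "j = k * int Q" by linarith
    thus False using assms by simp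
  qed
  have "(\<Sum>r<Q. ee (of_int j * (real r / real Q))) = (\<Sum>r<Q. ee y ^ r)"
    by (intro sum.cong) (auto simp: ee_power[symmetric] y_def field_simps)
  also have "\<dots> = (ee y ^ Q - 1) / (ee y - 1)" by (rule geometric_sum) fact
  also have "ee y ^ Q = ee (of_int j)" using assms by (simp add: ee_power[symmetric] y_def)
  finally show ?thesis by simp
qed

text \<open>Averaging over the \<open>K\<close>-th roots of unity kills all pairs
  \<open>j \<noteq> j'\<close>. The translates thus form an exact partition of unity, and a sampled
  average against them is a genuine weighted mean.\<close>

lemma fejer_partition:
  assumes "K > 0"
  shows "(\<Sum>r<K. fejer K (x - real r / real K)) = of_nat K"
proof -
  have e: "ee ((real j - real j') * (x - real r / real K)) =
       ee ((real j - real j') * x) * ee (of_int (int j' - int j) * (real r / real K))" for j j' r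
    by (simp only: ee_add[symmetric]) (rule arg_cong[of _ _ ee], simp add: algebra_simps diff_divide_distrib)
  have s: "(\<Sum>r<K. ee (of_int (int j' - int j) * (real r / real K))) = (if j' = j then of_nat K else 0)"
    if "j < K" "j' < K" for j j'
  proof (cases "j' = j")
    case False
    have "\<not> int K dvd (int j' - int j)"
    proof
      assume "int K dvd (int j' - int j)"
      moreover have "\<bar>int j' - int j\<bar> < int K" "int j' - int j \<noteq> 0" using that False by auto
      ultimately show False using zdvd_imp_le[of "int K" "\<bar>int j' - int j\<bar>"] by auto
    qed
    from sum_ee_roots[OF this assms] False show ?thesis by simp
  qed simp
  have "(\<Sum>r<K. fejer K (x - real r / real K)) =
     (1 / of_nat K) * (\<Sum>r<K. \<Sum>j<K. \<Sum>j'<K. ee ((real j - real j') * x) * ee (of_int (int j' - int j) * (real r / real K)))"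
    unfolding fejer_def e by (simp only: sum_distrib_left)
  also have "(\<Sum>r<K. \<Sum>j<K. \<Sum>j'<K. ee ((real j - real j') * x) * ee (of_int (int j' - int j) * (real r / real K)))
     = (\<Sum>j<K. \<Sum>j'<K. \<Sum>r<K. ee ((real j - real j') * x) * ee (of_int (int j' - int j) * (real r / real K)))"
    by (subst sum.swap, rule sum.cong[OF refl], rule sum.swap)
  also have "\<dots> = (\<Sum>j<K. \<Sum>j'<K. ee ((real j - real j') * x) * (if j' = j then of_nat K else 0))"
    by (intro sum.cong refl) (simp only: sum_distrib_left[symmetric] s lessThan_iff)
  also have "\<dots> = (\<Sum>j<K. of_nat K)"
    by (intro sum.cong refl) (simp add: if_distrib cong: if_cong)
  finally show ?thesis using assms by simp
qed

text \<open>The diagonal pairs contribute \<open>card A\<close>; all others are exponential sums at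
  nonzero integer frequencies below \<open>L\<close>.\<close>

lemma sum_fejer_bound:
  fixes x :: "'a \<Rightarrow> real"
  assumes W: "\<And>k::int. k \<noteq> 0 \<Longrightarrow> \<bar>k\<bar> < int L \<Longrightarrow> norm (\<Sum>m\<in>A. ee (of_int k * x m)) \<le> W" and L: "L > 0" "W \<ge> 0"
  shows "(\<Sum>m\<in>A. norm (fejer L (x m))) \<le> real (card A) + real L * W"
proof -
  have "of_real (\<Sum>m\<in>A. norm (fejer L (x m))) = (\<Sum>m\<in>A. fejer L (x m))"
    by (simp add: of_real_norm_fejer)
  also have "\<dots> = (1 / of_nat L) * (\<Sum>m\<in>A. \<Sum>j<L. \<Sum>j'<L. ee ((real j - real j') * x m))"
    unfolding fejer_def by (simp only: sum_distrib_left)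
  also have "(\<Sum>m\<in>A. \<Sum>j<L. \<Sum>j'<L. ee ((real j - real j') * x m)) = (\<Sum>j<L. \<Sum>j'<L. \<Sum>m\<in>A. ee ((real j - real j') * x m))"
    by (subst sum.swap, rule sum.cong[OF refl], rule sum.swap)
  finally have "norm (complex_of_real (\<Sum>m\<in>A. norm (fejer L (x m)))) =
     norm ((1 / of_nat L) * (\<Sum>j<L. \<Sum>j'<L. \<Sum>m\<in>A. ee ((real j - real j') * x m)))" by simp
  also have "\<dots> = (1 / real L) * norm (\<Sum>j<L. \<Sum>j'<L. \<Sum>m\<in>A. ee ((real j - real j') * x m))"
    by (simp add: norm_mult norm_divide)
  also have "\<dots> \<le> (1 / real L) * (\<Sum>j<L. \<Sum>j'<L. (if j' = j then real (card A) else W))"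
  proof (rule mult_left_mono, rule order.trans[OF norm_sum], rule sum_mono, rule order.trans[OF norm_sum], rule sum_mono)
    fix j j' assume j: "j \<in> {..<L}" "j' \<in> {..<L}"
    show "norm (\<Sum>m\<in>A. ee ((real j - real j') * x m)) \<le> (if j' = j then real (card A) else W)"
    proof (cases "j' = j")
      case False
      have "norm (\<Sum>m\<in>A. ee (of_int (int j - int j') * x m)) \<le> W" by (rule W) (use j False in auto)
      thus ?thesis using False by simp
    qed simp
  qed (use L in auto)
  also have "(\<Sum>j<L. \<Sum>j'<L. (if j' = j then real (card A) else W)) \<le> (\<Sum>j<L. real (card A) + real L * W)"
  proof (intro sum_mono)
    fix j assume j: "j \<in> {..<L}"
    have "(\<Sum>j'<L. (if j' = j then real (card A) else W)) \<le> (\<Sum>j'<L. (if j' = j then real (card A) else 0) + W)"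
      by (intro sum_mono) (use L in auto)
    also have "\<dots> = real (card A) + real L * W" using j by (simp add: sum.distrib)
    finally show "(\<Sum>j'<L. (if j' = j then real (card A) else W)) \<le> real (card A) + real L * W" .
  qed
  hence "(1 / real L) * (\<Sum>j<L. \<Sum>j'<L. (if j' = j then real (card A) else W)) \<le> (1 / real L) * (\<Sum>j<L. real (card A) + real L * W)"
    by (intro mult_left_mono) auto
  also have "(1 / real L) * (\<Sum>j<L. real (card A) + real L * W) = real (card A) + real L * W" using L by simp
  finally have "\<bar>\<Sum>m\<in>A. norm (fejer L (x m))\<bar> \<le> real (card A) + real L * W"
    by (simp only: norm_of_real)
  thus ?thesis by simp
qed

text \<open>The \<open>1\<close>-periodic function \<open>g (frac x)\<close> jumps at the integers, so \<open>x\<close> has to keep away from them.\<close>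
lemma fejer_approx:
  fixes g :: "real \<Rightarrow> complex"
  assumes K: "K > 0" and d: "0 < d" "\<And>z::int. \<bar>x - of_int z\<bar> \<ge> d"
    and lip: "\<And>s t. norm (g s - g t) \<le> 4 * \<bar>s - t\<bar>" and g1: "\<And>s. norm (g s) \<le> 1"
  shows "norm ((\<Sum>r<K. g (real r / real K) * fejer K (x - real r / real K)) / of_nat K - g (frac x)) \<le> 4 * d + 1 / (d\<^sup>2 * real K)"
proof -
  define w where "w r = norm (fejer K (x - real r / real K))" for r
  have fw: "fejer K (x - real r / real K) = of_real (w r)" for r
    by (simp add: w_def of_real_norm_fejer)
  have sw: "(\<Sum>r<K. w r) = real K"
  proof -
    have "of_real (\<Sum>r<K. w r) = (of_nat K :: complex)" using fejer_partition[OF K, of x] by (simp add: fw)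
    thus ?thesis by (metis of_real_eq_iff of_real_of_nat_eq)
  qed
  have w0: "w r \<ge> 0" for r by (simp add: w_def)
  have "(\<Sum>r<K. g (real r / real K) * fejer K (x - real r / real K)) / of_nat K - g (frac x)
     = (\<Sum>r<K. (g (real r / real K) - g (frac x)) * of_real (w r)) / of_nat K"
  proof -
    have "(\<Sum>r<K. (g (real r / real K) - g (frac x)) * of_real (w r)) =
       (\<Sum>r<K. g (real r / real K) * fejer K (x - real r / real K)) - g (frac x) * of_real (\<Sum>r<K. w r)"
      by (simp add: fw left_diff_distrib sum_subtractf sum_distrib_left)
    thus ?thesis using K by (simp add: sw diff_divide_distrib)
  qed
  also have "norm \<dots> \<le> (\<Sum>r<K. norm (g (real r / real K) - g (frac x)) * w r) / real K"
    unfolding norm_divide norm_of_nat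
    by (intro divide_right_mono order.trans[OF norm_sum] sum_mono) (auto simp: norm_mult w0)
  also have "(\<Sum>r<K. norm (g (real r / real K) - g (frac x)) * w r) \<le> (\<Sum>r<K. 4 * d * w r + 1 / (d\<^sup>2 * real K))"
  proof (rule sum_mono)
    fix r assume r: "r \<in> {..<K}"
    have rK: "0 \<le> real r / real K" "real r / real K < 1" using r by auto
    show "norm (g (real r / real K) - g (frac x)) * w r \<le> 4 * d * w r + 1 / (d\<^sup>2 * real K)"
    proof (cases "\<bar>real r / real K - frac x\<bar> \<le> d")
      case True
      have "norm (g (real r / real K) - g (frac x)) \<le> 4 * d"
        by (rule order.trans[OF lip]) (use True in simp)
      hence "norm (g (real r / real K) - g (frac x)) * w r \<le> 4 * d * w r" using w0 by (intro mult_right_mono) auto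
      thus ?thesis using d by (smt (verit) divide_nonneg_nonneg mult_nonneg_nonneg of_nat_0_le_iff zero_le_power2)
    next
      case False
      \<comment> \<open>As \<open>frac x\<close> lies in \<open>[d, 1 - d]\<close>, a distance above
        \<open>d\<close> from \<open>r / K\<close> inside the unit interval is also a distance of at
        least \<open>d\<close> on the circle.\<close>
      have dd: "\<bar>(x - real r / real K) - of_int z\<bar> \<ge> d" for z :: int
      proof (rule ccontr)
        assume *: "\<not> \<bar>(x - real r / real K) - of_int z\<bar> \<ge> d"
        have fr: "x = of_int \<lfloor>x\<rfloor> + frac x" by (simp add: frac_def)
        have f1: "frac x < 1" "0 \<le> frac x" by (auto simp: frac_lt_1)
        have fd: "frac x \<ge> d" "1 - frac x \<ge> d"
          using d(2)[of "\<lfloor>x\<rfloor>"] d(2)[of "\<lfloor>x\<rfloor> + 1"] f1 by (auto simp: frac_def)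
        consider "z = \<lfloor>x\<rfloor>" | "z \<ge> \<lfloor>x\<rfloor> + 1" | "z \<le> \<lfloor>x\<rfloor> - 1" by linarith
        thus False
        proof cases
          case 1 thus False using * False fr by linarith
        next
          case 2
          hence "real_of_int z \<ge> of_int \<lfloor>x\<rfloor> + 1" by linarith
          thus False using * fr fd rK by linarith
        next
          case 3
          hence "real_of_int z \<le> of_int \<lfloor>x\<rfloor> - 1" by linarith
          thus False using * fr fd rK by linarith
        qed
      qed
      have "w r \<le> 1 / (2 * d\<^sup>2 * real K)" unfolding w_def using dd d K by (intro fejer_upper) auto
      moreover have "norm (g (real r / real K) - g (frac x)) \<le> 2"
        using norm_triangle_ineq4[of "g (real r / real K)" "g (frac x)"] g1[of "real r / real K"] g1[of "frac x"] by linarith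
      ultimately have "norm (g (real r / real K) - g (frac x)) * w r \<le> 2 * (1 / (2 * d\<^sup>2 * real K))"
        using w0 by (intro mult_mono) auto
      thus ?thesis using w0[of r] d by (simp add: add_increasing)
    qed
  qed
  also have "\<dots> = 4 * d * real K + 1 / (d\<^sup>2)" using K d
    by (simp add: sum.distrib sum_distrib_left[symmetric] sw)
  finally show ?thesis using K d by (simp add: divide_right_mono add_divide_distrib mult.commute)
qed

text \<open>\<open>ee (a * \<lfloor>x\<rfloor>)\<close> is \<open>ee (a * x)\<close> times a
  function of \<open>frac x\<close>. Off a neighbourhood of the integers that function is replaced
  by a trigonometric polynomial \<open>V\<close>; the points inside the neighbourhood are counted
  with a Fejer kernel of order \<open>L\<close>. Everything is then expressed by sums at frequencies
  \<open>k\<close> and \<open>a + k\<close>.\<close>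

lemma floor_sum_bound:
  fixes x :: "'a \<Rightarrow> real" and a :: real
  assumes a: "\<bar>a\<bar> \<le> 1/2" and L: "L > 0" and W0: "W \<ge> 0"
    and W1: "\<And>k::int. k \<noteq> 0 \<Longrightarrow> \<bar>k\<bar> < int L \<Longrightarrow> norm (\<Sum>m\<in>A. ee (of_int k * x m)) \<le> W"
    and W2: "\<And>k::int. \<bar>k\<bar> < int (L ^ 3) \<Longrightarrow> norm (\<Sum>m\<in>A. ee ((a + of_int k) * x m)) \<le> W"
  shows "norm (\<Sum>m\<in>A. ee (a * of_int \<lfloor>x m\<rfloor>)) \<le> 45 * real (card A) / real L + (real L ^ 3 + 8) * W"
proof -
  \<comment> \<open>\<open>d\<close> fits \<open>fejer_lower\<close> at order \<open>L\<close>; the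
    cube makes the error \<open>1 / (d\<^sup>2 * K)\<close> of order \<open>1 / L\<close> as
    well.\<close>
  define K where "K = L ^ 3"
  define d where "d = 1 / (6 * real L)"
  have K: "K > 0" and d: "d > 0" using L by (auto simp: K_def d_def)
  define g where "g s = ee (- a * s)" for s
  have lip: "norm (g s - g t) \<le> 4 * \<bar>s - t\<bar>" for s t
  proof -
    have "norm (g s - g t) \<le> 2 * pi * \<bar>- a * s - - a * t\<bar>" unfolding g_def by (rule norm_ee_diff_le)
    also have "- a * s - - a * t = - a * (s - t)" by (simp add: algebra_simps)
    also have "2 * pi * \<bar>- a * (s - t)\<bar> \<le> 2 * 4 * (1/2 * \<bar>s - t\<bar>)"
      using a pi_less_4 unfolding abs_mult by (intro mult_mono) auto
    finally show ?thesis by simp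
  qed
  define V where "V y = (\<Sum>r<K. g (real r / real K) * fejer K (y - real r / real K)) / of_nat K" for y
  have Vb: "norm (V y) \<le> 1" for y
  proof -
    have "norm (\<Sum>r<K. g (real r / real K) * fejer K (y - real r / real K)) \<le> (\<Sum>r<K. norm (fejer K (y - real r / real K)))"
      by (intro order.trans[OF norm_sum] sum_mono) (simp add: norm_mult g_def)
    also have "(\<Sum>r<K. norm (fejer K (y - real r / real K))) = norm (of_real (\<Sum>r<K. norm (fejer K (y - real r / real K))) :: complex)"
      by (subst norm_of_real) (simp add: sum_nonneg)
    also have "of_real (\<Sum>r<K. norm (fejer K (y - real r / real K))) = (\<Sum>r<K. fejer K (y - real r / real K))"
      by (simp add: of_real_norm_fejer)
    also have "\<dots> = of_nat K" by (rule fejer_partition[OF K])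
    finally show ?thesis using K unfolding V_def by (simp add: norm_divide)
  qed
  define bad where "bad m \<longleftrightarrow> (\<exists>z::int. \<bar>x m - of_int z\<bar> < d)" for m
  define err where "err m = norm (V (x m) - g (frac (x m)))" for m
  have errb: "err m \<le> 2 * (if bad m then 1 else 0) + (4 * d + 1 / (d\<^sup>2 * real K))" for m
  proof (cases "bad m")
    case True
    have "err m \<le> 2" unfolding err_def
      using norm_triangle_ineq4[of "V (x m)" "g (frac (x m))"] Vb[of "x m"] by (simp add: g_def)
    moreover have "4 * d + 1 / (d\<^sup>2 * real K) \<ge> 0" using d by simp
    ultimately show ?thesis using True by simp
  next
    case False
    hence "err m \<le> 4 * d + 1 / (d\<^sup>2 * real K)" unfolding err_def V_def
      by (intro fejer_approx K d lip) (auto simp: bad_def g_def not_less)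
    thus ?thesis using False by simp
  qed
  have ee_floor: "ee (a * of_int \<lfloor>x m\<rfloor>) = ee (a * x m) * g (frac (x m))" for m
  proof -
    have "a * of_int \<lfloor>x m\<rfloor> = a * x m + (- a * frac (x m))" by (simp add: frac_def algebra_simps)
    thus ?thesis by (simp only: g_def ee_add)
  qed
  have badcount: "(\<Sum>m\<in>A. (if bad m then 1 else 0 :: real)) \<le> 4 * real (card A) / real L + 4 * W"
  proof -
    have "(\<Sum>m\<in>A. (if bad m then 1 else 0 :: real)) \<le> (\<Sum>m\<in>A. 4 / real L * norm (fejer L (x m)))"
    proof (rule sum_mono)
      fix m assume "m \<in> A"
      show "(if bad m then 1 else 0 :: real) \<le> 4 / real L * norm (fejer L (x m))"
      proof (cases "bad m")
        case True
        then obtain z :: int where z: "\<bar>x m - of_int z\<bar> < 1 / (6 * real L)" unfolding bad_def d_def by blast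
        have "real L / 4 \<le> norm (fejer L (x m))" using L by (rule fejer_lower[OF less_imp_le[OF z]])
        thus ?thesis using L True by (simp add: field_simps)
      qed simp
    qed
    also have "\<dots> = 4 / real L * (\<Sum>m\<in>A. norm (fejer L (x m)))" by (simp only: sum_distrib_left)
    also have "\<dots> \<le> 4 / real L * (real (card A) + real L * W)"
      by (intro mult_left_mono sum_fejer_bound W1 L W0) auto
    also have "\<dots> = 4 * real (card A) / real L + 4 * W" using L by (simp add: field_simps)
    finally show ?thesis .
  qed
  \<comment> \<open>\<open>V\<close> combines \<open>K ^ 3\<close> unimodular terms with weight
    \<open>1 / K\<^sup>2\<close>, whence the loss of a factor \<open>K\<close>.\<close>
  have Vsum: "norm (\<Sum>m\<in>A. ee (a * x m) * V (x m)) \<le> real K * W"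
  proof -
    have e: "ee (a * y) * ee ((real j - real j') * (y - t)) =
       ee ((a + of_int (int j - int j')) * y) * ee (- ((real j - real j') * t))" for j j' y t
      by (simp add: ee_add[symmetric] algebra_simps)
    define co where "co r j j' = g (real r / real K) * ee (- ((real j - real j') * (real r / real K)))" for r j j'
    have "ee (a * y) * V y = (1 / of_nat K / of_nat K) * (\<Sum>r<K. \<Sum>j<K. \<Sum>j'<K. co r j j' * ee ((a + of_int (int j - int j')) * y))" for y
    proof -
      have "ee (a * y) * V y = (1 / of_nat K / of_nat K) * (\<Sum>r<K. \<Sum>j<K. \<Sum>j'<K. g (real r / real K) * (ee (a * y) * ee ((real j - real j') * (y - real r / real K))))"
        unfolding V_def fejer_def
        by (simp add: sum_distrib_left sum_divide_distrib mult_ac)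
      thus ?thesis unfolding e co_def by (simp add: mult_ac)
    qed
    hence "(\<Sum>m\<in>A. ee (a * x m) * V (x m)) = (1 / of_nat K / of_nat K) * (\<Sum>m\<in>A. \<Sum>r<K. \<Sum>j<K. \<Sum>j'<K. co r j j' * ee ((a + of_int (int j - int j')) * x m))"
      by (simp only: sum_distrib_left)
    also have "(\<Sum>m\<in>A. \<Sum>r<K. \<Sum>j<K. \<Sum>j'<K. co r j j' * ee ((a + of_int (int j - int j')) * x m)) =
       (\<Sum>r<K. \<Sum>j<K. \<Sum>j'<K. \<Sum>m\<in>A. co r j j' * ee ((a + of_int (int j - int j')) * x m))"
      by (subst sum.swap, rule sum.cong[OF refl], subst sum.swap, rule sum.cong[OF refl], rule sum.swap)
    also have "\<dots> = (\<Sum>r<K. \<Sum>j<K. \<Sum>j'<K. co r j j' * (\<Sum>m\<in>A. ee ((a + of_int (int j - int j')) * x m)))"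
      by (simp only: sum_distrib_left)
    finally have "norm (\<Sum>m\<in>A. ee (a * x m) * V (x m)) = (1 / real K / real K) * norm (\<Sum>r<K. \<Sum>j<K. \<Sum>j'<K. co r j j' * (\<Sum>m\<in>A. ee ((a + of_int (int j - int j')) * x m)))"
      by (simp add: norm_mult norm_divide)
    also have "\<dots> \<le> (1 / real K / real K) * (\<Sum>r<K. \<Sum>j<K. \<Sum>j'<K. W)"
    proof (intro mult_left_mono order.trans[OF norm_sum] sum_mono)
      fix r j j' assume *: "r \<in> {..<K}" "j \<in> {..<K}" "j' \<in> {..<K}"
      have "norm (\<Sum>m\<in>A. ee ((a + of_int (int j - int j')) * x m)) \<le> W"
      proof (rule W2)
        have "int j < int (L ^ 3)" "int j' < int (L ^ 3)"
          using * unfolding K_def by (simp_all only: lessThan_iff of_nat_less_iff)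
        thus "\<bar>int j - int j'\<bar> < int (L ^ 3)" by linarith
      qed
      thus "norm (co r j j' * (\<Sum>m\<in>A. ee ((a + of_int (int j - int j')) * x m))) \<le> W"
        by (simp add: norm_mult co_def g_def)
    qed auto
    also have "\<dots> = real K * W" using K by simp
    finally show ?thesis .
  qed
  have "norm (\<Sum>m\<in>A. ee (a * of_int \<lfloor>x m\<rfloor>)) =
      norm ((\<Sum>m\<in>A. ee (a * x m) * V (x m)) - (\<Sum>m\<in>A. ee (a * x m) * (V (x m) - g (frac (x m)))))"
    unfolding ee_floor by (simp add: sum_subtractf right_diff_distrib)
  also have "\<dots> \<le> norm (\<Sum>m\<in>A. ee (a * x m) * V (x m)) + norm (\<Sum>m\<in>A. ee (a * x m) * (V (x m) - g (frac (x m))))"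
    by (rule norm_triangle_ineq4)
  also have "\<dots> \<le> real K * W + (\<Sum>m\<in>A. err m)"
    by (intro add_mono Vsum order.trans[OF norm_sum] sum_mono) (simp add: norm_mult err_def)
  also have "(\<Sum>m\<in>A. err m) \<le> (\<Sum>m\<in>A. 2 * (if bad m then 1 else 0) + (4 * d + 1 / (d\<^sup>2 * real K)))"
    by (intro sum_mono errb)
  also have "\<dots> = 2 * (\<Sum>m\<in>A. (if bad m then 1 else 0)) + real (card A) * (4 * d + 1 / (d\<^sup>2 * real K))"
    by (simp only: sum.distrib sum_distrib_left[symmetric] sum_constant) (simp add: algebra_simps)
  also have "4 * d + 1 / (d\<^sup>2 * real K) \<le> 37 / real L"
  proof -
    have "d\<^sup>2 * real K = real L / 36" using L by (simp add: d_def K_def power2_eq_square power3_eq_cube)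
    thus ?thesis using L by (simp add: d_def field_simps)
  qed
  finally have "norm (\<Sum>m\<in>A. ee (a * of_int \<lfloor>x m\<rfloor>)) \<le>
     real K * W + (2 * (4 * real (card A) / real L + 4 * W) + real (card A) * (37 / real L))"
    using badcount by (smt (verit) mult_left_mono of_nat_0_le_iff)
  also have "\<dots> = 45 * real (card A) / real L + (real L ^ 3 + 8) * W" by (simp add: K_def algebra_simps)
  finally show ?thesis .
qed

text \<open>Among the frequencies \<open>a + k\<close> only \<open>k = 0\<close> can be close to 0;
  the others have absolute value at least 1/2, where \<open>exponential_sum_bound\<close> applies
  anyway. The expansion loses about \<open>R ^ 3\<close>, which is why that bound is used with
  \<open>R' = R ^ 8\<close>.\<close>

theorem exponential_sum_floor_bound:
  fixes c :: real
  assumes c: "c > 1" "c \<notin> \<int>"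
  shows "\<exists>C E. C > 0 \<and> E \<ge> 1 \<and> (\<forall>R (M::nat) a. R \<ge> 2 \<longrightarrow> real M \<ge> R powr E \<longrightarrow>
      R powr E / real M powr c \<le> \<bar>a\<bar> \<longrightarrow> \<bar>a\<bar> \<le> 1/2 \<longrightarrow>
      norm (\<Sum>m=1..M. ee (a * of_int \<lfloor>real m powr c\<rfloor>)) \<le> C * real M / R)"
proof -
  obtain C E where CE: "C > 0" "E \<ge> 1"
    and bd: "\<And>R (M::nat) b. R \<ge> 1 \<Longrightarrow> real M \<ge> R powr E \<Longrightarrow>
      R powr E / real M powr c \<le> \<bar>b\<bar> \<Longrightarrow> \<bar>b\<bar> \<le> R \<Longrightarrow>
      norm (\<Sum>m=1..M. ee (b * real m powr c)) \<le> C * real M / R"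
    using exponential_sum_bound[OF assms] by blast
  \<comment> \<open>The 8 belongs to \<open>R' = R powr 8\<close>; the additional 1 pays for the
    factor 2 in \<open>2 * R' powr E \<le> R powr E'\<close>.\<close>
  define E' where "E' = 8 * (E + 1)"
  have "norm (\<Sum>m=1..M. ee (a * of_int \<lfloor>real m powr c\<rfloor>)) \<le> (45 + 16 * C) * real M / R"
    if R: "R \<ge> 2" and M: "real M \<ge> R powr E'" and a1: "R powr E' / real M powr c \<le> \<bar>a\<bar>" and a2: "\<bar>a\<bar> \<le> 1/2"
    for R a :: real and M :: nat
  proof -
    define R' where "R' = R powr 8"
    have R'8: "R' = R ^ 8" unfolding R'_def using R by simp
    have "R ^ 1 \<le> R ^ 8" using R by (intro power_increasing) auto
    hence R'1: "R' \<ge> 2" unfolding R'8 using R by simp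
    have R'E: "R' powr (E + 1) = R powr E'" by (simp add: R'_def powr_powr E'_def)
    have R'E2: "2 * R' powr E \<le> R powr E'"
    proof -
      have "2 * R' powr E \<le> R' * R' powr E" using R'1 by (intro mult_right_mono) auto
      also have "\<dots> = R' powr (E + 1)" using R'1 by (simp add: powr_mult_base add.commute)
      finally show ?thesis by (simp add: R'E)
    qed
    have M': "real M \<ge> R' powr E" using M R'E2 by (smt (verit) powr_ge_zero)
    have "R' powr E \<ge> 1" using R'1 CE by (intro ge_one_powr_ge_zero) auto
    hence M1: "real M \<ge> 1" using M' by linarith
    have Mc: "real M powr c \<ge> real M" using M1 c powr_mono[of 1 c "real M"] by simp
    define L where "L = nat \<lceil>R\<rceil>"
    have L: "R \<le> real L" "real L \<le> 2 * R" "L > 0" using R unfolding L_def by linarith+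
    define W where "W = C * real M / R'"
    have W0: "W \<ge> 0" using CE R'1 by (simp add: W_def)
    have L3: "real L ^ 3 + 8 \<le> 9 * R ^ 3"
    proof -
      have "real L ^ 3 \<le> (2 * R) ^ 3" using L by (intro power_mono) auto
      moreover have "2 ^ 3 \<le> R ^ 3" using R by (intro power_mono) auto
      ultimately show ?thesis by (simp add: power_mult_distrib)
    qed
    have R45: "9 * R ^ 3 \<le> R'"
    proof -
      have "9 * R ^ 3 \<le> R ^ 5 * R ^ 3" using R power_mono[of 2 R 5] by (intro mult_right_mono) auto
      thus ?thesis by (simp add: R'8 power_add[symmetric])
    qed
    have small: "R' powr E / real M powr c \<le> 1/2"
    proof -
      have "2 * R' powr E \<le> real M powr c" using R'E2 M Mc by linarith
      thus ?thesis using M1 by (simp add: field_simps)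
    qed
    have half: "norm (\<Sum>m=1..M. ee (b * real m powr c)) \<le> W" if "\<bar>b\<bar> \<ge> 1/2" "\<bar>b\<bar> \<le> R'" for b
      unfolding W_def using R'1 M' that small by (intro bd) linarith+
    have "norm (\<Sum>m\<in>{1..M}. ee (a * of_int \<lfloor>real m powr c\<rfloor>)) \<le> 45 * real (card {1..M}) / real L + (real L ^ 3 + 8) * W"
    proof (rule floor_sum_bound)
      fix k :: int assume k: "k \<noteq> 0" "\<bar>k\<bar> < int L"
      have "\<bar>real_of_int k\<bar> \<le> real L" using k by linarith
      also have "\<dots> \<le> R'"
      proof -
        have "1 \<le> R ^ 2" using R by (intro one_le_power) auto
        hence "R * 1 \<le> R * R ^ 2" using R by (intro mult_left_mono) auto
        hence "2 * R \<le> 9 * (R * R ^ 2)" using R by linarith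
        moreover have "R * R ^ 2 = R ^ 3" by (simp add: power3_eq_cube power2_eq_square)
        ultimately show ?thesis using L R45 by linarith
      qed
      finally show "norm (\<Sum>m = 1..M. ee (of_int k * real m powr c)) \<le> W"
        using k by (intro half) auto
    next
      fix k :: int assume k: "\<bar>k\<bar> < int (L ^ 3)"
      show "norm (\<Sum>m = 1..M. ee ((a + of_int k) * real m powr c)) \<le> W"
      proof (cases "k = 0")
        case True
        have "R' powr E / real M powr c \<le> R powr E' / real M powr c"
          using R'E2 by (intro divide_right_mono) (smt (verit) powr_ge_zero, auto)
        thus ?thesis unfolding W_def True using R'1 M' a1 a2 by (intro bd) auto
      next
        case False
        have "\<bar>real_of_int k\<bar> \<le> real L ^ 3" using k by (metis of_int_abs of_int_le_iff of_int_of_nat_eq of_nat_power order_less_imp_le)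
        hence "\<bar>a + of_int k\<bar> \<le> R'" using L3 R45 a2 by linarith
        moreover have "\<bar>real_of_int k\<bar> \<ge> 1" using False by linarith
        hence "\<bar>a + of_int k\<bar> \<ge> 1/2" using a2 by linarith
        ultimately show ?thesis by (intro half) auto
      qed
    qed (use a2 L W0 in auto)
    also have "\<dots> \<le> 45 * real M / R + 9 * R ^ 3 * W"
      using L L3 R W0 by (intro add_mono mult_right_mono) (auto intro!: divide_left_mono)
    also have "9 * R ^ 3 * W \<le> 16 * C * real M / R"
    proof -
      have "9 * R ^ 3 * R \<le> 16 * R'"
        using R power_increasing[of 4 8 R] by (simp add: R'8 power_numeral_reduce)
      hence "9 * R ^ 3 * R * (C * real M) \<le> 16 * R' * (C * real M)" using CE by (intro mult_right_mono) auto
      thus ?thesis using R R'1 by (simp add: W_def field_simps)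
    qed
    finally show ?thesis by (simp add: add_divide_distrib distrib_right)
  qed
  moreover have "E' \<ge> 1" using CE by (simp add: E'_def)
  ultimately show ?thesis using CE by (intro exI[of _ "45 + 16 * C"] exI[of _ E']) auto
qed

section \<open>Dirichlet series and the zeta function\<close>

text \<open>\<open>n\<close> to the power \<open>- s\<close>, through the real logarithm, so that it
  is entire in \<open>s\<close>. Since \<open>ln 0 = 0\<close>, \<open>nps 0 s\<close> is 1 and not
  0; series therefore need \<open>a 0 = 0\<close>, which is part of \<open>dconv\<close>.\<close>

definition nps :: "nat \<Rightarrow> complex \<Rightarrow> complex" where
  "nps n s = exp (- s * of_real (ln (real n)))"

lemma norm_nps: "n > 0 \<Longrightarrow> norm (nps n s) = real n powr (- Re s)"
  by (simp add: nps_def powr_def)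

lemma nps_1 [simp]: "nps 1 s = 1" "nps (Suc 0) s = 1" by (simp_all add: nps_def)

lemma nps_mult: "m > 0 \<Longrightarrow> n > 0 \<Longrightarrow> nps (m * n) s = nps m s * nps n s"
  by (simp add: nps_def ln_mult exp_add[symmetric] algebra_simps)

lemma nps_field_derivative [derivative_intros]:
  "(nps n has_field_derivative (- of_real (ln (real n)) * nps n s)) (at s within A)"
  unfolding nps_def by (auto intro!: derivative_eq_intros)

lemma nps_of_real: "n > 0 \<Longrightarrow> nps n (of_real x) = of_real (real n powr (- x))"
  by (simp add: nps_def powr_def exp_of_real[symmetric])

definition dseries :: "(nat \<Rightarrow> real) \<Rightarrow> complex \<Rightarrow> complex" where
  "dseries a s = (\<Sum>n. of_real (a n) * nps n s)"

text \<open>Absolute convergence is asked at real points only, as \<open>norm (nps n s)\<close>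
  depends on \<open>Re s\<close> alone.\<close>

definition dconv :: "(nat \<Rightarrow> real) \<Rightarrow> bool" where
  "dconv a \<longleftrightarrow> a 0 = 0 \<and> (\<forall>x>1. summable (\<lambda>n. \<bar>a n\<bar> * real n powr (- x)))"

lemma dconv_norm_summable:
  assumes "dconv a" "Re s > 1"
  shows "summable (\<lambda>n. norm (of_real (a n) * nps n s))"
proof -
  have "norm (of_real (a n) * nps n s) = \<bar>a n\<bar> * real n powr (- Re s)" for n
    using assms by (cases "n = 0") (auto simp: norm_mult norm_nps dconv_def)
  thus ?thesis using assms by (simp add: dconv_def)
qed

lemma dconv_sums:
  assumes "dconv a" "Re s > 1"
  shows "(\<lambda>n. of_real (a n) * nps n s) sums dseries a s"
  unfolding dseries_def using summable_norm_cancel[OF dconv_norm_summable[OF assms]] by (rule summable_sums)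

lemma dconv_ln:
  assumes "dconv a"
  shows "dconv (\<lambda>n. a n * ln (real n))"
  unfolding dconv_def
proof (intro conjI allI impI)
  show "a 0 * ln (real 0) = 0" by simp
  fix x :: real assume x: "x > 1"
  define d where "d = (x - 1) / 2"
  have d: "d > 0" "x - d > 1" using x by (auto simp: d_def field_simps)
  show "summable (\<lambda>n. \<bar>a n * ln (real n)\<bar> * real n powr (- x))"
  proof (rule summable_comparison_test')
    show "summable (\<lambda>n. (1 / d) * (\<bar>a n\<bar> * real n powr (- (x - d))))"
      using assms d by (intro summable_mult) (auto simp: dconv_def)
    fix n :: nat assume "n \<ge> 1"
    have l: "ln (real n) \<le> real n powr d / d" "ln (real n) \<ge> 0"
      using \<open>n \<ge> 1\<close> d by (auto intro: ln_powr_bound)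
    have "\<bar>a n * ln (real n)\<bar> \<le> \<bar>a n\<bar> * (real n powr d / d)"
      unfolding abs_mult using l by (intro mult_left_mono) auto
    hence "\<bar>a n * ln (real n)\<bar> * real n powr (- x) \<le> \<bar>a n\<bar> * (real n powr d / d) * real n powr (- x)"
      by (rule mult_right_mono) simp
    also have "\<dots> = (1 / d) * (\<bar>a n\<bar> * (real n powr d * real n powr (- x)))" by simp
    also have "real n powr d * real n powr (- x) = real n powr (- (x - d))" by (simp add: powr_add[symmetric])
    finally show "norm (\<bar>a n * ln (real n)\<bar> * real n powr (- x)) \<le> (1 / d) * (\<bar>a n\<bar> * real n powr (- (x - d)))"
      by simp
  qed
qed

lemma dconv_uminus: "dconv a \<Longrightarrow> dconv (\<lambda>n. - a n)"
  by (simp add: dconv_def)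

lemma dconv_diff:
  assumes "dconv a" "dconv b" shows "dconv (\<lambda>n. a n - b n)"
  unfolding dconv_def
proof (intro conjI allI impI)
  fix x :: real assume x: "x > 1"
  show "summable (\<lambda>n. \<bar>a n - b n\<bar> * real n powr (- x))"
  proof (rule summable_comparison_test')
    show "summable (\<lambda>n. \<bar>a n\<bar> * real n powr (- x) + \<bar>b n\<bar> * real n powr (- x))"
      using assms x by (intro summable_add) (auto simp: dconv_def)
    show "norm (\<bar>a n - b n\<bar> * real n powr (- x)) \<le> \<bar>a n\<bar> * real n powr (- x) + \<bar>b n\<bar> * real n powr (- x)" if "n \<ge> 0" for n
    proof -
      have "\<bar>a n - b n\<bar> * real n powr (- x) \<le> (\<bar>a n\<bar> + \<bar>b n\<bar>) * real n powr (- x)"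
        by (intro mult_right_mono) auto
      thus ?thesis by (simp add: distrib_right)
    qed
  qed
qed (use assms in \<open>simp add: dconv_def\<close>)

lemma dconv_mono:
  assumes "dconv a" "\<And>n. \<bar>b n\<bar> \<le> \<bar>a n\<bar>" shows "dconv b"
  unfolding dconv_def
proof (intro conjI allI impI)
  show "b 0 = 0" using assms(1) assms(2)[of 0] by (simp add: dconv_def)
  fix x :: real assume x: "x > 1"
  show "summable (\<lambda>n. \<bar>b n\<bar> * real n powr (- x))"
  proof (rule summable_comparison_test')
    show "summable (\<lambda>n. \<bar>a n\<bar> * real n powr (- x))" using assms x by (auto simp: dconv_def)
    show "norm (\<bar>b n\<bar> * real n powr (- x)) \<le> \<bar>a n\<bar> * real n powr (- x)" if "n \<ge> 0" for n
      using assms(2)[of n] by (simp add: mult_right_mono)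
  qed
qed

lemma dseries_diff:
  assumes "dconv a" "dconv b" "Re s > 1"
  shows "dseries (\<lambda>n. a n - b n) s = dseries a s - dseries b s"
  using sums_diff[OF dconv_sums[OF assms(1,3)] dconv_sums[OF assms(2,3)]]
  unfolding dseries_def by (simp add: sums_iff left_diff_distrib)

lemma dseries_uminus:
  assumes "dconv a" "Re s > 1"
  shows "dseries (\<lambda>n. - a n) s = - dseries a s"
  using sums_minus[OF dconv_sums[OF assms]] unfolding dseries_def by (simp add: sums_iff)

lemma open_Re_gt: "open {s. Re s > x}"
  using open_halfspace_Re_gt[of x] by simp

lemma dseries_has_field_derivative:
  assumes a: "dconv a" and s: "Re s > 1"
  shows "(dseries a has_field_derivative dseries (\<lambda>n. - a n * ln (real n)) s) (at s)"
proof -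
  define S where "S = {s. Re s > 1}"
  have S: "open S" unfolding S_def by (rule open_Re_gt)
  have "\<exists>g g'. \<forall>x \<in> S. ((\<lambda>n. of_real (a n) * nps n x) sums g x) \<and>
     ((\<lambda>n. of_real (- a n * ln (real n)) * nps n x) sums g' x) \<and> (g has_field_derivative g' x) (at x)"
  proof (rule series_and_derivative_comparison_complex[OF S])
    fix n x assume "x \<in> S"
    show "((\<lambda>x. of_real (a n) * nps n x) has_field_derivative of_real (- a n * ln (real n)) * nps n x) (at x)"
      by (auto intro!: derivative_eq_intros)
  next
    fix x assume x: "x \<in> S"
    \<comment> \<open>Half the distance to the line, so that one majorant with exponent
      \<open>1 + d\<close> serves the whole ball.\<close>
    define d where "d = (Re x - 1) / 2"
    have d: "d > 0" "1 + d > 1" using x by (auto simp: d_def S_def)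
    define h :: "nat \<Rightarrow> complex" where "h n = of_real (\<bar>a n\<bar> * real n powr (- (1 + d)))" for n
    have hs: "summable h" unfolding h_def by (rule summable_of_real) (use a d(2) in \<open>unfold dconv_def, blast\<close>)
    have hr: "range h \<subseteq> \<real>\<^sub>\<ge>\<^sub>0" by (auto simp: h_def)
    have hb: "norm (of_real (a n) * nps n y) \<le> norm (h n)" if "y \<in> ball x d \<inter> S" for n y
    proof (cases "n = 0")
      case True thus ?thesis using a by (simp add: dconv_def)
    next
      case False
      have "\<bar>Re x - Re y\<bar> \<le> norm (x - y)" using abs_Re_le_cmod[of "x - y"] by simp
      also have "\<dots> < d" using that by (simp add: dist_norm)
      finally have "\<bar>Re x - Re y\<bar> < d" .
      moreover have "2 * d = Re x - 1" by (simp add: d_def)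
      ultimately have "Re y \<ge> 1 + d" by linarith
      hence "real n powr (- Re y) \<le> real n powr (- (1 + d))" using False by (intro powr_mono) auto
      thus ?thesis using False by (simp add: h_def norm_mult norm_nps abs_mult mult_left_mono)
    qed
    show "\<exists>d (h::nat \<Rightarrow> complex). 0 < d \<and> summable h \<and> range h \<subseteq> \<real>\<^sub>\<ge>\<^sub>0 \<and>
        (\<forall>\<^sub>F n in sequentially. \<forall>y\<in>ball x d \<inter> S. norm (of_real (a n) * nps n y) \<le> norm (h n))"
      by (intro exI[of _ d] exI[of _ h] conjI always_eventually allI ballI d hs hr hb)
  qed
  then obtain g g' where g: "\<And>x. x \<in> S \<Longrightarrow> (\<lambda>n. of_real (a n) * nps n x) sums g x"
     "\<And>x. x \<in> S \<Longrightarrow> (\<lambda>n. of_real (- a n * ln (real n)) * nps n x) sums g' x"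
     "\<And>x. x \<in> S \<Longrightarrow> (g has_field_derivative g' x) (at x)" by blast
  have gs: "g x = dseries a x" if "x \<in> S" for x using g(1)[OF that] by (simp add: dseries_def sums_iff)
  have gs': "g' x = dseries (\<lambda>n. - a n * ln (real n)) x" if "x \<in> S" for x using g(2)[OF that] by (simp add: dseries_def sums_iff)
  have sS: "s \<in> S" using s by (simp add: S_def)
  show ?thesis
    by (rule has_field_derivative_transform_within_open[OF _ S sS gs])
       (use g(3)[OF sS] gs'[OF sS] in auto)
qed

lemma dconv_ln_power:
  assumes "dconv a" shows "dconv (\<lambda>n. a n * (- ln (real n)) ^ k)"
proof (induction k)
  case (Suc k)
  have "dconv (\<lambda>n. - (a n * (- ln (real n)) ^ k * ln (real n)))"
    by (intro dconv_uminus dconv_ln Suc.IH)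
  thus ?case by (simp add: mult_ac)
qed (use assms in simp)

lemma dseries_higher_deriv:
  assumes "dconv a" "Re s > 1"
  shows "(deriv ^^ k) (dseries a) s = dseries (\<lambda>n. a n * (- ln (real n)) ^ k) s"
  using assms(2)
proof (induction k arbitrary: s)
  case (Suc k)
  have "(deriv ^^ Suc k) (dseries a) s = deriv ((deriv ^^ k) (dseries a)) s" by simp
  also have "\<dots> = deriv (dseries (\<lambda>n. a n * (- ln (real n)) ^ k)) s"
  proof (rule deriv_cong_ev[OF _ refl])
    have "eventually (\<lambda>x. x \<in> {s. Re s > 1}) (nhds s)"
      using Suc.prems by (intro eventually_nhds_in_open open_Re_gt) auto
    thus "\<forall>\<^sub>F x in nhds s. (deriv ^^ k) (dseries a) x = dseries (\<lambda>n. a n * (- ln (real n)) ^ k) x"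
      by eventually_elim (use Suc.IH in auto)
  qed
  also have "\<dots> = dseries (\<lambda>n. - (a n * (- ln (real n)) ^ k) * ln (real n)) s"
    by (rule DERIV_imp_deriv, rule dseries_has_field_derivative, rule dconv_ln_power[OF assms(1)], rule Suc.prems)
  finally show ?case by (simp add: mult_ac)
qed simp

text \<open>Relative to \<open>n = 1\<close>, all further terms decay at least like
  \<open>2 powr (- x)\<close>. The limit fixes the constant of integration in
  \<open>zt_eq_exp\<close>.\<close>

lemma dseries_tendsto:
  assumes "dconv a"
  shows "((\<lambda>x::real. dseries a (of_real x)) \<longlongrightarrow> of_real (a 1)) at_top"
proof -
  define K where "K = (\<Sum>n. \<bar>a n\<bar> * real n powr (-2))"
  have K: "summable (\<lambda>n. \<bar>a n\<bar> * real n powr (-2))" using assms by (auto simp: dconv_def)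
  have bd: "norm (dseries a (of_real x) - of_real (a 1)) \<le> 2 powr (- (x - 2)) * K" if "x \<ge> 2" for x :: real
  proof -
    have s: "(\<lambda>n. of_real (a n) * nps n (of_real x)) sums dseries a (of_real x)"
      using assms that by (intro dconv_sums) auto
    have "(\<lambda>n. if n = 1 then of_real (a n) * nps n (of_real x) else 0) sums (of_real (a 1) * nps 1 (of_real x))"
      by (rule sums_single)
    note sx = this
    have s2: "(\<lambda>n. if n = 1 then 0 else of_real (a n) * nps n (of_real x)) sums (dseries a (of_real x) - of_real (a 1))"
    proof -
      have "(\<lambda>n. if n = 1 then 0 else of_real (a n) * nps n (of_real x)) =
        (\<lambda>n. of_real (a n) * nps n (of_real x) - (if n = 1 then of_real (a n) * nps n (of_real x) else 0))" by auto
      moreover note sums_diff[OF s sx]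
      ultimately show ?thesis by (simp only: nps_1 mult_1_right)
    qed
    have "norm (\<Sum>n. if n = 1 then 0 else of_real (a n) * nps n (of_real x)) \<le> (\<Sum>n. 2 powr (- (x - 2)) * (\<bar>a n\<bar> * real n powr (-2)))"
    proof (rule norm_suminf_le)
      fix n :: nat
      show "norm (if n = 1 then 0 else of_real (a n) * nps n (of_real x)) \<le> 2 powr (- (x - 2)) * (\<bar>a n\<bar> * real n powr (-2))"
      proof (cases "n \<le> 1")
        case True
        hence "n = 0 \<or> n = 1" by auto
        thus ?thesis using assms by (auto simp: dconv_def)
      next
        case False
        have "real n powr (- x) = real n powr (- (x - 2)) * real n powr (-2)" by (simp add: powr_add[symmetric])
        also have "\<dots> \<le> 2 powr (- (x - 2)) * real n powr (-2)"
          using False that by (intro mult_right_mono powr_mono2') auto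
        finally have "\<bar>a n\<bar> * real n powr (- x) \<le> \<bar>a n\<bar> * (2 powr (- (x - 2)) * real n powr (-2))" by (intro mult_left_mono) auto
        thus ?thesis using False by (simp add: norm_mult norm_nps mult_ac)
      qed
    qed (use K in \<open>intro summable_mult\<close>)
    also have "\<dots> = 2 powr (- (x - 2)) * K" unfolding K_def by (rule suminf_mult[OF K])
    finally show ?thesis using s2 by (simp add: sums_iff)
  qed
  have "((\<lambda>x::real. dseries a (of_real x) - of_real (a 1)) \<longlongrightarrow> 0) at_top"
  proof (rule Lim_null_comparison)
    show "\<forall>\<^sub>F x in at_top. norm (dseries a (of_real x) - of_real (a 1)) \<le> 2 powr (- (x - 2)) * K"
      by (rule eventually_mono[OF eventually_ge_at_top[of 2]]) (rule bd)
    show "((\<lambda>x::real. 2 powr (- (x - 2)) * K) \<longlongrightarrow> 0) at_top" by real_asymp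
  qed
  thus ?thesis by (simp add: LIM_zero_iff)
qed

section \<open>The zeta function and its logarithm\<close>

definition one_coeff :: "nat \<Rightarrow> real" where "one_coeff n = (if n = 0 then 0 else 1)"

definition zt :: "complex \<Rightarrow> complex" where "zt = dseries one_coeff"

lemma dconv_one: "dconv one_coeff"
  unfolding dconv_def
proof (intro conjI allI impI)
  fix x :: real assume "x > 1"
  hence "summable (\<lambda>n. real n powr (- x))" by (simp add: summable_real_powr_iff)
  thus "summable (\<lambda>n. \<bar>one_coeff n\<bar> * real n powr (- x))"
    by (rule summable_cong[THEN iffD1, rotated]) (auto simp: one_coeff_def)
qed (simp add: one_coeff_def)

lemma dconv_ln': "dconv (\<lambda>n. ln (real n))"
  using dconv_ln[OF dconv_one] by (rule dconv_mono) (auto simp: one_coeff_def)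

lemma dconv_mangoldt: "dconv mangoldt"
  using dconv_ln'
proof (rule dconv_mono)
  fix n :: nat
  show "\<bar>mangoldt n :: real\<bar> \<le> \<bar>ln (real n)\<bar>"
    using mangoldt_le[of n] by (cases "n = 0") auto
qed

lemma infsum_dseries:
  assumes "dconv a" "Re s > 1"
  shows "infsum (\<lambda>n. of_real (a n) * nps n s) {1..} = dseries a s"
    "(\<lambda>n. norm (of_real (a n) * nps n s)) summable_on {1..}"
proof -
  have "((\<lambda>n. of_real (a n) * nps n s) has_sum dseries a s) UNIV"
    by (rule norm_summable_imp_has_sum[OF dconv_norm_summable[OF assms] dconv_sums[OF assms]])
  hence "infsum (\<lambda>n. of_real (a n) * nps n s) UNIV = dseries a s" by (rule infsumI)
  moreover have "infsum (\<lambda>n. of_real (a n) * nps n s) UNIV = infsum (\<lambda>n. of_real (a n) * nps n s) {1..}"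
    using assms(1) by (intro infsum_cong_neutral) (auto simp: dconv_def not_less_eq_eq)
  ultimately show "infsum (\<lambda>n. of_real (a n) * nps n s) {1..} = dseries a s" by simp
  have "(\<lambda>n. norm (of_real (a n) * nps n s)) summable_on UNIV"
    using dconv_norm_summable[OF assms] by (intro norm_summable_imp_summable_on) simp
  thus "(\<lambda>n. norm (of_real (a n) * nps n s)) summable_on {1..}"
    by (rule summable_on_subset_banach) auto
qed

text \<open>The Dirichlet convolution of 1 and \<open>mangoldt\<close> is the logarithm. Absolute
  convergence permits regrouping the double sum over \<open>(d, m)\<close> by the product
  \<open>n = d * m\<close>, that is, over pairs \<open>(n, d)\<close> with \<open>d\<close> dividing
  \<open>n\<close>.\<close>

lemma zt_times_dseries_mangoldt:
  assumes s: "Re s > 1"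
  shows "zt s * dseries mangoldt s = dseries (\<lambda>n. ln (real n)) s"
proof -
  define A :: "nat set" where "A = {1..}"
  define f where "f d = complex_of_real (mangoldt d) * nps d s" for d
  define g where "g m = complex_of_real (one_coeff m) * nps m s" for m
  have f: "infsum f A = dseries mangoldt s" "(\<lambda>d. norm (f d)) summable_on A"
    unfolding f_def A_def by (rule infsum_dseries[OF dconv_mangoldt s])+
  have g: "infsum g A = zt s" "(\<lambda>m. norm (g m)) summable_on A"
    unfolding g_def A_def zt_def by (rule infsum_dseries[OF dconv_one s])+
  have "(\<lambda>x. norm (case x of (d, m) \<Rightarrow> f d * g m)) summable_on A \<times> A"
    unfolding Infinite_Sum.abs_summable_on_Sigma_iff
  proof (intro conjI ballI)
    fix d assume "d \<in> A"
    show "(\<lambda>m. norm (case (d, m) of (d, m) \<Rightarrow> f d * g m)) summable_on A"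
      using g(2) by (simp add: norm_mult summable_on_cmult_right)
  next
    have "(\<lambda>d. norm (f d) * infsum (\<lambda>m. norm (g m)) A) summable_on A"
      using f(2) by (intro summable_on_cmult_left)
    moreover have "infsum (\<lambda>m. norm (f d * g m)) A = norm (f d) * infsum (\<lambda>m. norm (g m)) A" for d
      by (simp add: norm_mult infsum_cmult_right')
    moreover have "infsum (\<lambda>m. norm (g m)) A \<ge> 0" by (intro infsum_nonneg) auto
    ultimately show "(\<lambda>d. norm (infsum (\<lambda>m. norm (case (d, m) of (d, m) \<Rightarrow> f d * g m)) A)) summable_on A"
      by (simp add: abs_mult)
  qed
  hence sm: "(\<lambda>(d, m). f d * g m) summable_on A \<times> A" by (rule Infinite_Sum.abs_summable_summable)
  have "infsum f A * infsum g A = infsum (\<lambda>d. infsum (\<lambda>m. f d * g m) A) A"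
    by (simp add: infsum_cmult_right' infsum_cmult_left')
  also have "\<dots> = infsum (\<lambda>(d, m). f d * g m) (A \<times> A)"
    by (rule infsum_Sigma'_banach[OF sm])
  also have bij: "bij_betw (\<lambda>(n, d). (d, n div d)) (Sigma A (\<lambda>n. {d. d dvd n})) (A \<times> A)"
    by (rule bij_betw_byWitness[where f' = "\<lambda>(d, m). (d * m, d)"])
       (auto simp: A_def Suc_le_eq dvd_div_eq_0_iff intro!: Nat.gr0I)
  have "infsum (\<lambda>(d, m). f d * g m) (A \<times> A) = infsum (\<lambda>x. case (case x of (n, d) \<Rightarrow> (d, n div d)) of (d, m) \<Rightarrow> f d * g m) (Sigma A (\<lambda>n. {d. d dvd n}))"
    by (rule infsum_reindex_bij_betw[OF bij, symmetric])
  also have "\<dots> = infsum (\<lambda>(n, d). f d * g (n div d)) (Sigma A (\<lambda>n. {d. d dvd n}))"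
    by (intro infsum_cong) auto
  also have "\<dots> = infsum (\<lambda>n. infsum (\<lambda>d. f d * g (n div d)) {d. d dvd n}) A"
  proof (rule infsum_Sigma'_banach[symmetric])
    have "(\<lambda>x. case (case x of (n, d) \<Rightarrow> (d, n div d)) of (d, m) \<Rightarrow> f d * g m) summable_on (Sigma A (\<lambda>n. {d. d dvd n}))"
      using summable_on_reindex_bij_betw[OF bij, of "\<lambda>(d, m). f d * g m"] sm by blast
    thus "(\<lambda>(n, d). f d * g (n div d)) summable_on Sigma A (\<lambda>n. {d. d dvd n})"
      by (simp add: case_prod_unfold)
  qed
  also have "\<dots> = infsum (\<lambda>n. complex_of_real (ln (real n)) * nps n s) A"
  proof (intro infsum_cong)
    fix n assume n: "n \<in> A"
    hence n0: "n > 0" by (auto simp: A_def)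
    hence fin: "finite {d. d dvd n}" by simp
    have "infsum (\<lambda>d. f d * g (n div d)) {d. d dvd n} = (\<Sum>d | d dvd n. f d * g (n div d))"
      using fin by simp
    also have "\<dots> = (\<Sum>d | d dvd n. complex_of_real (mangoldt d) * nps n s)"
    proof (rule sum.cong[OF refl])
      fix d assume "d \<in> {d. d dvd n}"
      then obtain m where m: "n = d * m" by auto
      hence "d > 0" "m > 0" using n0 by auto
      thus "f d * g (n div d) = complex_of_real (mangoldt d) * nps n s"
        by (simp add: f_def g_def m one_coeff_def nps_mult)
    qed
    also have "\<dots> = complex_of_real (\<Sum>d | d dvd n. mangoldt d) * nps n s" by (simp add: sum_distrib_right)
    also have "(\<Sum>d | d dvd n. mangoldt d) = ln (real n)" using mangoldt_sum[of n, where ?'a = real] n0 by simp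
    finally show "infsum (\<lambda>d. f d * g (n div d)) {d. d dvd n} = complex_of_real (ln (real n)) * nps n s" .
  qed
  also have "\<dots> = dseries (\<lambda>n. ln (real n)) s" unfolding A_def by (rule infsum_dseries(1)[OF dconv_ln' s])
  finally show ?thesis unfolding f g by (simp add: mult.commute)
qed

lemma dseries_mangoldt_logderiv:
  assumes "Re s > 1" shows "(zt has_field_derivative - (zt s * dseries mangoldt s)) (at s)"
proof -
  have "(\<lambda>n. - one_coeff n * ln (real n)) = (\<lambda>n. - ln (real n))" by (auto simp: one_coeff_def)
  thus ?thesis using dseries_has_field_derivative[OF dconv_one, of s] assms dconv_ln'
    by (simp add: zt_def dseries_uminus zt_times_dseries_mangoldt[unfolded zt_def])
qed

text \<open>The coefficients of log zeta: 1/k at a prime power p^k and 0 elsewhere. At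
  \<open>n \<le> 1\<close> the quotient is 0 because \<open>mangoldt\<close> vanishes there.\<close>

definition logz_coeff :: "nat \<Rightarrow> real" where "logz_coeff n = mangoldt n / ln (real n)"

lemma logz_coeff_bounds: "0 \<le> logz_coeff n" "logz_coeff n \<le> one_coeff n"
proof -
  show "0 \<le> logz_coeff n" unfolding logz_coeff_def
    by (cases "n = 0") (auto intro!: divide_nonneg_nonneg mangoldt_nonneg)
  show "logz_coeff n \<le> one_coeff n"
  proof (cases "n \<le> 1")
    case True
    hence "n = 0 \<or> n = 1" by auto
    thus ?thesis by (auto simp: logz_coeff_def one_coeff_def)
  next
    case False
    thus ?thesis using mangoldt_le[of n] by (simp add: logz_coeff_def one_coeff_def)
  qed
qed

lemma dconv_logz: "dconv logz_coeff"
  using dconv_one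
proof (rule dconv_mono)
  show "\<bar>logz_coeff n\<bar> \<le> \<bar>one_coeff n\<bar>" for n
    using logz_coeff_bounds[of n] by linarith
qed

text \<open>\<open>zt * exp (- P)\<close> has derivative 0 on a convex half-plane and tends to 1
  along the real axis. This replaces the Euler product and any choice of a branch of the logarithm,
  and shows at once that \<open>zt\<close> has no zeros there.\<close>

lemma zt_eq_exp:
  assumes "Re s > 1" shows "zt s = exp (dseries logz_coeff s)"
proof -
  define P where "P = dseries logz_coeff"
  define S where "S = {s. Re s > 1}"
  have dP: "(P has_field_derivative - dseries mangoldt x) (at x)" if "x \<in> S" for x
  proof -
    have "(\<lambda>n. - logz_coeff n * ln (real n)) = (\<lambda>n. - mangoldt n)"
    proof
      fix n :: nat
      show "- logz_coeff n * ln (real n) = - mangoldt n"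
      proof (cases "n \<le> 1")
        case True
        hence "n = 0 \<or> n = 1" by auto
        thus ?thesis by (auto simp: logz_coeff_def)
      qed (simp add: logz_coeff_def)
    qed
    thus ?thesis using dseries_has_field_derivative[OF dconv_logz, of x] that dconv_mangoldt
      by (simp add: P_def S_def dseries_uminus)
  qed
  have dz: "(zt has_field_derivative - (zt x * dseries mangoldt x)) (at x)" if "x \<in> S" for x
    using that by (intro dseries_mangoldt_logderiv) (simp add: S_def)
  have "\<exists>c. \<forall>x\<in>S. zt x * exp (- P x) = c"
  proof (rule has_field_derivative_zero_constant)
    show "convex S" unfolding S_def by (rule convex_halfspace_Re_gt)
    fix x assume x: "x \<in> S"
    have "((\<lambda>x. zt x * exp (- P x)) has_field_derivative 0) (at x)"
      by (rule derivative_eq_intros dz[OF x] dP[OF x] refl)+ (simp add: algebra_simps)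
    thus "((\<lambda>x. zt x * exp (- P x)) has_field_derivative 0) (at x within S)"
      by (rule has_field_derivative_at_within)
  qed
  then obtain c where c: "\<And>x. x \<in> S \<Longrightarrow> zt x * exp (- P x) = c" by blast
  have "((\<lambda>x::real. zt (of_real x) * exp (- P (of_real x))) \<longlongrightarrow> of_real (one_coeff 1) * exp (- of_real (logz_coeff 1))) at_top"
    unfolding zt_def P_def by (intro tendsto_intros dseries_tendsto dconv_one dconv_logz)
  moreover have "\<forall>\<^sub>F x::real in at_top. zt (of_real x) * exp (- P (of_real x)) = c"
    using eventually_gt_at_top[of 1] by eventually_elim (auto intro!: c simp: S_def)
  ultimately have "((\<lambda>x::real. c) \<longlongrightarrow> of_real (one_coeff 1) * exp (- of_real (logz_coeff 1))) at_top"
    by (rule Lim_transform_eventually)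
  hence "c = of_real (one_coeff 1) * exp (- of_real (logz_coeff 1))" by (simp add: tendsto_const_iff)
  hence "c = 1" by (simp add: one_coeff_def logz_coeff_def)
  hence "zt s * exp (- P s) = 1" using c[of s] assms by (simp add: S_def)
  thus ?thesis by (simp add: P_def exp_minus field_simps)
qed

lemma zt_nonzero: "Re s > 1 \<Longrightarrow> zt s \<noteq> 0"
  by (simp add: zt_eq_exp)

text \<open>Termwise from \<open>3 + 4 cos u + cos 2u = 2 (1 + cos u)^2\<close>, applied to the
  series of log zeta, whose coefficients are nonnegative.\<close>

lemma zt_three_four_one:
  assumes x: "x > 1"
  shows "norm (zt (of_real x)) ^ 3 * norm (zt (Complex x t)) ^ 4 * norm (zt (Complex x (2 * t))) \<ge> 1"
proof -
  define P where "P = dseries logz_coeff"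
  have re: "(\<lambda>n. logz_coeff n * (real n powr (- x) * cos (u * ln (real n)))) sums Re (P (Complex x u))" for u
  proof -
    have "(\<lambda>n. Re (of_real (logz_coeff n) * nps n (Complex x u))) sums Re (P (Complex x u))"
      unfolding P_def using x by (intro sums_Re dconv_sums dconv_logz) auto
    moreover have "Re (of_real (logz_coeff n) * nps n (Complex x u)) = logz_coeff n * (real n powr (- x) * cos (u * ln (real n)))" for n
    proof (cases "n = 0")
      case False
      thus ?thesis by (simp add: nps_def powr_def Re_exp)
    qed (simp add: logz_coeff_def)
    ultimately show ?thesis by (simp only:)
  qed
  have big: "(\<lambda>n. 3 * (logz_coeff n * (real n powr (- x) * cos (0 * ln (real n)))) + 4 * (logz_coeff n * (real n powr (- x) * cos (t * ln (real n))))
      + logz_coeff n * (real n powr (- x) * cos (2 * t * ln (real n)))) sums (3 * Re (P (Complex x 0)) + 4 * Re (P (Complex x t)) + Re (P (Complex x (2 * t))))"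
    by (intro sums_add sums_mult re)
  have "0 \<le> 3 * Re (P (Complex x 0)) + 4 * Re (P (Complex x t)) + Re (P (Complex x (2 * t)))"
  proof (rule sums_le[OF _ sums_zero big])
    fix n :: nat
    have "3 + 4 * cos (t * ln (real n)) + cos (2 * (t * ln (real n))) = 2 * (1 + cos (t * ln (real n)))\<^sup>2"
      unfolding cos_double_cos by (simp add: power2_eq_square algebra_simps)
    hence "0 \<le> 3 + 4 * cos (t * ln (real n)) + cos (2 * (t * ln (real n)))" by simp
    hence "0 \<le> logz_coeff n * real n powr (- x) * (3 + 4 * cos (t * ln (real n)) + cos (2 * (t * ln (real n))))"
      using logz_coeff_bounds(1)[of n] by (intro mult_nonneg_nonneg) auto
    thus "0 \<le> 3 * (logz_coeff n * (real n powr (- x) * cos (0 * ln (real n)))) + 4 * (logz_coeff n * (real n powr (- x) * cos (t * ln (real n))))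
      + logz_coeff n * (real n powr (- x) * cos (2 * t * ln (real n)))"
      by (simp add: algebra_simps)
  qed
  hence "1 \<le> exp (3 * Re (P (Complex x 0)) + 4 * Re (P (Complex x t)) + Re (P (Complex x (2 * t))))" by simp
  also have "\<dots> = norm (zt (of_real x)) ^ 3 * norm (zt (Complex x t)) ^ 4 * norm (zt (Complex x (2 * t)))"
  proof -
    have "norm (zt (Complex x u)) = exp (Re (P (Complex x u)))" for u
      using x by (simp add: zt_eq_exp P_def)
    moreover have "complex_of_real x = Complex x 0" by (simp add: complex_eq_iff)
    ultimately show ?thesis by (simp add: exp_add exp_of_nat_mult[symmetric])
  qed
  finally show ?thesis .
qed

text \<open>The series of log zeta is dominated by its value at the real part. The bound is used at
  a fixed distance from the line and at bounded height, where the right side is bounded below by a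
  constant.\<close>

lemma zt_lower_bound:
  assumes "Re s > 1" shows "norm (zt s) \<ge> 1 / norm (zt (of_real (Re s)))"
proof -
  define P where "P = dseries logz_coeff"
  have 1: "(\<lambda>n. logz_coeff n * real n powr (- Re s)) sums Re (P (of_real (Re s)))"
  proof -
    have "(\<lambda>n. Re (of_real (logz_coeff n) * nps n (of_real (Re s)))) sums Re (P (of_real (Re s)))"
      unfolding P_def using assms by (intro sums_Re dconv_sums dconv_logz) auto
    moreover have "Re (of_real (logz_coeff n) * nps n (of_real (Re s))) = logz_coeff n * real n powr (- Re s)" for n
      by (cases "n = 0") (auto simp: nps_of_real logz_coeff_def)
    ultimately show ?thesis by (simp only:)
  qed
  have "norm (P s) \<le> Re (P (of_real (Re s)))"
  proof -
    have "norm (P s) \<le> (\<Sum>n. norm (of_real (logz_coeff n) * nps n s))"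
      unfolding P_def dseries_def by (rule summable_norm[OF dconv_norm_summable[OF dconv_logz assms]])
    also have "(\<lambda>n. norm (of_real (logz_coeff n) * nps n s)) = (\<lambda>n. logz_coeff n * real n powr (- Re s))"
    proof
      fix n show "norm (of_real (logz_coeff n) * nps n s) = logz_coeff n * real n powr (- Re s)"
      proof (cases "n = 0")
        case False
        thus ?thesis using logz_coeff_bounds(1)[of n] by (simp add: norm_mult norm_nps)
      qed (simp add: logz_coeff_def)
    qed
    finally show ?thesis using 1 by (simp add: sums_iff)
  qed
  hence "- Re (P (of_real (Re s))) \<le> Re (P s)" using abs_Re_le_cmod[of "P s"] by linarith
  hence "exp (- Re (P (of_real (Re s)))) \<le> exp (Re (P s))" by simp
  thus ?thesis using assms by (simp add: zt_eq_exp P_def exp_minus field_simps)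
qed

section \<open>Bounds near the line of real part one\<close>

text \<open>\<open>s - 1\<close> times the difference between \<open>n\<close> to the
  \<open>- s\<close> and the integral of \<open>x\<close> to the \<open>- s\<close> over
  \<open>[n, n + 1]\<close>, with the integral in closed form.\<close>

definition vterm :: "nat \<Rightarrow> complex \<Rightarrow> complex" where
  "vterm n s = (s - 1) * nps n s - nps n (s - 1) + nps (Suc n) (s - 1)"

text \<open>\<open>s - 1\<close> times zeta, continued to \<open>Re s > 0\<close> (see
  \<open>zreg_eq_zt\<close> and \<open>zreg_holomorphic\<close>). The factor removes the pole; the
  value at 1 is 1.\<close>

definition zreg :: "complex \<Rightarrow> complex" where
  "zreg s = 1 + (\<Sum>n. vterm (Suc n) s)"

lemma exp_Ln_diff_bound:
  fixes s :: complex and x :: real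
  assumes n: "n > 0" and x: "real n \<le> x" "x \<le> real n + 1" and s: "Re s \<ge> 0"
  shows "norm (exp (- s * of_real (ln x)) - nps n s) \<le> norm s * real n powr (- Re s - 1)"
proof -
  define S where "S = closed_segment (of_nat n :: complex) (of_real x)"
  have S: "Re z \<ge> real n \<and> Im z = 0" if zS: "z \<in> S" for z
  proof -
    obtain u where u: "0 \<le> u" "z = (1 - u) *\<^sub>R of_nat n + u *\<^sub>R of_real x"
      using zS unfolding S_def in_segment by blast
    have "Re z = (1 - u) * real n + u * x" "Im z = 0" unfolding u(2) by simp_all
    hence "Re z = real n + u * (x - real n)" "Im z = 0" by (simp_all add: left_diff_distrib right_diff_distrib)
    moreover have "u * (x - real n) \<ge> 0" using u x by (intro mult_nonneg_nonneg) auto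
    ultimately show ?thesis by linarith
  qed
  have "norm (exp (- s * Ln (of_real x)) - exp (- s * Ln (of_nat n))) \<le> (norm s * real n powr (- Re s - 1)) * norm (of_real x - of_nat n :: complex)"
  proof (rule field_differentiable_bound[where S = S and f = "\<lambda>z. exp (- s * Ln z)" and f' = "\<lambda>z. - s * exp (- s * Ln z) / z"])
    show "convex S" by (simp add: S_def)
    fix z assume z: "z \<in> S"
    have zr: "z = of_real (Re z)" "Re z \<ge> real n" using S[OF z] by (auto simp: complex_eq_iff)
    have z0: "z \<notin> \<real>\<^sub>\<le>\<^sub>0" using zr n by (auto simp: complex_nonpos_Reals_iff)
    show "((\<lambda>z. exp (- s * Ln z)) has_field_derivative - s * exp (- s * Ln z) / z) (at z within S)"
      using z0 by (auto intro!: derivative_eq_intros simp: divide_inverse mult_ac)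
    define y where "y = Re z"
    have y: "y \<ge> real n" "z = of_real y" using zr by (auto simp: y_def)
    have y0: "y > 0" using y n by simp
    have "norm (- s * exp (- s * Ln z) / z) = norm s * y powr (- Re s) / y"
      using y0 unfolding y(2) by (simp add: norm_mult norm_divide Ln_of_real powr_def)
    also have "\<dots> = norm s * y powr (- Re s - 1)" using y0 by (simp add: powr_diff)
    also have "\<dots> \<le> norm s * real n powr (- Re s - 1)"
      using y n s by (intro mult_left_mono powr_mono2') auto
    finally show "norm (- s * exp (- s * Ln z) / z) \<le> norm s * real n powr (- Re s - 1)" .
  qed (auto simp: S_def)
  also have "\<dots> \<le> (norm s * real n powr (- Re s - 1)) * 1"
  proof (rule mult_left_mono)
    have "norm (of_real x - of_nat n :: complex) = norm (of_real (x - real n) :: complex)" by simp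
    also have "\<dots> \<le> 1" unfolding norm_of_real using x by simp
    finally show "norm (of_real x - of_nat n :: complex) \<le> 1" .
  qed auto
  finally show ?thesis using n x by (simp add: nps_def Ln_of_real Ln_of_nat)
qed

lemma vterm_bound_aux:
  assumes n: "n > 0" and B: "\<And>x. real n \<le> x \<Longrightarrow> x \<le> real n + 1 \<Longrightarrow> norm (exp (- s * of_real (ln x)) - nps n s) \<le> B"
  shows "norm (vterm n s) \<le> norm (s - 1) * B"
proof -
  define S where "S = closed_segment (of_nat n :: complex) (of_nat (Suc n))"
  have S: "Re z \<ge> real n \<and> Re z \<le> real n + 1 \<and> Im z = 0" if "z \<in> S" for z
    using that by (auto simp: S_def closed_segment_def algebra_simps)
  define f where "f z = exp ((1 - s) * Ln z) + (s - 1) * nps n s * z" for z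
  have "norm (f (of_nat (Suc n)) - f (of_nat n)) \<le> (norm (s - 1) * B) * norm (of_nat (Suc n) - of_nat n :: complex)"
  proof (rule field_differentiable_bound[where S = S and f' = "\<lambda>z. (1 - s) * (exp (- s * Ln z) - nps n s)"])
    show "convex S" by (simp add: S_def)
    fix z assume z: "z \<in> S"
    have zr: "z = of_real (Re z)" "Re z \<ge> real n" "Re z \<le> real n + 1" using S[OF z] by (auto simp: complex_eq_iff)
    have z0: "z \<notin> \<real>\<^sub>\<le>\<^sub>0" "z \<noteq> 0" using zr n by (auto simp: complex_nonpos_Reals_iff)
    define E where "E = exp (- s * Ln z)"
    have e: "exp ((1 - s) * Ln z) = z * E"
    proof -
      have "(1 - s) * Ln z = Ln z + (- s * Ln z)" by (simp add: algebra_simps)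
      thus ?thesis using z0 unfolding E_def by (simp only: exp_add) simp
    qed
    have D: "(f has_field_derivative exp ((1 - s) * Ln z) * ((1 - s) / z) + (s - 1) * nps n s) (at z within S)"
      unfolding f_def using z0 by (auto intro!: derivative_eq_intros simp: divide_inverse mult_ac)
    have "exp ((1 - s) * Ln z) * ((1 - s) / z) + (s - 1) * nps n s = (1 - s) * (E - nps n s)"
    proof -
      have "z * E * ((1 - s) / z) = (1 - s) * E" using z0 by simp
      thus ?thesis unfolding e by algebra
    qed
    with D show "(f has_field_derivative (1 - s) * (exp (- s * Ln z) - nps n s)) (at z within S)"
      by (simp only: E_def)
    have "norm (exp (- s * of_real (ln (Re z))) - nps n s) \<le> B" using zr by (intro B) auto
    moreover have "Ln z = of_real (ln (Re z))" using zr n by (metis Ln_of_real less_le_trans of_nat_0_less_iff)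
    ultimately show "norm ((1 - s) * (exp (- s * Ln z) - nps n s)) \<le> norm (s - 1) * B"
      by (simp add: norm_mult norm_minus_commute mult_left_mono)
  qed (auto simp: S_def)
  also have "f (of_nat (Suc n)) - f (of_nat n) = vterm n s"
  proof -
    have e: "exp ((1 - s) * Ln (of_nat m)) = nps m (s - 1)" if "m > 0" for m
      using that by (simp add: nps_def Ln_of_nat)
    show ?thesis unfolding f_def using n e[of n] e[of "Suc n"] by (simp add: vterm_def algebra_simps del: of_nat_Suc) (simp add: algebra_simps)
  qed
  finally show ?thesis by simp
qed

text \<open>Good for \<open>n\<close> above \<open>norm s\<close>, where \<open>x\<close> to the
  \<open>- s\<close> varies little over a unit interval; \<open>vterm_bound2\<close> is meant for
  smaller \<open>n\<close>.\<close>

lemma vterm_bound1: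
  assumes n: "n > 0" and s: "Re s \<ge> 0"
  shows "norm (vterm n s) \<le> norm (s - 1) * (norm s * real n powr (- Re s - 1))"
  using exp_Ln_diff_bound[OF n _ _ s] by (intro vterm_bound_aux[OF n]) auto

lemma vterm_bound2:
  assumes n: "n > 0" and s: "Re s \<ge> 0"
  shows "norm (vterm n s) \<le> norm (s - 1) * (2 * real n powr (- Re s))"
proof (rule vterm_bound_aux[OF n])
  fix x assume x: "real n \<le> x" "x \<le> real n + 1"
  have x0: "x > 0" using n x by simp
  have "norm (exp (- s * of_real (ln x)) - nps n s) \<le> norm (exp (- s * of_real (ln x))) + norm (nps n s)"
    by (rule norm_triangle_ineq4)
  also have "norm (exp (- s * of_real (ln x))) = x powr (- Re s)" using x0 by (simp add: powr_def)
  also have "x powr (- Re s) \<le> real n powr (- Re s)" using x n s by (intro powr_mono2') auto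
  finally show "norm (exp (- s * of_real (ln x)) - nps n s) \<le> 2 * real n powr (- Re s)"
    using n by (simp add: norm_nps)
qed

text \<open>Interpolating between the two trivial bounds gives a bound that grows slower than any fixed
  power of \<open>norm s\<close>, while still summable slightly to the left of the line \<open>Re s = 1\<close>.\<close>
lemma vterm_bound:
  assumes n: "n > 0" and s: "Re s \<ge> 0" and th: "0 \<le> th" "th \<le> 1"
  shows "norm (vterm n s) \<le> norm (s - 1) * (2 * norm s powr th * real n powr (- Re s - th))"
proof (cases "norm s \<le> real n")
  case True
  show ?thesis
  proof (cases "s = 0")
    case True
    thus ?thesis using vterm_bound1[OF n s] by simp
  next
    case False
    define u where "u = norm s / real n"
    have u: "0 < u" "u \<le> 1" using True False n by (auto simp: u_def)
    have "norm s * real n powr (- Re s - 1) = u * real n powr (- Re s)"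
      using n by (simp add: u_def powr_diff)
    also have "u \<le> u powr th" using u th powr_mono'[of th 1 u] by simp
    also have "u powr th = norm s powr th * real n powr (- th)"
      using n by (simp add: u_def powr_divide powr_minus field_simps)
    finally have "norm s * real n powr (- Re s - 1) \<le> norm s powr th * real n powr (- th) * real n powr (- Re s)"
      by (simp add: mult_right_mono)
    also have "\<dots> = norm s powr th * (real n powr (- th) * real n powr (- Re s))" by simp
    also have "real n powr (- th) * real n powr (- Re s) = real n powr (- Re s - th)"
      by (simp only: powr_add[symmetric]) (rule arg_cong[of _ _ "(powr) (real n)"], simp)
    also have "norm s powr th * real n powr (- Re s - th) \<le> 2 * norm s powr th * real n powr (- Re s - th)"
      by (simp add: mult.assoc)
    finally have "norm (s - 1) * (norm s * real n powr (- Re s - 1)) \<le> norm (s - 1) * (2 * norm s powr th * real n powr (- Re s - th))"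
      by (intro mult_left_mono) auto
    thus ?thesis using vterm_bound1[OF n s] by linarith
  qed
next
  case False
  have "1 = real n powr th * real n powr (- th)" using n by (simp add: powr_add[symmetric])
  also have "\<dots> \<le> norm s powr th * real n powr (- th)" using False th by (intro mult_right_mono powr_mono2) auto
  finally have "2 * real n powr (- Re s) * 1 \<le> 2 * real n powr (- Re s) * (norm s powr th * real n powr (- th))"
    by (intro mult_left_mono) auto
  also have "\<dots> = 2 * norm s powr th * real n powr (- Re s - th)"
    by (simp add: powr_diff powr_minus field_simps)
  finally have "norm (s - 1) * (2 * real n powr (- Re s)) \<le> norm (s - 1) * (2 * norm s powr th * real n powr (- Re s - th))"
    by (intro mult_left_mono) auto
  thus ?thesis using vterm_bound2[OF n s] by linarith
qed

text \<open>\<open>vterm_bound\<close> with interpolation exponent \<open>2 * e\<close>: up to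
  \<open>e\<close> to the left of the line, the terms still decay like
  \<open>n powr (- 1 - e)\<close>.\<close>

lemma zreg_minus_one_bound:
  assumes e: "0 < e" "e \<le> 1/2" and s: "Re s \<ge> 1 - e"
  shows "norm (zreg s - 1) \<le> 2 * (\<Sum>n. real (Suc n) powr (- 1 - e)) * norm (s - 1) * norm s powr (2 * e)"
proof -
  have sm: "summable (\<lambda>n. real (Suc n) powr (- 1 - e))"
    using e by (subst summable_Suc_iff) (simp add: summable_real_powr_iff)
  have "norm (\<Sum>n. vterm (Suc n) s) \<le> (\<Sum>n. (norm (s - 1) * 2 * norm s powr (2 * e)) * real (Suc n) powr (- 1 - e))"
  proof (rule norm_suminf_le)
    fix n
    have "norm (vterm (Suc n) s) \<le> norm (s - 1) * (2 * norm s powr (2 * e) * real (Suc n) powr (- Re s - 2 * e))"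
      using e s by (intro vterm_bound) auto
    also have "\<dots> \<le> norm (s - 1) * (2 * norm s powr (2 * e) * real (Suc n) powr (- 1 - e))"
      using e s by (intro mult_left_mono powr_mono) auto
    finally show "norm (vterm (Suc n) s) \<le> (norm (s - 1) * 2 * norm s powr (2 * e)) * real (Suc n) powr (- 1 - e)"
      by (simp add: mult.assoc)
  qed (use sm in \<open>intro summable_mult\<close>)
  also have "\<dots> = (norm (s - 1) * 2 * norm s powr (2 * e)) * (\<Sum>n. real (Suc n) powr (- 1 - e))"
    by (rule suminf_mult[OF sm])
  finally show ?thesis by (simp add: zreg_def mult_ac)
qed

text \<open>Only locally uniform convergence is at stake, so \<open>vterm_bound1\<close> serves as
  majorant, with exponent \<open>- d - 1\<close> on a ball of radius
  \<open>d = Re x / 2\<close>.\<close>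

lemma zreg_holomorphic: "zreg holomorphic_on {s. Re s > 0}"
proof -
  define S where "S = {s. Re s > 0}"
  have S: "open S" unfolding S_def by (rule open_Re_gt)
  have "\<exists>g. \<forall>x\<in>S. ((\<lambda>n. vterm (Suc n) x) sums g x) \<and> g field_differentiable (at x)"
  proof -
    obtain g where "\<forall>x\<in>S. ((\<lambda>n. vterm (Suc n) x) sums g x) \<and> g field_differentiable (at x)"
    proof (rule series_differentiable_comparison_complex[OF S])
      fix n x assume "x \<in> S"
      show "vterm (Suc n) field_differentiable at x"
        unfolding vterm_def[abs_def] nps_def field_differentiable_def
        by (rule exI) (auto intro!: derivative_eq_intros)
    next
      fix x assume x: "x \<in> S"
      define d where "d = Re x / 2"
      have d: "d > 0" using x by (auto simp: d_def S_def)
      define K where "K = (norm x + d + 1) * (norm x + d)"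
      define h :: "nat \<Rightarrow> complex" where "h n = of_real (K * real (Suc n) powr (- d - 1))" for n
      have K: "K \<ge> 0" using d by (simp add: K_def)
      have "summable (\<lambda>n. K * real (Suc n) powr (- d - 1))"
        using d by (intro summable_mult) (subst summable_Suc_iff, simp add: summable_real_powr_iff)
      hence hs: "summable h" unfolding h_def by (rule summable_of_real)
      have hr: "range h \<subseteq> \<real>\<^sub>\<ge>\<^sub>0" using K by (auto simp: h_def)
      have hb: "norm (vterm (Suc n) y) \<le> norm (h n)" if y: "y \<in> ball x d \<inter> S" for n y
      proof -
        have n1: "norm (x - y) < d" using y by (simp add: dist_norm)
        have "\<bar>Re x - Re y\<bar> \<le> norm (x - y)" using abs_Re_le_cmod[of "x - y"] by simp
        moreover have "2 * d = Re x" by (simp add: d_def)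
        ultimately have re: "Re y \<ge> d" using n1 by linarith
        have ny: "norm y \<le> norm x + d" using n1 norm_triangle_ineq2[of y x] by (simp add: norm_minus_commute)
        have ny1: "norm (y - 1) \<le> norm x + d + 1" using ny norm_triangle_ineq4[of y 1] by simp
        have "norm (vterm (Suc n) y) \<le> norm (y - 1) * (norm y * real (Suc n) powr (- Re y - 1))"
          using re d by (intro vterm_bound1) auto
        also have "\<dots> \<le> (norm x + d + 1) * ((norm x + d) * real (Suc n) powr (- d - 1))"
          using re ny ny1 d by (intro mult_mono powr_mono) auto
        also have "\<dots> = K * real (Suc n) powr (- d - 1)" by (simp add: K_def mult.assoc)
        also have "\<dots> = norm (h n)" unfolding h_def norm_of_real using K by simp
        finally show ?thesis .
      qed
      show "\<exists>d (h::nat \<Rightarrow> complex). 0 < d \<and> summable h \<and> range h \<subseteq> \<real>\<^sub>\<ge>\<^sub>0 \<and>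
        (\<forall>\<^sub>F n in sequentially. \<forall>y\<in>ball x d \<inter> S. norm (vterm (Suc n) y) \<le> norm (h n))"
        by (intro exI[of _ d] exI[of _ h] conjI always_eventually allI ballI d hs hr hb)
    qed blast
    thus ?thesis by blast
  qed
  then obtain g where g: "\<And>x. x \<in> S \<Longrightarrow> (\<lambda>n. vterm (Suc n) x) sums g x" "\<And>x. x \<in> S \<Longrightarrow> g field_differentiable (at x)"
    by blast
  have "g holomorphic_on S" unfolding holomorphic_on_def using g(2) field_differentiable_at_within by blast
  hence "(\<lambda>s. 1 + g s) holomorphic_on S" by (intro holomorphic_intros)
  moreover have "zreg s = 1 + g s" if "s \<in> S" for s using g(1)[OF that] by (simp add: zreg_def sums_iff)
  ultimately show ?thesis unfolding S_def[symmetric] by (simp cong: holomorphic_cong)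
qed

text \<open>For \<open>Re s > 1\<close> the corrections in \<open>vterm\<close> telescope to -1,
  which the leading 1 in \<open>zreg\<close> cancels.\<close>

lemma zreg_eq_zt:
  assumes s: "Re s > 1" shows "zreg s = (s - 1) * zt s"
proof -
  have 1: "(\<lambda>n. nps (Suc n) s) sums zt s"
  proof -
    have "(\<lambda>n. of_real (one_coeff n) * nps n s) sums zt s" unfolding zt_def by (rule dconv_sums[OF dconv_one s])
    hence "(\<lambda>n. of_real (one_coeff (Suc n)) * nps (Suc n) s) sums zt s"
      by (subst sums_Suc_iff) (simp add: one_coeff_def)
    thus ?thesis by (simp add: one_coeff_def)
  qed
  have lim: "(\<lambda>n. nps (Suc n) (s - 1)) \<longlonglongrightarrow> 0"
  proof (rule tendsto_norm_zero_cancel)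
    have "(\<lambda>n. real (Suc n) powr (- (Re s - 1))) \<longlonglongrightarrow> 0" using s by real_asymp
    thus "(\<lambda>n. norm (nps (Suc n) (s - 1))) \<longlonglongrightarrow> 0" by (simp add: norm_nps)
  qed
  have 2: "(\<lambda>n. nps (Suc (Suc n)) (s - 1) - nps (Suc n) (s - 1)) sums (0 - nps (Suc 0) (s - 1))"
    by (rule telescope_sums[OF lim])
  have "(\<lambda>n. (s - 1) * nps (Suc n) s + (nps (Suc (Suc n)) (s - 1) - nps (Suc n) (s - 1))) sums ((s - 1) * zt s + (0 - nps (Suc 0) (s - 1)))"
    by (intro sums_add sums_mult 1 2)
  moreover have "(\<lambda>n. (s - 1) * nps (Suc n) s + (nps (Suc (Suc n)) (s - 1) - nps (Suc n) (s - 1))) = (\<lambda>n. vterm (Suc n) s)"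
    by (auto simp: vterm_def)
  ultimately have "(\<lambda>n. vterm (Suc n) s) sums ((s - 1) * zt s - 1)" by simp
  thus ?thesis by (simp add: zreg_def sums_iff)
qed

text \<open>The height above the real axis, shifted to be at least \<open>3\<close> so that it dominates \<open>norm s\<close> and
  \<open>norm (s - 1)\<close> in the strip under consideration.\<close>
definition height :: "complex \<Rightarrow> real" where "height s = \<bar>Im s\<bar> + 3"

lemma height_ge: "height s \<ge> 3" by (simp add: height_def)

lemma norm_le_height:
  assumes "0 \<le> Re s" "Re s \<le> 3"
  shows "norm s \<le> height s" "norm (s - 1) \<le> height s"
proof -
  show "norm s \<le> height s" using cmod_le[of s] assms by (simp add: height_def)
  show "norm (s - 1) \<le> height s" using cmod_le[of "s - 1"] assms by (simp add: height_def)
qed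

lemma height_le_add: "height w \<le> height s + norm (w - s)"
  using abs_Im_le_cmod[of "w - s"] by (simp add: height_def)

lemma norm_of_real_minus_one: "norm (of_real x - 1 :: complex) = \<bar>x - 1\<bar>"
proof -
  have "(of_real x - 1 :: complex) = of_real (x - 1)" by simp
  thus ?thesis by (simp only: norm_of_real)
qed

lemma zreg_upper:
  assumes e: "0 < e" "e \<le> 1/2"
  shows "\<exists>C\<ge>1. \<forall>s. 1 - e \<le> Re s \<longrightarrow> Re s \<le> 3 \<longrightarrow>
     norm (zreg s - 1) \<le> C * norm (s - 1) * height s powr (2 * e) \<and> norm (zreg s) \<le> C * height s powr (1 + 2 * e)"
proof -
  define D where "D = 2 * (\<Sum>n. real (Suc n) powr (- 1 - e))"
  have sm: "summable (\<lambda>n. real (Suc n) powr (- 1 - e))"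
    using e by (subst summable_Suc_iff) (simp add: summable_real_powr_iff)
  have D: "D \<ge> 0" unfolding D_def by (intro mult_nonneg_nonneg suminf_nonneg sm) auto
  have 1: "norm (zreg s - 1) \<le> D * norm (s - 1) * height s powr (2 * e)" if s: "1 - e \<le> Re s" "Re s \<le> 3" for s
  proof -
    have "norm (zreg s - 1) \<le> D * norm (s - 1) * norm s powr (2 * e)"
      unfolding D_def by (rule zreg_minus_one_bound[OF e s(1)])
    also have "\<dots> \<le> D * norm (s - 1) * height s powr (2 * e)"
      using D e s by (intro mult_left_mono powr_mono2 norm_le_height) auto
    finally show ?thesis .
  qed
  have 2: "norm (zreg s) \<le> (D + 1) * height s powr (1 + 2 * e)" if s: "1 - e \<le> Re s" "Re s \<le> 3" for s
  proof -
    have h: "height s \<ge> 1" using height_ge[of s] by simp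
    have a1: "norm (zreg s) \<le> norm (zreg s - 1) + 1" using norm_triangle_ineq[of "zreg s - 1" 1] by simp
    have "norm (zreg s - 1) \<le> D * norm (s - 1) * height s powr (2 * e)" by (rule 1[OF s])
    also have "\<dots> \<le> D * height s * height s powr (2 * e)"
      using D e s by (intro mult_right_mono mult_left_mono norm_le_height) auto
    also have "\<dots> = D * height s powr (1 + 2 * e)" using h by (simp add: powr_add)
    finally have a2: "norm (zreg s - 1) \<le> D * height s powr (1 + 2 * e)" .
    have a3: "1 \<le> height s powr (1 + 2 * e)" using h e by (intro ge_one_powr_ge_zero) auto
    have "(D + 1) * height s powr (1 + 2 * e) = D * height s powr (1 + 2 * e) + height s powr (1 + 2 * e)"
      by (simp add: distrib_right)
    thus ?thesis using a1 a2 a3 by linarith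
  qed
  show ?thesis
  proof (intro exI[of _ "D + 1"] conjI allI impI)
    show "D + 1 \<ge> 1" using D by simp
    fix s assume s: "1 - e \<le> Re s" "Re s \<le> 3"
    show "norm (zreg s) \<le> (D + 1) * height s powr (1 + 2 * e)" by (rule 2[OF s])
    have "norm (zreg s - 1) \<le> D * (norm (s - 1) * height s powr (2 * e))" using 1[OF s] by (simp add: mult.assoc)
    also have "\<dots> \<le> (D + 1) * (norm (s - 1) * height s powr (2 * e))"
      by (rule mult_right_mono) (simp_all)
    finally show "norm (zreg s - 1) \<le> (D + 1) * norm (s - 1) * height s powr (2 * e)" by (simp add: mult.assoc)
  qed
qed

text \<open>Cauchy's estimate on a circle of radius \<open>e / 2\<close>, on which heights at most
  double.\<close>

lemma zreg_deriv_bound: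
  assumes e: "0 < e" "e \<le> 1/2"
  shows "\<exists>C\<ge>1. \<forall>s. 1 - e / 2 \<le> Re s \<longrightarrow> Re s \<le> 2 \<longrightarrow> norm (deriv zreg s) \<le> C * height s powr (1 + 2 * e)"
proof -
  obtain C where C: "C \<ge> 1" "\<And>s. 1 - e \<le> Re s \<Longrightarrow> Re s \<le> 3 \<Longrightarrow> norm (zreg s) \<le> C * height s powr (1 + 2 * e)"
    using zreg_upper[OF e] by blast
  have "norm (deriv zreg s) \<le> (C * 4 * (2 / e)) * height s powr (1 + 2 * e)"
    if s: "1 - e / 2 \<le> Re s" "Re s \<le> 2" for s
  proof -
    define r where "r = e / 2"
    have r: "r > 0" "r \<le> 1" using e by (auto simp: r_def)
    have re: "1 - e \<le> Re w \<and> Re w \<le> 3" if "norm (s - w) \<le> r" for w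
      using abs_Re_le_cmod[of "s - w"] that s e by (auto simp: r_def abs_le_iff)
    have sub: "cball s r \<subseteq> {s. Re s > 0}"
    proof
      fix w assume "w \<in> cball s r"
      hence "norm (s - w) \<le> r" by (simp add: dist_norm)
      hence "1 - e \<le> Re w" using re by blast
      thus "w \<in> {s. Re s > 0}" using e by simp
    qed
    have hol: "zreg holomorphic_on cball s r" by (rule holomorphic_on_subset[OF zreg_holomorphic sub])
    have "norm ((deriv ^^ 1) zreg s) \<le> fact 1 * (C * 4 * height s powr (1 + 2 * e)) / r ^ 1"
    proof (rule Cauchy_inequality)
      show "zreg holomorphic_on ball s r" by (rule holomorphic_on_subset[OF hol]) auto
      show "continuous_on (cball s r) zreg" by (rule holomorphic_on_imp_continuous_on[OF hol])
      fix w assume w: "norm (s - w) = r"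
      have "norm (zreg w) \<le> C * height w powr (1 + 2 * e)" using re[of w] w by (intro C) auto
      also have "height w powr (1 + 2 * e) \<le> (2 * height s) powr (1 + 2 * e)"
      proof (rule powr_mono2)
        show "height w \<le> 2 * height s"
          using height_le_add[of w s] w r height_ge[of s] by (simp add: norm_minus_commute)
      qed (use e height_ge[of w] in auto)
      also have "\<dots> = 2 powr (1 + 2 * e) * height s powr (1 + 2 * e)"
        using height_ge[of s] by (simp add: powr_mult)
      also have "\<dots> \<le> 2 powr 2 * height s powr (1 + 2 * e)"
        using e by (intro mult_right_mono powr_mono) auto
      finally show "norm (zreg w) \<le> C * 4 * height s powr (1 + 2 * e)" using C(1) by simp
    qed (use r in auto)
    thus ?thesis by (simp add: r_def)
  qed
  moreover have "C * 4 * (2 / e) \<ge> 1"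
  proof -
    have "1 \<le> 2 / e" using e by (simp add: field_simps)
    hence "4 * 1 \<le> (C * 4) * (2 / e)" using C(1) by (intro mult_mono) auto
    thus ?thesis by simp
  qed
  ultimately show ?thesis by (intro exI[of _ "C * 4 * (2 / e)"]) auto
qed

section \<open>Lower bounds for \<open>zreg\<close> on both sides of the line\<close>

text \<open>Near 1, \<open>zreg s - 1\<close> is bounded by a constant times
  \<open>norm (s - 1)\<close>. The 3-4-1 inequality gives nothing at small heights, where the factor
  at height \<open>2 * t\<close> meets the pole.\<close>

lemma zreg_near_one:
  "\<exists>t0. 0 < t0 \<and> t0 \<le> 1/4 \<and> (\<forall>s. norm (s - 1) \<le> 2 * t0 \<longrightarrow> norm (zreg s) \<ge> 1/2)"
proof -
  obtain C where C: "C \<ge> 1" "\<And>s. 1 - 1/2 \<le> Re s \<Longrightarrow> Re s \<le> 3 \<Longrightarrow> norm (zreg s - 1) \<le> C * norm (s - 1) * height s powr (2 * (1/2))"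
    using zreg_upper[of "1/2"] by auto
  \<comment> \<open>Solves \<open>C * (2 * t0) * 4 = 1/2\<close>, where 4 bounds the height near
    1.\<close>
  define t0 where "t0 = 1 / (16 * C)"
  have t0: "0 < t0" "t0 \<le> 1/4" using C by (auto simp: t0_def field_simps)
  have "norm (zreg s) \<ge> 1/2" if s: "norm (s - 1) \<le> 2 * t0" for s
  proof -
    have s2: "norm (s - 1) \<le> 1/2" using s t0 by simp
    have re: "1/2 \<le> Re s" "Re s \<le> 3" "\<bar>Im s\<bar> \<le> 1/2"
      using abs_Re_le_cmod[of "s - 1"] abs_Im_le_cmod[of "s - 1"] s2 by auto
    have h: "height s \<le> 4" using re by (simp add: height_def)
    have "norm (zreg s - 1) \<le> C * norm (s - 1) * height s powr (2 * (1/2))" using re by (intro C) auto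
    also have "\<dots> \<le> C * (2 * t0) * 4"
      using s h C t0 height_ge[of s] by (intro mult_mono) auto
    also have "\<dots> = 1/2" using C by (simp add: t0_def)
    finally show ?thesis using norm_triangle_ineq2[of 1 "1 - zreg s"] by (simp add: norm_minus_commute)
  qed
  thus ?thesis using t0 by blast
qed

text \<open>With \<open>x = Re s\<close>, zeta is \<open>O(1 / (x - 1))\<close> at \<open>x\<close>
  and \<open>O(height powr (2 * e))\<close> at ordinate \<open>2 * t\<close>, so the 3-4-1
  inequality bounds the fourth power of zeta at \<open>s\<close> from below by a multiple of
  \<open>(x - 1)^3 * height powr (- 2 * e)\<close>. The factor \<open>s - 1\<close> adds one power
  of the height.\<close>

lemma zreg_lower_right:
  assumes e: "0 < e" "e \<le> 1/2" and t0: "0 < t0"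
  shows "\<exists>c>0. \<forall>s. 1 < Re s \<longrightarrow> Re s \<le> 2 \<longrightarrow> t0 \<le> \<bar>Im s\<bar> \<longrightarrow>
     norm (zreg s) \<ge> c * (Re s - 1) powr (3/4) * height s powr (1 - e / 2)"
proof -
  obtain C where C: "C \<ge> 1" "\<And>s. 1 - e \<le> Re s \<Longrightarrow> Re s \<le> 3 \<Longrightarrow> norm (zreg s) \<le> C * height s powr (1 + 2 * e)"
    using zreg_upper[OF e] by blast
  \<comment> \<open>For \<open>\<bar>Im s\<bar> \<ge> t0\<close> the ratio of
    \<open>\<bar>Im s\<bar>\<close> to \<open>height s\<close> is smallest at
    \<open>t0\<close>.\<close>
  define q where "q = t0 / (t0 + 3)"
  have q: "0 < q" "q \<le> 1" using t0 by (auto simp: q_def)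
  have hq: "q * height s \<le> \<bar>Im s\<bar>" if "t0 \<le> \<bar>Im s\<bar>" for s
  proof -
    have "t0 * (\<bar>Im s\<bar> + 3) \<le> \<bar>Im s\<bar> * (t0 + 3)" using that t0 by (simp add: algebra_simps)
    thus ?thesis using t0 by (simp add: q_def height_def field_simps)
  qed
  define K where "K = (C * 9) ^ 3 * (C * 4 / q)"
  have K: "K > 0" using C q by (simp add: K_def)
  define c where "c = q / K powr (1/4)"
  have c: "c > 0" using q K by (simp add: c_def)
  have "norm (zreg s) \<ge> c * (Re s - 1) powr (3/4) * height s powr (1 - e / 2)"
    if s: "1 < Re s" "Re s \<le> 2" "t0 \<le> \<bar>Im s\<bar>" for s
  proof -
    define x t where "x = Re s" and "t = Im s"
    have sx: "s = Complex x t" by (simp add: x_def t_def)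
    have x: "1 < x" "x \<le> 2" using s by (auto simp: x_def)
    have h: "height s \<ge> 3" by (rule height_ge)
    have z1: "norm (zt (of_real x)) \<le> C * 9 / (x - 1)"
    proof -
      have "(x - 1) * norm (zt (of_real x)) = norm ((of_real x - 1) * zt (of_real x))"
        using x by (simp add: norm_mult norm_of_real_minus_one)
      also have "\<dots> = norm (zreg (of_real x))" using x by (subst zreg_eq_zt) auto
      also have "\<dots> \<le> C * height (of_real x) powr (1 + 2 * e)" using x e by (intro C) auto
      also have "\<dots> = C * 3 powr (1 + 2 * e)" by (simp add: height_def)
      also have "\<dots> \<le> C * 3 powr 2" using e C by (intro mult_left_mono powr_mono) auto
      finally show ?thesis using x by (simp add: field_simps)
    qed
    have z2: "norm (zt (Complex x (2 * t))) \<le> C * 4 / q * height s powr (2 * e)"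
    proof -
      define w where "w = Complex x (2 * t)"
      have hw: "height w \<le> 2 * height s" "height w \<ge> 0" by (simp_all add: w_def sx height_def)
      have "q * height s \<le> \<bar>t\<bar>" using hq[OF s(3)] by (simp add: t_def)
      also have "\<dots> \<le> norm (w - 1)" using abs_Im_le_cmod[of "w - 1"] by (simp add: w_def)
      finally have w1: "q * height s \<le> norm (w - 1)" .
      have "(q * height s) * norm (zt w) \<le> norm (w - 1) * norm (zt w)" using w1 by (intro mult_right_mono) auto
      also have "\<dots> = norm (zreg w)" using x by (subst zreg_eq_zt) (auto simp: w_def norm_mult)
      also have "\<dots> \<le> C * height w powr (1 + 2 * e)" using x e by (intro C) (auto simp: w_def)
      also have "\<dots> \<le> C * (2 * height s) powr (1 + 2 * e)" using C hw e by (intro mult_left_mono powr_mono2) auto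
      also have "\<dots> = C * (2 powr (1 + 2 * e) * height s powr (1 + 2 * e))" using h by (simp add: powr_mult)
      also have "\<dots> \<le> C * (2 powr 2 * height s powr (1 + 2 * e))" using C e by (intro mult_left_mono mult_right_mono powr_mono) auto
      also have "\<dots> = C * 4 * height s powr (2 * e) * height s" using h by (simp add: powr_add)
      finally have "q * norm (zt w) \<le> C * 4 * height s powr (2 * e)" using h by (simp add: mult_ac)
      thus ?thesis using q by (simp add: w_def field_simps)
    qed
    have zpos: "norm (zt s) > 0" using zt_nonzero s by simp
    have "1 \<le> norm (zt (of_real x)) ^ 3 * norm (zt s) ^ 4 * norm (zt (Complex x (2 * t)))"
      using zt_three_four_one[OF x(1), of t] by (simp add: sx)
    also have "\<dots> \<le> (C * 9 / (x - 1)) ^ 3 * norm (zt s) ^ 4 * (C * 4 / q * height s powr (2 * e))"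
      using z1 z2 C q x by (intro mult_mono power_mono) auto
    also have "\<dots> = norm (zt s) ^ 4 * (K * height s powr (2 * e) / (x - 1) ^ 3)"
      using x by (simp add: K_def power_divide field_simps)
    finally have "(x - 1) ^ 3 \<le> norm (zt s) ^ 4 * (K * height s powr (2 * e))"
      using x by (simp add: field_simps)
    hence le4: "(x - 1) ^ 3 / (K * height s powr (2 * e)) \<le> norm (zt s) ^ 4"
      using K h by (simp add: field_simps)
    have "((x - 1) ^ 3 / (K * height s powr (2 * e))) powr (1/4) \<le> (norm (zt s) ^ 4) powr (1/4)"
      using le4 x K h by (intro powr_mono2) auto
    also have "(norm (zt s) ^ 4) powr (1/4) = norm (zt s)"
    proof -
      have "norm (zt s) ^ 4 = norm (zt s) powr 4" using zpos by simp
      thus ?thesis by (simp only: powr_powr) simp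
    qed
    also have "((x - 1) ^ 3 / (K * height s powr (2 * e))) powr (1/4) = (x - 1) powr (3/4) / (K powr (1/4) * height s powr (e / 2))"
    proof -
      have "(x - 1) ^ 3 = (x - 1) powr 3" using x by simp
      thus ?thesis using K h x by (simp only:) (simp add: powr_divide powr_mult powr_powr del: powr_numeral)
    qed
    finally have zl: "(x - 1) powr (3/4) / (K powr (1/4) * height s powr (e / 2)) \<le> norm (zt s)" .
    have "c * (x - 1) powr (3/4) * height s powr (1 - e / 2) = (q * height s) * ((x - 1) powr (3/4) / (K powr (1/4) * height s powr (e / 2)))"
      using h by (simp add: c_def powr_diff)
    also have "\<dots> \<le> norm (s - 1) * norm (zt s)"
    proof (rule mult_mono)
      show "q * height s \<le> norm (s - 1)" using hq[OF s(3)] abs_Im_le_cmod[of "s - 1"] by simp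
    qed (use zl K h in auto)
    also have "\<dots> = norm (zreg s)" using s by (simp add: zreg_eq_zt norm_mult)
    finally show ?thesis by (simp add: x_def)
  qed
  thus ?thesis using c by blast
qed

text \<open>At distance \<open>n\<close> to the right of the line \<open>zreg\<close> is at least of
  order \<open>n powr (3/4) * height powr (1 - e/2)\<close>, and moving left by \<open>2 * n\<close>
  changes it by at most order \<open>n * height powr (1 + 2 * e)\<close>. The two balance at
  \<open>n\<close> of order \<open>height powr (- 10 * e)\<close>, where both are of order
  \<open>height powr (1 - 8 * e)\<close>; a small factor \<open>k\<close> lets the lower bound
  win.\<close>

lemma zreg_lower_bound:
  assumes e: "0 < e" "e \<le> 1/20"
  shows "\<exists>c k. 0 < c \<and> 0 < k \<and> k \<le> 1/4 \<and> k \<le> e / 2 \<and> (\<forall>s. 1 - k * height s powr (- 10 * e) \<le> Re s \<longrightarrow> Re s \<le> 2 \<longrightarrow>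
     norm (zreg s) \<ge> c * height s powr (1 - 8 * e))"
proof -
  have e2: "e \<le> 1/2" using e by simp
  obtain t0 where t0: "0 < t0" "t0 \<le> 1/4" "\<And>s. norm (s - 1) \<le> 2 * t0 \<Longrightarrow> norm (zreg s) \<ge> 1/2"
    using zreg_near_one by blast
  obtain c1 where c1: "c1 > 0" "\<And>s. 1 < Re s \<Longrightarrow> Re s \<le> 2 \<Longrightarrow> t0 \<le> \<bar>Im s\<bar> \<Longrightarrow>
     norm (zreg s) \<ge> c1 * (Re s - 1) powr (3/4) * height s powr (1 - e / 2)"
    using zreg_lower_right[OF e(1) e2 t0(1)] by blast
  obtain C2 where C2: "C2 \<ge> 1" "\<And>s. 1 - e / 2 \<le> Re s \<Longrightarrow> Re s \<le> 2 \<Longrightarrow> norm (deriv zreg s) \<le> C2 * height s powr (1 + 2 * e)"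
    using zreg_deriv_bound[OF e(1) e2] by blast
  obtain C where C: "C \<ge> 1" "\<And>s. 1 - e \<le> Re s \<Longrightarrow> Re s \<le> 3 \<Longrightarrow> norm (zreg s) \<le> C * height s powr (1 + 2 * e)"
    using zreg_upper[OF e(1) e2] by blast
  \<comment> \<open>\<open>t0\<close> and \<open>e / 2\<close> keep the strip within reach of
    \<open>zreg_near_one\<close> and of the derivative bound; the fourth power makes the change at
    most half of the lower bound.\<close>
  define k where "k = min (min t0 (e / 2)) ((c1 / (4 * C2)) ^ 4)"
  have k: "0 < k" "k \<le> 1/4" "k \<le> e / 2" "k \<le> t0" "k \<le> (c1 / (4 * C2)) ^ 4"
    using t0 e c1 C2 by (auto simp: k_def)
  have k4: "k powr (1/4) \<le> c1 / (4 * C2)"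
  proof -
    have p: "c1 / (4 * C2) > 0" using c1 C2 by simp
    have "k powr (1/4) \<le> ((c1 / (4 * C2)) ^ 4) powr (1/4)" using k by (intro powr_mono2) auto
    also have "(c1 / (4 * C2)) ^ 4 = (c1 / (4 * C2)) powr 4" using p by simp
    also have "((c1 / (4 * C2)) powr 4) powr (1/4) = c1 / (4 * C2)" by (simp only: powr_powr) (use c1(1) C2(1) in simp)
    finally show ?thesis .
  qed
  define c where "c = min (c1 / 2 * k powr (3/4)) (min (1/8) (t0\<^sup>2 / (C * 36)))"
  have c: "c > 0" "c \<le> c1 / 2 * k powr (3/4)" "c \<le> 1/8" "c \<le> t0\<^sup>2 / (C * 36)" using c1 k t0 C by (auto simp: c_def)
  have main: "norm (zreg s) \<ge> c * height s powr (1 - 8 * e)"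
    if s: "1 - k * height s powr (- 10 * e) \<le> Re s" "Re s \<le> 2" for s
  proof -
    have h: "height s \<ge> 3" by (rule height_ge)
    define n where "n = k * height s powr (- 10 * e)"
    have hp: "height s powr (- 10 * e) \<le> 1" using h e powr_mono[of "- 10 * e" 0 "height s"] by simp
    have n: "0 < n" "n \<le> k" unfolding n_def using k hp h by (auto simp: mult_left_le)
    show ?thesis
    proof (cases "t0 \<le> \<bar>Im s\<bar>")
      case True
      have n34: "n powr (3/4) = k powr (3/4) * height s powr (- 15/2 * e)"
        using k h by (simp add: n_def powr_mult powr_powr)
      have low: "c1 * n powr (3/4) * height s powr (1 - e / 2) = c1 * k powr (3/4) * height s powr (1 - 8 * e)"
      proof -
        have "height s powr (- 15/2 * e) * height s powr (1 - e / 2) = height s powr (1 - 8 * e)"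
          by (simp add: powr_add[symmetric])
        thus ?thesis by (simp only: n34 mult.assoc)
      qed
      have cc: "c * height s powr (1 - 8 * e) \<le> c1 / 2 * k powr (3/4) * height s powr (1 - 8 * e)"
        using c(2) by (intro mult_right_mono) auto
      show ?thesis
      proof (cases "Re s \<ge> 1 + n")
        case True': True
        have "c1 * n powr (3/4) * height s powr (1 - e / 2) \<le> c1 * (Re s - 1) powr (3/4) * height s powr (1 - e / 2)"
          using True' n c1 by (intro mult_right_mono mult_left_mono powr_mono2) auto
        also have "\<dots> \<le> norm (zreg s)" using True True' n s by (intro c1) auto
        finally have "c1 * k powr (3/4) * height s powr (1 - 8 * e) \<le> norm (zreg s)" unfolding low .
        moreover have "c1 / 2 * k powr (3/4) * height s powr (1 - 8 * e) \<le> c1 * k powr (3/4) * height s powr (1 - 8 * e)"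
          using c1 by (intro mult_right_mono) auto
        ultimately show ?thesis using cc by linarith
      next
        case False
        define s' where "s' = Complex (1 + n) (Im s)"
        have hs': "height s' = height s" by (simp add: s'_def height_def)
        have n4: "n \<le> 1/4" using n k by simp
        define S where "S = closed_segment s s'"
        have S: "1 - n \<le> Re w \<and> Re w \<le> 1 + n \<and> Im w = Im s" if wS: "w \<in> S" for w
        proof -
          obtain u where u: "0 \<le> u" "u \<le> 1" "w = (1 - u) *\<^sub>R s + u *\<^sub>R s'"
            using wS unfolding S_def in_segment by blast
          have "Re w = (1 - u) * Re s + u * (1 + n)" "Im w = (1 - u) * Im s + u * Im s"
            by (simp_all add: u(3) s'_def)
          moreover have "(1 - u) * (1 - n) + u * (1 - n) \<le> (1 - u) * Re s + u * (1 + n)"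
            using u s n False by (intro add_mono mult_left_mono) (auto simp: n_def)
          moreover have "(1 - u) * Re s + u * (1 + n) \<le> (1 - u) * (1 + n) + u * (1 + n)"
            using u False by (intro add_mono mult_left_mono) auto
          ultimately show ?thesis by (simp add: algebra_simps)
        qed
        have "norm (zreg s - zreg s') \<le> (C2 * height s powr (1 + 2 * e)) * norm (s - s')"
        proof (rule field_differentiable_bound[where S = S and f' = "deriv zreg"])
          show "convex S" by (simp add: S_def)
          fix w assume w: "w \<in> S"
          have re: "1 - n \<le> Re w" "Re w \<le> 1 + n" "Im w = Im s" using S[OF w] by auto
          have "Re w > 0" using re n4 by linarith
          hence "(zreg has_field_derivative deriv zreg w) (at w)"
            by (intro holomorphic_derivI[OF zreg_holomorphic open_Re_gt]) simp
          thus "(zreg has_field_derivative deriv zreg w) (at w within S)"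
            by (rule has_field_derivative_at_within)
          have "1 - e / 2 \<le> Re w" using re n k by linarith
          moreover have "Re w \<le> 2" using re n4 by linarith
          ultimately have "norm (deriv zreg w) \<le> C2 * height w powr (1 + 2 * e)" by (rule C2)
          thus "norm (deriv zreg w) \<le> C2 * height s powr (1 + 2 * e)" using re by (simp add: height_def)
        qed (auto simp: S_def)
        also have "norm (s - s') \<le> 2 * n"
        proof -
          have "s - s' = of_real (Re s - (1 + n))" by (simp add: s'_def complex_eq_iff)
          hence "norm (s - s') = \<bar>Re s - (1 + n)\<bar>" by (metis norm_of_real)
          thus ?thesis using False s(1) by (simp add: n_def)
        qed
        hence "(C2 * height s powr (1 + 2 * e)) * norm (s - s') \<le> (C2 * height s powr (1 + 2 * e)) * (2 * n)"
          using C2 by (intro mult_left_mono) auto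
        also have "\<dots> \<le> c1 / 2 * k powr (3/4) * height s powr (1 - 8 * e)"
        proof -
          have "n = k powr (1/4) * k powr (3/4) * height s powr (- 10 * e)" using k by (simp add: n_def powr_add[symmetric])
          also have "\<dots> \<le> c1 / (4 * C2) * k powr (3/4) * height s powr (- 10 * e)"
            using k4 by (intro mult_right_mono) auto
          finally have "(C2 * height s powr (1 + 2 * e)) * (2 * n) \<le> (C2 * height s powr (1 + 2 * e)) * (2 * (c1 / (4 * C2) * k powr (3/4) * height s powr (- 10 * e)))"
            using C2 by (intro mult_left_mono) auto
          also have "\<dots> = c1 / 2 * k powr (3/4) * (height s powr (1 + 2 * e) * height s powr (- 10 * e))" using C2 by simp
          also have "height s powr (1 + 2 * e) * height s powr (- 10 * e) = height s powr (1 - 8 * e)"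
            by (simp add: powr_add[symmetric])
          finally show ?thesis .
        qed
        finally have d: "norm (zreg s - zreg s') \<le> c1 / 2 * k powr (3/4) * height s powr (1 - 8 * e)" .
        have "norm (zreg s') \<ge> c1 * (Re s' - 1) powr (3/4) * height s' powr (1 - e / 2)"
          using n n4 True by (intro c1) (auto simp: s'_def)
        moreover have "Re s' - 1 = n" by (simp add: s'_def)
        ultimately have "norm (zreg s') \<ge> c1 * k powr (3/4) * height s powr (1 - 8 * e)"
          by (simp only: hs' low)
        moreover have "norm (zreg s') \<le> norm (zreg s) + norm (zreg s - zreg s')"
          using norm_triangle_ineq2[of "zreg s'" "zreg s"] by (simp add: norm_minus_commute)
        ultimately show ?thesis using d cc by linarith
      qed
    next
      case False
      \<comment> \<open>At bounded height any positive constant will do: near 1 it comes from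
        \<open>zreg_near_one\<close>, further right from \<open>zt_lower_bound\<close>.\<close>
      have h4: "height s \<le> 4" using False t0 by (simp add: height_def)
      have hh: "height s powr (1 - 8 * e) \<le> 4"
        using h4 h e powr_mono[of "1 - 8 * e" 1 "height s"] by simp
      have hc: "c * height s powr (1 - 8 * e) \<le> c * 4" using hh c by (intro mult_left_mono) auto
      show ?thesis
      proof (cases "Re s \<le> 1 + t0")
        case True
        have "1 - n \<le> Re s" using s(1) unfolding n_def .
        hence "\<bar>Re s - 1\<bar> \<le> t0" using True n k(4) by linarith
        hence "\<bar>Re (s - 1)\<bar> \<le> t0" by simp
        hence "norm (s - 1) \<le> 2 * t0" using cmod_le[of "s - 1"] False by simp
        hence "norm (zreg s) \<ge> 1/2" by (rule t0(3))
        thus ?thesis using hc c(3) by linarith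
      next
        case False
        have re: "Re s > 1 + t0" "Re s > 1" using False t0 by auto
        have "norm (zt (of_real (Re s))) \<le> C * 9 / t0"
        proof -
          have "t0 * norm (zt (of_real (Re s))) \<le> norm (of_real (Re s) - 1 :: complex) * norm (zt (of_real (Re s)))"
            using re by (intro mult_right_mono) (auto simp: norm_of_real_minus_one)
          also have "\<dots> = norm (zreg (of_real (Re s)))" using re by (subst zreg_eq_zt) (auto simp: norm_mult)
          also have "\<dots> \<le> C * height (of_real (Re s)) powr (1 + 2 * e)" using re e s by (intro C) auto
          also have "\<dots> = C * 3 powr (1 + 2 * e)" by (simp add: height_def)
          also have "\<dots> \<le> C * 3 powr 2" using e C by (intro mult_left_mono powr_mono) auto
          finally show ?thesis using t0 by (simp add: field_simps)
        qed
        hence "1 / (C * 9 / t0) \<le> 1 / norm (zt (of_real (Re s)))"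
          using zt_nonzero[of "of_real (Re s)"] re C(1) t0(1)
          by (intro divide_left_mono) (auto intro!: divide_pos_pos mult_pos_pos)
        also have "\<dots> \<le> norm (zt s)" by (rule zt_lower_bound[OF re(2)])
        finally have "t0 / (C * 9) \<le> norm (zt s)" by simp
        hence "t0 * (t0 / (C * 9)) \<le> norm (s - 1) * norm (zt s)"
          using t0 C re abs_Re_le_cmod[of "s - 1"] by (intro mult_mono) auto
        also have "\<dots> = norm (zreg s)" using re by (simp add: zreg_eq_zt norm_mult)
        finally have "4 * (t0\<^sup>2 / (C * 36)) \<le> norm (zreg s)" by (simp add: power2_eq_square)
        thus ?thesis using hc c(4) by linarith
      qed
    qed
  qed
  show ?thesis using c k main by blast
qed

section \<open>The logarithmic derivative with its pole removed\<close>

text \<open>\<open>- zeta' / zeta - zeta\<close> written through \<open>zreg\<close>: the poles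
  \<open>1 / (s - 1)\<close> of both parts cancel identically, and the \<open>if\<close> fills the
  removable singularity that remains.\<close>

definition pnt_fun :: "complex \<Rightarrow> complex" where
  "pnt_fun s = - deriv zreg s / zreg s - (if s = 1 then deriv zreg 1 else (zreg s - zreg 1) / (s - 1))"

lemma zreg_1: "zreg 1 = 1"
proof -
  have "vterm (Suc n) 1 = 0" for n by (simp add: vterm_def) (simp add: nps_def)
  thus ?thesis by (simp add: zreg_def)
qed

lemma pnt_fun_eq:
  assumes s: "Re s > 1"
  shows "pnt_fun s = dseries (\<lambda>n. mangoldt n - one_coeff n) s"
proof -
  have s1: "s \<noteq> 1" using s by auto
  have d: "deriv zreg s = zt s + (s - 1) * (- (zt s * dseries mangoldt s))"
  proof (rule DERIV_imp_deriv)
    have "((\<lambda>s. (s - 1) * zt s) has_field_derivative zt s + (s - 1) * (- (zt s * dseries mangoldt s))) (at s)"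
      by (rule derivative_eq_intros dseries_mangoldt_logderiv[OF s] refl)+ (simp add: algebra_simps)
    thus "(zreg has_field_derivative zt s + (s - 1) * (- (zt s * dseries mangoldt s))) (at s)"
      by (rule has_field_derivative_transform_within_open[OF _ open_Re_gt[of 1]]) (use s zreg_eq_zt in auto)
  qed
  have "pnt_fun s = dseries mangoldt s - zt s"
  proof -
    define w where "w = s - 1"
    have w: "w \<noteq> 0" using s1 by (simp add: w_def)
    have "pnt_fun s = - (zt s + w * (- (zt s * dseries mangoldt s))) / (w * zt s) - (w * zt s - 1) / w"
      using s1 by (simp add: pnt_fun_def d zreg_1 zreg_eq_zt[OF s] w_def)
    also have "\<dots> = dseries mangoldt s - zt s" using w zt_nonzero[OF s] by (simp add: field_simps)
    finally show ?thesis .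
  qed
  thus ?thesis using s by (simp add: dseries_diff dconv_mangoldt dconv_one zt_def)
qed

text \<open>The derivative of \<open>zreg\<close> is \<open>O(height powr (1 + 2 * e))\<close>, and
  \<open>zreg\<close> is at least of order \<open>height powr (1 - 8 * e)\<close>. The full power of
  the height cancels in the quotient, leaving the exponent \<open>10 * e\<close>.\<close>

lemma pnt_fun_bound:
  assumes e: "0 < e" "e \<le> 1/20"
  shows "\<exists>C k. C > 0 \<and> 0 < k \<and> k \<le> 1/4 \<and> (\<forall>s. 1 - k * height s powr (- 10 * e) \<le> Re s \<longrightarrow> Re s \<le> 2 \<longrightarrow>
     zreg s \<noteq> 0 \<and> norm (pnt_fun s) \<le> C * height s powr (10 * e))"
proof -
  have e2: "e \<le> 1/2" using e by simp
  obtain c k where ck: "0 < c" "0 < k" "k \<le> 1/4" "k \<le> e / 2"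
    "\<And>s. 1 - k * height s powr (- 10 * e) \<le> Re s \<Longrightarrow> Re s \<le> 2 \<Longrightarrow> norm (zreg s) \<ge> c * height s powr (1 - 8 * e)"
    using zreg_lower_bound[OF e] by blast
  obtain C2 where C2: "C2 \<ge> 1" "\<And>s. 1 - e / 2 \<le> Re s \<Longrightarrow> Re s \<le> 2 \<Longrightarrow> norm (deriv zreg s) \<le> C2 * height s powr (1 + 2 * e)"
    using zreg_deriv_bound[OF e(1) e2] by blast
  obtain C where C: "C \<ge> 1" "\<And>s. 1 - e \<le> Re s \<Longrightarrow> Re s \<le> 3 \<Longrightarrow> norm (zreg s - 1) \<le> C * norm (s - 1) * height s powr (2 * e)"
    using zreg_upper[OF e(1) e2] by blast
  define D where "D = C2 / c + C + C2 * 9"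
  have D: "D > 0" using C C2 ck by (simp add: D_def add_pos_pos)
  have "zreg s \<noteq> 0 \<and> norm (pnt_fun s) \<le> D * height s powr (10 * e)"
    if s: "1 - k * height s powr (- 10 * e) \<le> Re s" "Re s \<le> 2" for s
  proof
    have h: "height s \<ge> 3" by (rule height_ge)
    have "height s powr (- 10 * e) \<le> 1" using h e powr_mono[of "- 10 * e" 0 "height s"] by simp
    hence "k * height s powr (- 10 * e) \<le> k" using ck by (simp add: mult_left_le)
    hence re: "1 - e / 2 \<le> Re s" using s ck by linarith
    have low: "norm (zreg s) \<ge> c * height s powr (1 - 8 * e)" by (rule ck(5)[OF s])
    have pos: "c * height s powr (1 - 8 * e) > 0" using ck h by simp
    show "zreg s \<noteq> 0" using low pos by auto
    have 1: "norm (deriv zreg s / zreg s) \<le> C2 / c * height s powr (10 * e)"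
    proof -
      have "norm (deriv zreg s / zreg s) \<le> (C2 * height s powr (1 + 2 * e)) / (c * height s powr (1 - 8 * e))"
        unfolding norm_divide using C2 re s low pos by (intro frac_le) auto
      also have "\<dots> = C2 / c * (height s powr (1 + 2 * e) / height s powr (1 - 8 * e))" by simp
      also have "height s powr (1 + 2 * e) / height s powr (1 - 8 * e) = height s powr (10 * e)"
        by (simp add: powr_diff[symmetric])
      finally show ?thesis .
    qed
    have h10: "height s powr (2 * e) \<le> height s powr (10 * e)" "1 \<le> height s powr (10 * e)"
      using h e by (auto intro!: powr_mono ge_one_powr_ge_zero)
    have 2: "norm (if s = 1 then deriv zreg 1 else (zreg s - zreg 1) / (s - 1)) \<le> (C + C2 * 9) * height s powr (10 * e)"
    proof (cases "s = 1")
      case True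
      have "norm (deriv zreg 1) \<le> C2 * height 1 powr (1 + 2 * e)" using e by (intro C2) auto
      also have "\<dots> = C2 * 3 powr (1 + 2 * e)" by (simp add: height_def)
      also have "\<dots> \<le> C2 * 3 powr 2" using e C2 by (intro mult_left_mono powr_mono) auto
      also have "\<dots> \<le> (C + C2 * 9) * 1" using C by simp
      also have "\<dots> \<le> (C + C2 * 9) * height s powr (10 * e)" using h10 C C2 by (intro mult_left_mono) auto
      finally show ?thesis using True by simp
    next
      case False
      have "norm (zreg s - 1) \<le> C * norm (s - 1) * height s powr (2 * e)" using re s e by (intro C) auto
      hence "norm ((zreg s - zreg 1) / (s - 1)) \<le> C * height s powr (2 * e)"
        using False by (simp add: zreg_1 norm_divide field_simps)
      also have "\<dots> \<le> (C + C2 * 9) * height s powr (10 * e)" using h10 C C2 by (intro mult_mono) auto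
      finally show ?thesis using False by simp
    qed
    have "norm (pnt_fun s) \<le> norm (- deriv zreg s / zreg s) + norm (if s = 1 then deriv zreg 1 else (zreg s - zreg 1) / (s - 1))"
      unfolding pnt_fun_def by (rule norm_triangle_ineq4)
    also have "\<dots> \<le> C2 / c * height s powr (10 * e) + (C + C2 * 9) * height s powr (10 * e)"
      using 1 2 by (intro add_mono) auto
    also have "\<dots> = D * height s powr (10 * e)" by (simp add: D_def algebra_simps)
    finally show "norm (pnt_fun s) \<le> D * height s powr (10 * e)" .
  qed
  thus ?thesis using D ck by blast
qed

text \<open>Cauchy's estimate on a disc of radius of order \<open>height powr (- 10 * e)\<close>: to
  the bound \<open>height powr (10 * e)\<close> every derivative adds the same factor once
  more.\<close>

lemma pnt_fun_higher_deriv_bound: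
  "\<exists>C>0. \<forall>s. 1 < Re s \<longrightarrow> Re s \<le> 3/2 \<longrightarrow> norm ((deriv ^^ j) pnt_fun s) \<le> C * height s powr (1/2)"
proof -
  \<comment> \<open>Makes the total exponent \<open>10 * e * (j + 1)\<close> equal to 1/2.\<close>
  define e where "e = 1 / (20 * (real j + 1))"
  have e: "0 < e" "e \<le> 1/20" by (auto simp: e_def field_simps)
  obtain C k where C: "C > 0" "0 < k" "k \<le> 1/4"
    "\<And>s. 1 - k * height s powr (- 10 * e) \<le> Re s \<Longrightarrow> Re s \<le> 2 \<Longrightarrow> zreg s \<noteq> 0"
    "\<And>s. 1 - k * height s powr (- 10 * e) \<le> Re s \<Longrightarrow> Re s \<le> 2 \<Longrightarrow> norm (pnt_fun s) \<le> C * height s powr (10 * e)"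
    using pnt_fun_bound[OF e] by blast
  define D where "D = fact j * (C * 2) / (k / 4) ^ j"
  have D: "D > 0" using C by (simp add: D_def)
  have "norm ((deriv ^^ j) pnt_fun s) \<le> D * height s powr (1/2)" if s: "1 < Re s" "Re s \<le> 3/2" for s
  proof -
    have h: "height s \<ge> 3" by (rule height_ge)
    \<comment> \<open>Heights at most double on the disc of radius \<open>2 * r\<close>, and
      \<open>2 powr (10 * e) \<le> 2\<close>; the quarter thus keeps that disc inside the region of
      \<open>pnt_fun_bound\<close>.\<close>
    define r where "r = k / 4 * height s powr (- 10 * e)"
    have hp: "height s powr (- 10 * e) \<le> 1" using h e powr_mono[of "- 10 * e" 0 "height s"] by simp
    have r: "0 < r" "r \<le> 1/16" unfolding r_def using C h hp mult_mono[of "k/4" "1/16" "height s powr (- 10 * e)" 1] by auto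
    have e10: "(2::real) powr (10 * e) \<le> 2" using e powr_mono[of "10 * e" 1 2] by simp
    have reg: "1 - k * height w powr (- 10 * e) \<le> Re w \<and> Re w \<le> 2 \<and> height w \<le> 2 * height s" if w: "norm (s - w) < 2 * r" for w
    proof -
      have hw: "height w \<le> 2 * height s" using height_le_add[of w s] w r h by (simp add: norm_minus_commute)
      have hw0: "height w > 0" using height_ge[of w] by simp
      have "(2 * height s) powr (- 10 * e) \<le> height w powr (- 10 * e)"
        using hw hw0 e by (intro powr_mono2') auto
      moreover have "(2 * height s) powr (- 10 * e) = height s powr (- 10 * e) / 2 powr (10 * e)"
        using h by (simp add: powr_mult powr_minus field_simps)
      moreover have "height s powr (- 10 * e) / 2 \<le> height s powr (- 10 * e) / 2 powr (10 * e)"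
        using e10 by (intro divide_left_mono) auto
      ultimately have "height s powr (- 10 * e) / 2 \<le> height w powr (- 10 * e)" by linarith
      hence "k * (height s powr (- 10 * e) / 2) \<le> k * height w powr (- 10 * e)" using C by (intro mult_left_mono) auto
      hence "2 * r \<le> k * height w powr (- 10 * e)" by (simp add: r_def)
      moreover have "\<bar>Re s - Re w\<bar> < 2 * r" using abs_Re_le_cmod[of "s - w"] w by simp
      ultimately show ?thesis using s r hw by auto
    qed
    define U where "U = ball s (2 * r)"
    have U: "open U" by (simp add: U_def)
    have Ureg: "1 - k * height w powr (- 10 * e) \<le> Re w" "Re w \<le> 2" if "w \<in> U" for w
      using reg[of w] that by (auto simp: U_def dist_norm)
    have URe: "U \<subseteq> {s. Re s > 0}"
    proof
      fix w assume w: "w \<in> U"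
      have "height w powr (- 10 * e) \<le> 1" using height_ge[of w] e powr_mono[of "- 10 * e" 0 "height w"] by simp
      hence "k * height w powr (- 10 * e) \<le> k" using C by (simp add: mult_left_le)
      hence "Re w > 0" using Ureg(1)[OF w] C(3) by linarith
      thus "w \<in> {s. Re s > 0}" by simp
    qed
    have holz: "zreg holomorphic_on U" by (rule holomorphic_on_subset[OF zreg_holomorphic URe])
    have holp: "(\<lambda>z. if z = 1 then deriv zreg 1 else (zreg z - zreg 1) / (z - 1)) holomorphic_on U"
    proof (rule holomorphic_on_subset[OF pole_lemma[OF zreg_holomorphic] URe])
      show "1 \<in> interior {s. 0 < Re s}" using open_Re_gt[of 0] by (simp add: interior_open)
    qed
    have hol: "pnt_fun holomorphic_on U"
      unfolding pnt_fun_def[abs_def] using U holz holp C(4) Ureg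
      by (intro holomorphic_intros holomorphic_deriv holp) auto
    have sub: "cball s r \<subseteq> U" using r by (auto simp: U_def)
    have "norm ((deriv ^^ j) pnt_fun s) \<le> fact j * (C * (2 * height s powr (10 * e))) / r ^ j"
    proof (rule Cauchy_inequality)
      show "pnt_fun holomorphic_on ball s r" by (rule holomorphic_on_subset[OF hol]) (use sub ball_subset_cball in blast)
      show "continuous_on (cball s r) pnt_fun"
        by (rule holomorphic_on_imp_continuous_on, rule holomorphic_on_subset[OF hol sub])
      fix w assume "norm (s - w) = r"
      hence w: "norm (s - w) < 2 * r" using r by simp
      have "norm (pnt_fun w) \<le> C * height w powr (10 * e)" using reg[OF w] by (intro C(5)) auto
      also have "height w powr (10 * e) \<le> (2 * height s) powr (10 * e)"
        using reg[OF w] e height_ge[of w] by (intro powr_mono2) auto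
      also have "\<dots> = 2 powr (10 * e) * height s powr (10 * e)" using h by (simp add: powr_mult)
      also have "\<dots> \<le> 2 * height s powr (10 * e)" using e10 by (intro mult_right_mono) auto
      finally show "norm (pnt_fun w) \<le> C * (2 * height s powr (10 * e))" using C by simp
    qed (use r in auto)
    also have "\<dots> = D * (height s powr (10 * e) / (height s powr (- 10 * e)) ^ j)"
    proof -
      have e: "fact j * (C * (2 * X)) / (P * H) = fact j * (C * 2) / P * (X / H)" for X P H :: real by simp
      show ?thesis by (simp only: r_def D_def power_mult_distrib e)
    qed
    also have "height s powr (10 * e) / (height s powr (- 10 * e)) ^ j = height s powr (1/2)"
    proof -
      have "(height s powr (- 10 * e)) ^ j = height s powr (- 10 * e * real j)"
        using h by (simp add: powr_powr flip: powr_realpow)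
      moreover have "10 * e - (- 10 * e * real j) = 1/2"
      proof -
        have "10 * e - (- 10 * e * real j) = 10 * e * (real j + 1)" by (simp add: algebra_simps)
        thus ?thesis by (simp add: e_def)
      qed
      ultimately show ?thesis by (simp only: powr_diff[symmetric])
    qed
    finally show ?thesis .
  qed
  thus ?thesis using D by blast
qed

text \<open>The form that Perron's formula consumes: uniform up to the line, with an exponent 1/2
  that is independent of \<open>j\<close>; only the constant varies.\<close>

theorem dseries_pnt_bound:
  "\<exists>C>0. \<forall>s. 1 < Re s \<longrightarrow> Re s \<le> 3/2 \<longrightarrow>
     norm (dseries (\<lambda>n. (mangoldt n - one_coeff n) * (- ln (real n)) ^ j) s) \<le> C * (\<bar>Im s\<bar> + 3) powr (1/2)"
proof -
  obtain C where C: "C > 0" "\<And>s. 1 < Re s \<Longrightarrow> Re s \<le> 3/2 \<Longrightarrow> norm ((deriv ^^ j) pnt_fun s) \<le> C * height s powr (1/2)"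
    using pnt_fun_higher_deriv_bound by blast
  define a where "a n = mangoldt n - one_coeff n" for n
  have a: "dconv a" unfolding a_def by (intro dconv_diff dconv_mangoldt dconv_one)
  have "norm (dseries (\<lambda>n. a n * (- ln (real n)) ^ j) s) \<le> C * (\<bar>Im s\<bar> + 3) powr (1/2)" if s: "1 < Re s" "Re s \<le> 3/2" for s
  proof -
    have "dseries (\<lambda>n. a n * (- ln (real n)) ^ j) s = (deriv ^^ j) (dseries a) s"
      by (rule dseries_higher_deriv[OF a s(1), symmetric])
    also have "\<dots> = (deriv ^^ j) pnt_fun s"
    proof (rule higher_deriv_cong_ev[OF _ refl])
      have "eventually (\<lambda>x. x \<in> {s. Re s > 1}) (nhds s)"
        using s by (intro eventually_nhds_in_open open_Re_gt) auto
      thus "\<forall>\<^sub>F x in nhds s. dseries a x = pnt_fun x"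
        by eventually_elim (auto simp: pnt_fun_eq a_def[abs_def])
    qed
    finally show ?thesis using C(2)[OF s] by (simp add: height_def)
  qed
  thus ?thesis using C(1) unfolding a_def by blast
qed

section \<open>Perron's formula\<close>

text \<open>The square in the denominator replaces the jump of the classical kernel by the
  continuous weight \<open>max 0 l\<close>, and makes the vertical integral absolutely
  convergent.\<close>

definition pkern :: "real \<Rightarrow> complex \<Rightarrow> complex" where
  "pkern l s = exp (s * of_real l) / s ^ 2"

text \<open>\<open>k\<close> measures the length of a side in units of \<open>T\<close>; the kernel
  is \<open>O(1 / T^2)\<close> on it, so one power of \<open>T\<close> is left.\<close>

lemma pkern_segment_bound:
  assumes T: "T > 0" and seg: "\<And>s. s \<in> closed_segment a b \<Longrightarrow> Re s * l \<le> x * l \<and> T \<le> norm s"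
    and len: "norm (b - a) \<le> k * T" "k \<ge> 0"
  shows "pkern l contour_integrable_on linepath a b"
    "norm (contour_integral (linepath a b) (pkern l)) \<le> k * exp (x * l) / T"
proof -
  have "s \<noteq> 0" if "s \<in> closed_segment a b" for s using seg[OF that] T by auto
  hence "continuous_on (closed_segment a b) (pkern l)"
    unfolding pkern_def by (intro continuous_intros) auto
  thus int: "pkern l contour_integrable_on linepath a b"
    by (rule contour_integrable_continuous_linepath)
  have "norm (contour_integral (linepath a b) (pkern l)) \<le> exp (x * l) / T ^ 2 * norm (b - a)"
  proof (rule contour_integral_bound_linepath[OF int])
    fix s assume s: "s \<in> closed_segment a b"
    have "T ^ 2 \<le> norm s ^ 2" using seg[OF s] T by (intro power_mono) auto
    thus "norm (pkern l s) \<le> exp (x * l) / T ^ 2"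
      unfolding pkern_def norm_divide norm_power using seg[OF s] T by (intro frac_le) auto
  qed auto
  also have "\<dots> \<le> exp (x * l) / T ^ 2 * (k * T)" using len by (intro mult_left_mono) auto
  also have "\<dots> = k * exp (x * l) / T" using T by (simp add: power2_eq_square)
  finally show "norm (contour_integral (linepath a b) (pkern l)) \<le> k * exp (x * l) / T" .
qed

lemma contour_integral_rectpath:
  assumes "f contour_integrable_on linepath a1 (Complex (Re a3) (Im a1))"
    "f contour_integrable_on linepath (Complex (Re a3) (Im a1)) a3"
    "f contour_integrable_on linepath a3 (Complex (Re a1) (Im a3))"
    "f contour_integrable_on linepath (Complex (Re a1) (Im a3)) a1"
  shows "contour_integral (rectpath a1 a3) f =
     contour_integral (linepath a1 (Complex (Re a3) (Im a1))) f + contour_integral (linepath (Complex (Re a3) (Im a1)) a3) f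
     + contour_integral (linepath a3 (Complex (Re a1) (Im a3))) f + contour_integral (linepath (Complex (Re a1) (Im a3)) a1) f"
  using assms unfolding rectpath_def Let_def
  by (simp add: contour_integral_join contour_integrable_join valid_path_join)

text \<open>Split off \<open>1 / w^2\<close>, which has a primitive. The remainder is
  \<open>F w / w\<close> with \<open>F\<close> entire and \<open>F 0 = l\<close>, so Cauchy's
  integral formula settles the double pole.\<close>

lemma pkern_residue:
  assumes "Re a1 < 0" "Im a1 < 0" "0 < Re a3" "0 < Im a3"
  shows "contour_integral (rectpath a1 a3) (pkern l) = 2 * pi * \<i> * of_real l"
proof -
  define F where "F = (\<lambda>z::complex. if z = 0 then deriv (\<lambda>z. exp (z * of_real l)) 0 else (exp (z * of_real l) - exp (0 * of_real l)) / (z - 0))"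
  have F: "F holomorphic_on UNIV" unfolding F_def
    by (rule pole_lemma) (auto intro!: holomorphic_intros)
  have "deriv (\<lambda>z. exp (z * of_real l)) (0::complex) = of_real l"
    by (rule DERIV_imp_deriv) (auto intro!: derivative_eq_intros)
  hence F0: "F 0 = of_real l" by (simp add: F_def)
  have box: "0 \<in> box a1 a3" using assms by (simp add: in_box_complex_iff)
  have "path_image (rectpath a1 a3) = cbox a1 a3 - box a1 a3"
    using assms by (intro path_image_rectpath_cbox_minus_box) auto
  hence im: "path_image (rectpath a1 a3) \<subseteq> UNIV - {0}" using box by auto
  have 1: "((\<lambda>w. F w / (w - 0)) has_contour_integral (2 * pi * \<i> * winding_number (rectpath a1 a3) 0 * F 0)) (rectpath a1 a3)"
    by (rule Cauchy_integral_formula_convex_simple[OF convex_UNIV F]) (use im in auto)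
  have 2: "((\<lambda>w::complex. 1 / w ^ 2) has_contour_integral 0) (rectpath a1 a3)"
  proof (rule Cauchy_theorem_primitive[where S = "UNIV - {0}" and f = "\<lambda>w. - 1 / w"])
    fix x :: complex assume "x \<in> UNIV - {0}"
    thus "((\<lambda>w. - 1 / w) has_field_derivative 1 / x ^ 2) (at x within UNIV - {0})"
      by (auto intro!: derivative_eq_intros simp: power2_eq_square)
  qed (use im in auto)
  have "((\<lambda>w. F w / (w - 0) + 1 / w ^ 2) has_contour_integral (2 * pi * \<i> * winding_number (rectpath a1 a3) 0 * F 0 + 0)) (rectpath a1 a3)"
    by (rule has_contour_integral_add[OF 1 2])
  hence "((\<lambda>w. F w / (w - 0) + 1 / w ^ 2) has_contour_integral (2 * pi * \<i> * of_real l)) (rectpath a1 a3)"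
    using winding_number_rectpath[OF box] by (simp add: F0)
  hence "(pkern l has_contour_integral (2 * pi * \<i> * of_real l)) (rectpath a1 a3)"
  proof (rule has_contour_integral_eq)
    fix x assume "x \<in> path_image (rectpath a1 a3)"
    hence "x \<noteq> 0" using im by auto
    thus "F x / (x - 0) + 1 / x\<^sup>2 = pkern l x"
      by (simp add: F_def pkern_def power2_eq_square add_divide_distrib[symmetric])
  qed
  thus ?thesis by (rule contour_integral_unique)
qed

text \<open>The contour is closed towards the side where the exponential does not grow: to the right
  for \<open>l \<le> 0\<close>, without a pole, and to the left for \<open>l > 0\<close>, around the
  pole at 0. The added sides stay at distance at least \<open>T\<close> from 0.\<close>

lemma perron_kernel:
  assumes x: "1 \<le> x" "x \<le> 2" and T: "T \<ge> 1"
  shows "norm (contour_integral (linepath (Complex x (-T)) (Complex x T)) (pkern l) - 2 * pi * \<i> * of_real (max 0 l)) \<le> 8 * exp (x * l) / T"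
proof (cases "l \<le> 0")
  case True
  define a1 a2 a3 a4 where "a1 = Complex x (-T)" and "a2 = Complex (x + T) (-T)" and "a3 = Complex (x + T) T" and "a4 = Complex x T"
  have s12: "Re s * l \<le> x * l \<and> T \<le> norm s" if "s \<in> closed_segment a1 a2" for s
  proof -
    have "Im s = - T" "x \<le> Re s"
      using that T unfolding a1_def a2_def by (subst (asm) closed_segment_same_Im; auto simp: closed_segment_eq_real_ivl)+
    thus ?thesis using True abs_Im_le_cmod[of s] T by (auto simp: mult_right_mono_neg)
  qed
  have s23: "Re s * l \<le> x * l \<and> T \<le> norm s" if "s \<in> closed_segment a2 a3" for s
  proof -
    have "Re s = x + T"
      using that T unfolding a2_def a3_def by (subst (asm) closed_segment_same_Re; auto)
    thus ?thesis using True abs_Re_le_cmod[of s] T x by (auto simp: mult_right_mono_neg)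
  qed
  have s34: "Re s * l \<le> x * l \<and> T \<le> norm s" if "s \<in> closed_segment a3 a4" for s
  proof -
    have "Im s = T" "x \<le> Re s"
      using that T unfolding a3_def a4_def by (subst (asm) closed_segment_same_Im; auto simp: closed_segment_eq_real_ivl)+
    thus ?thesis using True abs_Im_le_cmod[of s] T by (auto simp: mult_right_mono_neg)
  qed
  have ss: "s \<noteq> 0" if "s \<in> closed_segment a4 a1" for s
  proof -
    have "Re s = x"
      using that T unfolding a1_def a4_def by (subst (asm) closed_segment_same_Re; auto)
    thus ?thesis using x by auto
  qed
  have i41: "pkern l contour_integrable_on linepath a4 a1"
    by (intro contour_integrable_continuous_linepath) (unfold pkern_def, intro continuous_intros, use ss in auto)
  have T0: "T > 0" using T by simp
  have n12: "norm (a2 - a1) \<le> 1 * T" and n23: "norm (a3 - a2) \<le> 2 * T" and n34: "norm (a4 - a3) \<le> 1 * T"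
    using T by (auto simp: a1_def a2_def a3_def a4_def complex_norm Complex_eq norm_mult)
  note b12 = pkern_segment_bound[OF T0 s12 n12]
  note b23 = pkern_segment_bound[OF T0 s23 n23]
  note b34 = pkern_segment_bound[OF T0 s34 n34]
  have e1: "contour_integral (rectpath a1 a3) (pkern l) = 0"
  proof (rule contour_integral_unique, rule Cauchy_theorem_convex_simple[where S = "{s. Re s > 0}"])
    show "pkern l holomorphic_on {s. Re s > 0}" unfolding pkern_def by (intro holomorphic_intros) auto
    show "convex {s. Re s > 0}" by (rule convex_halfspace_Re_gt)
    have "path_image (rectpath a1 a3) \<subseteq> cbox a1 a3" using T by (intro path_image_rectpath_subset_cbox) (auto simp: a1_def a3_def)
    also have "\<dots> \<subseteq> {s. Re s > 0}" using x by (auto simp: in_cbox_complex_iff a1_def)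
    finally show "path_image (rectpath a1 a3) \<subseteq> {s. Re s > 0}" .
  qed auto
  have e2: "contour_integral (rectpath a1 a3) (pkern l) = contour_integral (linepath a1 a2) (pkern l) + contour_integral (linepath a2 a3) (pkern l)
     + contour_integral (linepath a3 a4) (pkern l) + contour_integral (linepath a4 a1) (pkern l)"
    using contour_integral_rectpath[of "pkern l" a1 a3] b12(1) b23(1) b34(1) i41 by (simp add: a1_def a2_def a3_def a4_def)
  have e3: "contour_integral (linepath a1 a4) (pkern l) = - contour_integral (linepath a4 a1) (pkern l)"
    using contour_integral_reverse_linepath[of a1 a4 "pkern l"] ss
    by (metis add.inverse_inverse closed_segment_commute contour_integral_reversepath reversepath_linepath valid_path_linepath)
  have "contour_integral (linepath a1 a2) (pkern l) + contour_integral (linepath a2 a3) (pkern l)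
     + contour_integral (linepath a3 a4) (pkern l) = - contour_integral (linepath a4 a1) (pkern l)"
    using e1 e2 unfolding eq_neg_iff_add_eq_0 by simp
  hence "contour_integral (linepath a1 a4) (pkern l) = contour_integral (linepath a1 a2) (pkern l) + contour_integral (linepath a2 a3) (pkern l)
     + contour_integral (linepath a3 a4) (pkern l)" using e3 by simp
  hence "norm (contour_integral (linepath a1 a4) (pkern l)) \<le> 1 * exp (x * l) / T + 2 * exp (x * l) / T + 1 * exp (x * l) / T"
    using b12(2) b23(2) b34(2) by (simp only:) (intro norm_triangle_mono; simp)
  also have "\<dots> \<le> 8 * exp (x * l) / T" using T by (simp add: field_simps)
  finally show ?thesis using True by (simp add: a1_def a4_def max_absorb1)
next
  case False
  define a1 a2 a3 a4 where "a1 = Complex (-T) (-T)" and "a2 = Complex x (-T)" and "a3 = Complex x T" and "a4 = Complex (-T) T"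
  have s12: "Re s * l \<le> x * l \<and> T \<le> norm s" if "s \<in> closed_segment a1 a2" for s
  proof -
    have "Im s = - T" "Re s \<le> x"
      using that T x unfolding a1_def a2_def by (subst (asm) closed_segment_same_Im; auto simp: closed_segment_eq_real_ivl)+
    thus ?thesis using False abs_Im_le_cmod[of s] T by (auto intro: mult_right_mono)
  qed
  have s34: "Re s * l \<le> x * l \<and> T \<le> norm s" if "s \<in> closed_segment a3 a4" for s
  proof -
    have "Im s = T" "Re s \<le> x"
      using that T x unfolding a3_def a4_def by (subst (asm) closed_segment_same_Im; auto simp: closed_segment_eq_real_ivl)+
    thus ?thesis using False abs_Im_le_cmod[of s] T by (auto intro: mult_right_mono)
  qed
  have s41: "Re s * l \<le> x * l \<and> T \<le> norm s" if "s \<in> closed_segment a4 a1" for s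
  proof -
    have "Re s = - T"
      using that T unfolding a1_def a4_def by (subst (asm) closed_segment_same_Re; auto)
    hence "Re s \<le> x" "T \<le> norm s" using abs_Re_le_cmod[of s] T x by auto
    thus ?thesis using False by (auto intro: mult_right_mono)
  qed
  have ss: "s \<noteq> 0" if "s \<in> closed_segment a2 a3" for s
  proof -
    have "Re s = x"
      using that T unfolding a2_def a3_def by (subst (asm) closed_segment_same_Re; auto)
    thus ?thesis using x by auto
  qed
  have i23: "pkern l contour_integrable_on linepath a2 a3"
    by (intro contour_integrable_continuous_linepath) (unfold pkern_def, intro continuous_intros, use ss in auto)
  have T0: "T > 0" using T by simp
  have n12: "norm (a2 - a1) \<le> 3 * T"
  proof -
    have "a2 - a1 = of_real (x + T)" by (simp add: a1_def a2_def complex_eq_iff)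
    thus ?thesis using T x by (simp only: norm_of_real)
  qed
  have n34: "norm (a4 - a3) \<le> 3 * T"
  proof -
    have "a4 - a3 = of_real (- T - x)" by (simp add: a3_def a4_def complex_eq_iff)
    thus ?thesis using T x by (simp only: norm_of_real)
  qed
  have n41: "norm (a1 - a4) \<le> 2 * T"
    using T by (auto simp: a1_def a4_def complex_norm Complex_eq norm_mult)
  note b12 = pkern_segment_bound[OF T0 s12 n12]
  note b34 = pkern_segment_bound[OF T0 s34 n34]
  note b41 = pkern_segment_bound[OF T0 s41 n41]
  have "contour_integral (rectpath a1 a3) (pkern l) = 2 * pi * \<i> * of_real l"
    by (rule pkern_residue) (use T x in \<open>auto simp: a1_def a3_def\<close>)
  moreover have "contour_integral (rectpath a1 a3) (pkern l) = contour_integral (linepath a1 a2) (pkern l) + contour_integral (linepath a2 a3) (pkern l)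
     + contour_integral (linepath a3 a4) (pkern l) + contour_integral (linepath a4 a1) (pkern l)"
    using contour_integral_rectpath[of "pkern l" a1 a3] b12(1) i23 b34(1) b41(1) by (simp add: a1_def a2_def a3_def a4_def)
  ultimately have "contour_integral (linepath a2 a3) (pkern l) - 2 * pi * \<i> * of_real l = - (contour_integral (linepath a1 a2) (pkern l)
     + contour_integral (linepath a3 a4) (pkern l) + contour_integral (linepath a4 a1) (pkern l))"
    by (simp add: algebra_simps)
  hence "norm (contour_integral (linepath a2 a3) (pkern l) - 2 * pi * \<i> * of_real l) \<le> 3 * exp (x * l) / T + 3 * exp (x * l) / T + 2 * exp (x * l) / T"
    using b12(2) b34(2) b41(2) by (simp only: norm_minus_cancel) (intro norm_triangle_mono; simp)
  also have "\<dots> = 8 * exp (x * l) / T" using T by (simp add: field_simps)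
  finally show ?thesis using False by (simp add: a2_def a3_def max_def)
qed

text \<open>Growth 1/2 of the series against decay 2 of the kernel. The bound must not depend on
  \<open>T\<close>, which tends to infinity later.\<close>

lemma integral_height_bound:
  assumes T: "T > 0"
  shows "(\<lambda>t::real. (\<bar>t\<bar> + 3) powr (-3/2)) integrable_on {-T..T}"
    "integral {-T..T} (\<lambda>t. (\<bar>t\<bar> + 3) powr (-3/2)) \<le> 4"
proof -
  define V where "V = 2 * 3 powr (-1/2) - 2 * (3 + T) powr (-1/2)"
  have 1: "((\<lambda>t::real. (\<bar>t\<bar> + 3) powr (-3/2)) has_integral (- 2 * (T + 3) powr (-1/2) - - 2 * (0 + 3) powr (-1/2))) {0..T}"
  proof (rule fundamental_theorem_of_calculus)
    fix t assume t: "t \<in> {0..T}"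
    have "((\<lambda>t. - 2 * (t + 3) powr (-1/2)) has_real_derivative (\<bar>t\<bar> + 3) powr (-3/2)) (at t within {0..T})"
      using t by (auto intro!: derivative_eq_intros)
    thus "((\<lambda>t. - 2 * (t + 3) powr (-1/2)) has_vector_derivative (\<bar>t\<bar> + 3) powr (-3/2)) (at t within {0..T})"
      by (simp only: has_real_derivative_iff_has_vector_derivative)
  qed (use T in auto)
  have 2: "((\<lambda>t::real. (\<bar>t\<bar> + 3) powr (-3/2)) has_integral (2 * (- 0 + 3) powr (-1/2) - 2 * (- (- T) + 3) powr (-1/2))) {-T..0}"
  proof (rule fundamental_theorem_of_calculus)
    fix t assume t: "t \<in> {-T..0}"
    have "((\<lambda>t. 2 * (- t + 3) powr (-1/2)) has_real_derivative (\<bar>t\<bar> + 3) powr (-3/2)) (at t within {-T..0})"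
      using t by (auto intro!: derivative_eq_intros)
    thus "((\<lambda>t. 2 * (- t + 3) powr (-1/2)) has_vector_derivative (\<bar>t\<bar> + 3) powr (-3/2)) (at t within {-T..0})"
      by (simp only: has_real_derivative_iff_has_vector_derivative)
  qed (use T in auto)
  have "((\<lambda>t::real. (\<bar>t\<bar> + 3) powr (-3/2)) has_integral (V + V)) {-T..T}"
    by (rule has_integral_combine[of _ 0]) (use 1 2 T in \<open>auto simp: V_def add.commute\<close>)
  moreover have "V + V \<le> 4"
  proof -
    have "(3::real) powr (-1/2) \<le> 3 powr 0" by (intro powr_mono) auto
    moreover have "(3::real) powr 0 = 1" "(3 + T) powr (-1/2) \<ge> 0" by simp_all
    ultimately show ?thesis unfolding V_def by linarith
  qed
  ultimately show "(\<lambda>t::real. (\<bar>t\<bar> + 3) powr (-3/2)) integrable_on {-T..T}"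
    "integral {-T..T} (\<lambda>t. (\<bar>t\<bar> + 3) powr (-3/2)) \<le> 4" by (auto simp: integral_unique has_integral_integrable)
qed

lemma dseries_holomorphic: "dconv a \<Longrightarrow> dseries a holomorphic_on {s. Re s > 1}"
  unfolding holomorphic_on_def field_differentiable_def
  using dseries_has_field_derivative has_field_derivative_at_within by blast

text \<open>The truncation error in Perron's formula disappears as \<open>T\<close> tends to infinity, so only the growth
  of the Dirichlet series on a vertical line matters.\<close>
lemma perron_log_mean_bound:
  fixes a :: "nat \<Rightarrow> real"
  assumes a: "dconv a" and C: "C \<ge> 0"
    and bd: "\<And>s. 1 < Re s \<Longrightarrow> Re s \<le> 3/2 \<Longrightarrow> norm (dseries a s) \<le> C * (\<bar>Im s\<bar> + 3) powr (1/2)"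
    and x: "x \<ge> exp 2"
  shows "\<bar>\<Sum>n=1..nat \<lfloor>x\<rfloor>. a n * ln (x / real n)\<bar> \<le> 36 * C * x"
proof -
  have x0: "x > 0" using x exp_gt_zero[of 2] by linarith
  have lx: "ln x \<ge> 2" using x x0 by (simp add: ln_ge_iff)
  \<comment> \<open>Makes \<open>x powr \<sigma>\<close> equal to \<open>exp 1 * x\<close>; the
    hypothesis \<open>x \<ge> exp 2\<close> gives \<open>\<sigma> \<le> 3/2\<close>.\<close>
  define \<sigma> where "\<sigma> = 1 + 1 / ln x"
  have \<sigma>: "1 < \<sigma>" "\<sigma> \<le> 3/2" using lx by (auto simp: \<sigma>_def field_simps)
  have ex: "exp (\<sigma> * ln x) \<le> 3 * x"
  proof -
    have "exp (\<sigma> * ln x) = exp (ln x + 1)" using lx by (simp add: \<sigma>_def field_simps)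
    also have "\<dots> = x * exp 1" using x0 by (simp add: exp_add)
    also have "\<dots> \<le> x * 3" using x0 exp_le by (intro mult_left_mono) auto
    finally show ?thesis by simp
  qed
  \<comment> \<open>Finite for each \<open>x\<close>, but without any control in \<open>x\<close>;
    it only occurs divided by \<open>T\<close>.\<close>
  define K where "K = (\<Sum>n. \<bar>a n\<bar> * real n powr (- \<sigma>))"
  have Ksm: "summable (\<lambda>n. \<bar>a n\<bar> * real n powr (- \<sigma>))" using a \<sigma> by (auto simp: dconv_def)
  define S where "S = (\<Sum>n=1..nat \<lfloor>x\<rfloor>. a n * ln (x / real n))"
  have main: "2 * pi * \<bar>S\<bar> \<le> 72 * C * (3 * x) + (8 * (3 * x) * K) / T" if T: "T \<ge> 1" for T
  proof -
    define g where "g = linepath (Complex \<sigma> (-T)) (Complex \<sigma> T)"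
    have im: "path_image g = closed_segment (Complex \<sigma> (-T)) (Complex \<sigma> T)" by (simp add: g_def)
    have re: "Re s = \<sigma>" if "s \<in> path_image g" for s
      using that unfolding im by (subst (asm) closed_segment_same_Re; auto)
    have ns: "norm s \<ge> 1" if "s \<in> path_image g" for s
      using abs_Re_le_cmod[of s] re[OF that] \<sigma> by auto
    define f where "f n s = of_real (a n) * pkern (ln x - ln (real n)) s" for n s
    have f_eq: "f n s = (of_real (a n) * nps n s) * (exp (s * of_real (ln x)) / s ^ 2)" for n s
      by (simp add: f_def pkern_def nps_def left_diff_distrib right_diff_distrib exp_diff exp_minus field_simps)
    define F where "F s = dseries a s * (exp (s * of_real (ln x)) / s ^ 2)" for s
    have fint: "f n contour_integrable_on g" for n
      unfolding g_def
    proof (rule contour_integrable_continuous_linepath)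
      have "s \<noteq> 0" if "s \<in> closed_segment (Complex \<sigma> (-T)) (Complex \<sigma> T)" for s using ns[of s] that im by auto
      thus "continuous_on (closed_segment (Complex \<sigma> (-T)) (Complex \<sigma> T)) (f n)"
        unfolding f_def pkern_def by (intro continuous_intros) auto
    qed
    have fb: "norm (f n s) \<le> (\<bar>a n\<bar> * real n powr (- \<sigma>)) * exp (\<sigma> * ln x)" if "s \<in> path_image g" for n s
    proof (cases "n = 0")
      case True thus ?thesis using a by (simp add: f_def dconv_def)
    next
      case False
      have "norm (exp (s * of_real (ln x)) / s ^ 2) \<le> exp (\<sigma> * ln x) / 1"
        unfolding norm_divide norm_power using ns[OF that] re[OF that] by (intro frac_le) (auto intro: one_le_power)
      hence "norm (of_real (a n) * nps n s) * norm (exp (s * of_real (ln x)) / s ^ 2) \<le> (\<bar>a n\<bar> * real n powr (- \<sigma>)) * exp (\<sigma> * ln x)"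
        using False re[OF that] by (intro mult_mono) (auto simp: norm_mult norm_nps)
      thus ?thesis unfolding f_eq norm_mult[of "of_real (a n) * nps n s"] .
    qed
    have ul: "uniform_limit (path_image g) (\<lambda>n s. \<Sum>i<n. f i s) F sequentially"
    proof -
      have "uniform_limit (path_image g) (\<lambda>n s. \<Sum>i<n. f i s) (\<lambda>s. suminf (\<lambda>i. f i s)) sequentially"
        by (rule Weierstrass_m_test[OF fb]) (use Ksm in \<open>auto intro: summable_mult2\<close>)
      moreover have "suminf (\<lambda>i. f i s) = F s" if "s \<in> path_image g" for s
      proof -
        have "(\<lambda>i. f i s) sums F s" unfolding f_eq F_def using re[OF that] \<sigma>
          by (intro sums_mult2 dconv_sums[OF a]) auto
        thus ?thesis by (simp add: sums_iff)
      qed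
      ultimately show ?thesis by (simp cong: uniform_limit_cong')
    qed
    have vd: "norm (vector_derivative g (at t)) \<le> 2 * T" for t
      unfolding g_def using T by (simp add: Complex_eq norm_mult)
    have lim: "((\<lambda>n. contour_integral g (\<lambda>s. \<Sum>i<n. f i s)) \<longlongrightarrow> contour_integral g F) sequentially"
    proof (rule contour_integral_uniform_limit(2)[OF _ ul])
      show "\<forall>\<^sub>F n in sequentially. (\<lambda>s. \<Sum>i<n. f i s) contour_integrable_on g"
        by (intro always_eventually allI contour_integrable_sum fint) auto
      show "norm (vector_derivative g (at t)) \<le> 2 * T" if "t \<in> {0..1}" for t by (rule vd)
    qed (auto simp: g_def)
    have sums1: "(\<lambda>n. contour_integral g (f n)) sums contour_integral g F"
      unfolding sums_def using lim by (simp add: contour_integral_sum fint)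
    define m where "m n = 2 * pi * \<i> * of_real (a n * max 0 (ln x - ln (real n)))" for n
    have sums2: "m sums (2 * pi * \<i> * of_real S)"
    proof -
      have "m sums (\<Sum>n\<in>{1..nat \<lfloor>x\<rfloor>}. m n)"
      proof (rule sums_finite)
        fix n assume n: "n \<notin> {1..nat \<lfloor>x\<rfloor>}"
        show "m n = 0"
        proof (cases "n = 0")
          case True thus ?thesis using a by (simp add: m_def dconv_def)
        next
          case False
          hence "real n > x" using n by (auto simp: not_le) linarith
          hence "ln x \<le> ln (real n)" using x0 by simp
          thus ?thesis by (simp add: m_def)
        qed
      qed auto
      also have "(\<Sum>n\<in>{1..nat \<lfloor>x\<rfloor>}. m n) = (\<Sum>n\<in>{1..nat \<lfloor>x\<rfloor>}. 2 * pi * \<i> * of_real (a n * ln (x / real n)))"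
      proof (rule sum.cong[OF refl])
        fix n assume n: "n \<in> {1..nat \<lfloor>x\<rfloor>}"
        hence "real n \<le> x" by (simp add: le_nat_floor) linarith
        hence "ln (real n) \<le> ln x" using n by simp
        thus "m n = 2 * pi * \<i> * of_real (a n * ln (x / real n))" using n x0 by (simp add: m_def ln_div)
      qed
      also have "\<dots> = 2 * pi * \<i> * of_real S" unfolding S_def of_real_sum by (simp only: sum_distrib_left)
      finally show ?thesis .
    qed
    have diff: "norm (contour_integral g (f n) - m n) \<le> (8 * (3 * x) / T) * (\<bar>a n\<bar> * real n powr (- \<sigma>))" for n
    proof (cases "n = 0")
      case True
      hence "f n = (\<lambda>s. 0)" using a by (auto simp: f_def dconv_def)
      thus ?thesis using True a by (simp add: m_def dconv_def)
    next
      case False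
      have "(\<lambda>s. pkern (ln x - ln (real n)) s) contour_integrable_on g" unfolding g_def
      proof (rule contour_integrable_continuous_linepath)
        have "s \<noteq> 0" if "s \<in> closed_segment (Complex \<sigma> (-T)) (Complex \<sigma> T)" for s using ns[of s] that im by auto
        thus "continuous_on (closed_segment (Complex \<sigma> (-T)) (Complex \<sigma> T)) (\<lambda>s. pkern (ln x - ln (real n)) s)"
          unfolding pkern_def by (intro continuous_intros) auto
      qed
      hence "contour_integral g (f n) = of_real (a n) * contour_integral g (pkern (ln x - ln (real n)))"
        unfolding f_def[abs_def] by (rule contour_integral_lmul)
      hence "contour_integral g (f n) - m n = of_real (a n) * (contour_integral g (pkern (ln x - ln (real n))) - 2 * pi * \<i> * of_real (max 0 (ln x - ln (real n))))"
        by (simp add: m_def algebra_simps)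
      hence "norm (contour_integral g (f n) - m n) = \<bar>a n\<bar> * norm (contour_integral g (pkern (ln x - ln (real n))) - 2 * pi * \<i> * of_real (max 0 (ln x - ln (real n))))"
        by (simp add: norm_mult)
      also have "\<dots> \<le> \<bar>a n\<bar> * (8 * exp (\<sigma> * (ln x - ln (real n))) / T)"
        unfolding g_def using \<sigma> T by (intro mult_left_mono perron_kernel) auto
      also have "exp (\<sigma> * (ln x - ln (real n))) = exp (\<sigma> * ln x) * real n powr (- \<sigma>)"
        using False by (simp add: powr_def right_diff_distrib exp_diff exp_minus field_simps)
      also have "\<bar>a n\<bar> * (8 * (exp (\<sigma> * ln x) * real n powr (- \<sigma>)) / T) = (8 * exp (\<sigma> * ln x) / T) * (\<bar>a n\<bar> * real n powr (- \<sigma>))" by simp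
      also have "\<dots> \<le> (8 * (3 * x) / T) * (\<bar>a n\<bar> * real n powr (- \<sigma>))"
        using ex T by (intro mult_right_mono divide_right_mono mult_left_mono) auto
      finally show ?thesis .
    qed
    have "(\<lambda>n. contour_integral g (f n) - m n) sums (contour_integral g F - 2 * pi * \<i> * of_real S)"
      by (rule sums_diff[OF sums1 sums2])
    hence "norm (contour_integral g F - 2 * pi * \<i> * of_real S) = norm (\<Sum>n. contour_integral g (f n) - m n)" by (simp add: sums_iff)
    also have "\<dots> \<le> (\<Sum>n. (8 * (3 * x) / T) * (\<bar>a n\<bar> * real n powr (- \<sigma>)))"
      by (rule norm_suminf_le[OF diff]) (use Ksm in \<open>rule summable_mult\<close>)
    also have "\<dots> = (8 * (3 * x) / T) * K" unfolding K_def by (rule suminf_mult[OF Ksm])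
    finally have d1: "norm (contour_integral g F - 2 * pi * \<i> * of_real S) \<le> 8 * (3 * x) * K / T" by simp
    have d2: "norm (contour_integral g F) \<le> 72 * C * (3 * x)"
    proof -
      have cF: "continuous_on (path_image g) F" unfolding F_def
      proof (intro continuous_intros)
        show "continuous_on (path_image g) (dseries a)"
          by (rule holomorphic_on_imp_continuous_on, rule holomorphic_on_subset[OF dseries_holomorphic[OF a]]) (use re \<sigma> in auto)
        show "\<forall>s\<in>path_image g. s\<^sup>2 \<noteq> 0"
        proof
          fix s assume "s \<in> path_image g"
          thus "s\<^sup>2 \<noteq> 0" using ns[of s] by auto
        qed
      qed
      have Tm: "-T < T" using T by simp
      have "contour_integral g F = \<i> * integral {-T..T} (\<lambda>t. F (Complex \<sigma> t))"
        unfolding g_def by (rule contour_integral_linepath_same_Re) (use Tm in auto)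
      hence "norm (contour_integral g F) = norm (integral {-T..T} (\<lambda>t. F (Complex \<sigma> t)))" by (simp add: norm_mult)
      also have "\<dots> \<le> integral {-T..T} (\<lambda>t. (18 * C * (3 * x)) * (\<bar>t\<bar> + 3) powr (-3/2))"
      proof (rule integral_norm_bound_integral)
        have "continuous_on {-T..T} (\<lambda>t. F (Complex \<sigma> t))"
        proof (rule continuous_on_compose2[OF cF])
          show "continuous_on {-T..T} (Complex \<sigma>)" unfolding Complex_eq[abs_def] by (intro continuous_intros)
          show "Complex \<sigma> ` {-T..T} \<subseteq> path_image g" unfolding im using Tm
            by (subst closed_segment_same_Re) (auto simp: closed_segment_eq_real_ivl)
        qed
        thus "(\<lambda>t. F (Complex \<sigma> t)) integrable_on {-T..T}" by (rule integrable_continuous_interval)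
        show "(\<lambda>t. (18 * C * (3 * x)) * (\<bar>t\<bar> + 3) powr (-3/2)) integrable_on {-T..T}"
          using integral_height_bound(1)[of T] T by (intro integrable_on_mult_right) auto
        fix t assume "t \<in> {-T..T}"
        define s where "s = Complex \<sigma> t"
        define h where "h = \<bar>t\<bar> + 3"
        have h: "h \<ge> 3" by (simp add: h_def)
        have n1: "norm (dseries a s) \<le> C * h powr (1/2)" using bd[of s] \<sigma> by (simp add: s_def h_def)
        \<comment> \<open>Compares the kernel with \<open>h\<close>, so that the integrand decays
          like \<open>h powr (1/2 - 2)\<close>. The 18 comes from
          \<open>(\<bar>t\<bar> + 3)^2 \<le> 18 * (1 + t^2)\<close>.\<close>
        have s2: "h ^ 2 / 18 \<le> norm s ^ 2"
        proof -
          have "norm s ^ 2 = \<sigma> ^ 2 + t ^ 2" by (simp add: s_def cmod_power2)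
          moreover have "\<sigma> ^ 2 \<ge> 1" using \<sigma> by (intro one_le_power) auto
          moreover have "h ^ 2 \<le> 18 * (1 + t ^ 2)"
          proof -
            have "0 \<le> (\<bar>t\<bar> - 3) ^ 2" by simp
            hence "h ^ 2 \<le> 2 * (\<bar>t\<bar> ^ 2 + 9)" by (simp add: h_def power2_eq_square algebra_simps)
            also have "\<dots> \<le> 18 * (1 + t ^ 2)" by simp
            finally show ?thesis .
          qed
          ultimately show ?thesis by simp
        qed
        have "norm (F s) = norm (dseries a s) * (exp (\<sigma> * ln x) / norm s ^ 2)"
          by (simp add: F_def norm_mult norm_divide norm_power s_def)
        also have "\<dots> \<le> (C * h powr (1/2)) * (3 * x / (h ^ 2 / 18))"
          using n1 s2 ex h C x0 by (intro mult_mono frac_le) auto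
        also have "\<dots> = (18 * C * (3 * x)) * (h powr (1/2) / h ^ 2)" by simp
        also have "h powr (1/2) / h ^ 2 = h powr (-3/2)"
        proof -
          have "h ^ 2 = h powr 2" using h by simp
          thus ?thesis by (simp only: powr_diff[symmetric]) simp
        qed
        finally show "norm (F (Complex \<sigma> t)) \<le> (18 * C * (3 * x)) * (\<bar>t\<bar> + 3) powr (-3/2)" by (simp add: s_def h_def)
      qed
      also have "\<dots> = (18 * C * (3 * x)) * integral {-T..T} (\<lambda>t. (\<bar>t\<bar> + 3) powr (-3/2))" by (rule integral_mult_right)
      also have "\<dots> \<le> (18 * C * (3 * x)) * 4"
        using integral_height_bound(2)[of T] T C x0 by (intro mult_left_mono) auto
      finally show ?thesis by simp
    qed
    have "2 * pi * \<bar>S\<bar> = norm (2 * pi * \<i> * of_real S)" by (simp add: norm_mult)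
    also have "\<dots> \<le> norm (contour_integral g F) + norm (contour_integral g F - 2 * pi * \<i> * of_real S)"
      using norm_triangle_sub[of "2 * pi * \<i> * of_real S" "contour_integral g F"] by (simp add: norm_minus_commute)
    finally show ?thesis using d1 d2 by simp
  qed
  have "2 * pi * \<bar>S\<bar> \<le> 72 * C * (3 * x)"
  proof (rule tendsto_lowerbound)
    show "((\<lambda>T::real. 72 * C * (3 * x) + (8 * (3 * x) * K) / T) \<longlongrightarrow> 72 * C * (3 * x)) at_top" by real_asymp
    show "\<forall>\<^sub>F T in at_top. 2 * pi * \<bar>S\<bar> \<le> 72 * C * (3 * x) + 8 * (3 * x) * K / T"
      using eventually_ge_at_top[of 1] by eventually_elim (rule main)
  qed auto
  moreover have "6 * \<bar>S\<bar> \<le> 2 * pi * \<bar>S\<bar>" using pi_gt3 by (intro mult_right_mono) auto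
  ultimately have "6 * \<bar>S\<bar> \<le> 6 * (36 * C * x)" by simp
  thus ?thesis by (simp add: S_def)
qed

section \<open>The prime number theorem\<close>

text \<open>\<open>S y - S x\<close> is the integral of the partial sums of \<open>w\<close> against
  \<open>du / u\<close> over \<open>[x, y]\<close>. For \<open>w \<ge> 0\<close> these are monotone,
  so the end values enclose it.\<close>

lemma log_mean_desmooth:
  fixes w :: "nat \<Rightarrow> real"
  assumes w: "\<And>n. w n \<ge> 0" and xy: "1 \<le> x" "x \<le> y"
  defines "S \<equiv> \<lambda>x. \<Sum>n=1..nat \<lfloor>x\<rfloor>. w n * ln (x / real n)"
  shows "(\<Sum>n=1..nat \<lfloor>x\<rfloor>. w n) * ln (y / x) \<le> S y - S x"
    "S y - S x \<le> (\<Sum>n=1..nat \<lfloor>y\<rfloor>. w n) * ln (y / x)"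
proof -
  have fl: "nat \<lfloor>x\<rfloor> \<le> nat \<lfloor>y\<rfloor>" using xy by (intro nat_mono floor_mono)
  have split: "(\<Sum>n=1..nat \<lfloor>y\<rfloor>. g n) = (\<Sum>n=1..nat \<lfloor>x\<rfloor>. g n) + (\<Sum>n=nat \<lfloor>x\<rfloor>+1..nat \<lfloor>y\<rfloor>. g n)" for g :: "nat \<Rightarrow> real"
    using sum.ub_add_nat[of 1 "nat \<lfloor>x\<rfloor>" g "nat \<lfloor>y\<rfloor> - nat \<lfloor>x\<rfloor>"] fl by simp
  have ln1: "ln (y / real n) = ln (x / real n) + ln (y / x)" if "n \<ge> 1" for n
    using that xy by (simp add: ln_div)
  have "S y - S x = (\<Sum>n=1..nat \<lfloor>x\<rfloor>. w n * ln (y / real n)) - (\<Sum>n=1..nat \<lfloor>x\<rfloor>. w n * ln (x / real n)) + (\<Sum>n=nat \<lfloor>x\<rfloor>+1..nat \<lfloor>y\<rfloor>. w n * ln (y / real n))"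
    unfolding S_def split[of "\<lambda>n. w n * ln (y / real n)"] by simp
  also have "(\<Sum>n=1..nat \<lfloor>x\<rfloor>. w n * ln (y / real n)) - (\<Sum>n=1..nat \<lfloor>x\<rfloor>. w n * ln (x / real n)) = (\<Sum>n=1..nat \<lfloor>x\<rfloor>. w n) * ln (y / x)"
    unfolding sum_subtractf[symmetric] sum_distrib_right
    by (rule sum.cong) (auto simp: ln1 algebra_simps)
  finally have eq: "S y - S x = (\<Sum>n=1..nat \<lfloor>x\<rfloor>. w n) * ln (y / x) + (\<Sum>n=nat \<lfloor>x\<rfloor>+1..nat \<lfloor>y\<rfloor>. w n * ln (y / real n))" .
  have n_range: "x \<le> real n" "real n \<le> y" "real n > 0" if "n \<in> {nat \<lfloor>x\<rfloor>+1..nat \<lfloor>y\<rfloor>}" for n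
    using that xy by (auto simp: le_nat_floor) linarith+
  have "0 \<le> (\<Sum>n=nat \<lfloor>x\<rfloor>+1..nat \<lfloor>y\<rfloor>. w n * ln (y / real n))"
    using n_range w by (intro sum_nonneg mult_nonneg_nonneg ln_ge_zero) (auto simp: le_divide_eq)
  thus "(\<Sum>n=1..nat \<lfloor>x\<rfloor>. w n) * ln (y / x) \<le> S y - S x" using eq by simp
  have "(\<Sum>n=nat \<lfloor>x\<rfloor>+1..nat \<lfloor>y\<rfloor>. w n * ln (y / real n)) \<le> (\<Sum>n=nat \<lfloor>x\<rfloor>+1..nat \<lfloor>y\<rfloor>. w n * ln (y / x))"
  proof (intro sum_mono mult_left_mono w)
    fix n assume n: "n \<in> {nat \<lfloor>x\<rfloor>+1..nat \<lfloor>y\<rfloor>}"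
    have "y / real n \<le> y / x" using n_range[OF n] xy by (intro divide_left_mono) auto
    thus "ln (y / real n) \<le> ln (y / x)" using n_range[OF n] xy by simp
  qed
  thus "S y - S x \<le> (\<Sum>n=1..nat \<lfloor>y\<rfloor>. w n) * ln (y / x)"
    unfolding eq split[of w] by (simp add: distrib_right sum_distrib_right)
qed

lemma ln_one_plus_ge_half:
  assumes "0 \<le> d" "d \<le> (1::real)" shows "ln (1 + d) \<ge> d / 2"
proof -
  have "d / (1 + d) \<le> ln (1 + d)"
  proof -
    have "ln (1 / (1 + d)) \<le> 1 / (1 + d) - 1" using assms by (intro ln_le_minus_one) auto
    thus ?thesis using assms by (simp add: ln_div field_simps)
  qed
  moreover have "d / 2 \<le> d / (1 + d)" using assms by (intro divide_left_mono) auto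
  ultimately show ?thesis by linarith
qed

text \<open>Partial sums of the difference are not monotone, so the sums for \<open>mangoldt\<close>
  and for 1 are desmoothed separately and then compared. With \<open>y / x = 1 + d\<close>, Perron's
  error costs \<open>N / d\<close>, and the increment of the sum of \<open>ln n ^ (2 * p)\<close>
  costs \<open>d * N * ln N ^ (2 * p)\<close>. The choice \<open>d = 1 / ln N ^ p\<close> balances
  both at \<open>N * ln N ^ p\<close>.\<close>

lemma mangoldt_ln_power_sum:
  "\<exists>C N0. C > 0 \<and> (\<forall>N\<ge>N0. \<bar>\<Sum>n=1..N. (mangoldt n - 1) * ln (real n) ^ (2 * p)\<bar> \<le> C * real N * ln (real N) ^ p)"
proof -
  \<comment> \<open>Even, so that \<open>(- ln n) ^ k\<close> carries no sign.\<close>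
  define k where "k = 2 * p"
  obtain C where C: "C > 0" "\<And>s. 1 < Re s \<Longrightarrow> Re s \<le> 3/2 \<Longrightarrow>
     norm (dseries (\<lambda>n. (mangoldt n - one_coeff n) * (- ln (real n)) ^ k) s) \<le> C * (\<bar>Im s\<bar> + 3) powr (1/2)"
    using dseries_pnt_bound[of k] by blast
  define a where "a n = (mangoldt n - one_coeff n) * (- ln (real n)) ^ k" for n
  have a: "dconv a" unfolding a_def by (intro dconv_ln_power dconv_diff dconv_mangoldt dconv_one)
  have a_eq: "a n = mangoldt n * ln (real n) ^ k - ln (real n) ^ k" if "n \<ge> 1" for n
    using that by (simp add: a_def k_def power_mult one_coeff_def left_diff_distrib)
  define K where "K = 36 * C"
  have K: "K > 0" using C by (simp add: K_def)
  have Sb: "\<bar>\<Sum>n=1..nat \<lfloor>x\<rfloor>. a n * ln (x / real n)\<bar> \<le> K * x" if "x \<ge> exp 2" for x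
    unfolding K_def using C by (intro perron_log_mean_bound[OF a _ _ that]) (auto simp: a_def[abs_def])
  define W U where "W = (\<lambda>x::real. \<Sum>n=1..nat \<lfloor>x\<rfloor>. mangoldt n * ln (real n) ^ k)" and "U = (\<lambda>x::real. \<Sum>n=1..nat \<lfloor>x\<rfloor>. ln (real n) ^ k)"
  define SW SU where "SW = (\<lambda>x::real. \<Sum>n=1..nat \<lfloor>x\<rfloor>. (mangoldt n * ln (real n) ^ k) * ln (x / real n))"
     and "SU = (\<lambda>x::real. \<Sum>n=1..nat \<lfloor>x\<rfloor>. ln (real n) ^ k * ln (x / real n))"
  have Sd: "\<bar>SW x - SU x\<bar> \<le> K * x" if "x \<ge> exp 2" for x
  proof -
    have "SW x - SU x = (\<Sum>n=1..nat \<lfloor>x\<rfloor>. a n * ln (x / real n))"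
      unfolding SW_def SU_def sum_subtractf[symmetric] by (rule sum.cong) (auto simp: a_eq left_diff_distrib)
    thus ?thesis using Sb[OF that] by simp
  qed
  have nn: "mangoldt n * ln (real n) ^ k \<ge> 0" "ln (real n) ^ k \<ge> 0" for n
    unfolding k_def by (auto simp: power_mult intro!: mult_nonneg_nonneg mangoldt_nonneg)
  have core: "W x * ln (y / x) \<le> U y * ln (y / x) + 2 * K * y" "U x * ln (y / x) \<le> W y * ln (y / x) + 2 * K * y"
    if "exp 2 \<le> x" "x \<le> y" for x y
  proof -
    have x1: "1 \<le> x" using that one_le_exp_iff[of 2] by linarith
    have e: "exp 2 \<le> y" using that by linarith
    have Kx: "K * x \<le> K * y" using K that by (intro mult_left_mono) auto
    note 1 = log_mean_desmooth[of "\<lambda>n. mangoldt n * ln (real n) ^ k", OF nn(1) x1 that(2), folded W_def SW_def]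
    note 2 = log_mean_desmooth[of "\<lambda>n. ln (real n) ^ k", OF nn(2) x1 that(2), folded U_def SU_def]
    show "W x * ln (y / x) \<le> U y * ln (y / x) + 2 * K * y" "U x * ln (y / x) \<le> W y * ln (y / x) + 2 * K * y"
      using 1 2 Sd[OF that(1)] Sd[OF e] Kx unfolding W_def U_def SW_def SU_def by linarith+
  qed
  define B where "B = 2 ^ (k + 1) + 8 * K"
  have ev: "eventually (\<lambda>N. real N \<ge> 2 * exp 2 \<and> ln (real N) \<ge> 1 \<and> real N \<ge> ln (real N) ^ p \<and> real N \<ge> 2) sequentially"
    by (intro eventually_conj) real_asymp+
  then obtain N0 where N0: "\<And>N. N \<ge> N0 \<Longrightarrow> real N \<ge> 2 * exp 2 \<and> ln (real N) \<ge> 1 \<and> real N \<ge> ln (real N) ^ p \<and> real N \<ge> 2"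
    unfolding eventually_sequentially by blast
  have "\<bar>\<Sum>n=1..N. (mangoldt n - 1) * ln (real n) ^ (2 * p)\<bar> \<le> B * real N * ln (real N) ^ p" if "N \<ge> N0" for N
  proof -
    define l where "l = ln (real N)"
    define d where "d = 1 / l ^ p"
    have N: "real N \<ge> 2 * exp 2" "l \<ge> 1" "real N \<ge> l ^ p" "real N \<ge> 2" using N0[OF that] by (auto simp: l_def)
    have lp: "l ^ p \<ge> 1" using N(2) by (rule one_le_power)
    have d: "0 < d" "d \<le> 1" using lp by (auto simp: d_def)
    \<comment> \<open>Lets the rounding term \<open>+ 1\<close> in the count of integers be absorbed
      into \<open>d * N\<close>.\<close>
    have dN: "d * real N \<ge> 1" using N lp by (simp add: d_def)
    define L where "L = ln (1 + d)"
    have L: "L \<ge> d / 2" unfolding L_def using d by (intro ln_one_plus_ge_half) auto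
    have Lpos: "L > 0" using L d by linarith
    have Udiff: "U y - U x \<le> (y - x + 1) * (2 * l) ^ k" if xy: "1 \<le> x" "x \<le> y" "y \<le> 2 * real N" for x y
    proof -
      have fl: "nat \<lfloor>x\<rfloor> \<le> nat \<lfloor>y\<rfloor>" using xy by (intro nat_mono floor_mono)
      have "U y - U x = (\<Sum>n=nat \<lfloor>x\<rfloor>+1..nat \<lfloor>y\<rfloor>. ln (real n) ^ k)"
        unfolding U_def using sum.ub_add_nat[of 1 "nat \<lfloor>x\<rfloor>" "\<lambda>n. ln (real n) ^ k" "nat \<lfloor>y\<rfloor> - nat \<lfloor>x\<rfloor>"] fl by simp
      also have "\<dots> \<le> (\<Sum>n=nat \<lfloor>x\<rfloor>+1..nat \<lfloor>y\<rfloor>. (2 * l) ^ k)"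
      proof (intro sum_mono power_mono)
        fix n assume n: "n \<in> {nat \<lfloor>x\<rfloor>+1..nat \<lfloor>y\<rfloor>}"
        have "real n \<le> y" using n xy by (simp add: le_nat_floor) linarith
        hence "real n \<le> real N * real N" using xy N mult_right_mono[of 2 "real N" "real N"] by linarith
        hence "ln (real n) \<le> ln (real N * real N)" using n N by (intro ln_mono) auto
        also have "\<dots> = 2 * l" using N by (simp add: ln_mult l_def)
        finally show "ln (real n) \<le> 2 * l" .
      qed (auto intro!: ln_ge_zero)
      also have "\<dots> = real (nat \<lfloor>y\<rfloor> - nat \<lfloor>x\<rfloor>) * (2 * l) ^ k" by simp
      also have "\<dots> \<le> (y - x + 1) * (2 * l) ^ k"
      proof (rule mult_right_mono)
        have "real (nat \<lfloor>y\<rfloor> - nat \<lfloor>x\<rfloor>) = of_int \<lfloor>y\<rfloor> - of_int \<lfloor>x\<rfloor>" using fl xy by (simp add: of_nat_diff)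
        thus "real (nat \<lfloor>y\<rfloor> - nat \<lfloor>x\<rfloor>) \<le> y - x + 1" by linarith
      qed (use N in simp)
      finally show ?thesis .
    qed
    have lk: "l ^ k = l ^ p * l ^ p" by (simp add: k_def mult_2 power_add)
    have Ub: "(d * real N + 1) * (2 * l) ^ k \<le> 2 ^ (k + 1) * (real N * l ^ p)"
    proof -
      have "(d * real N + 1) * (2 * l) ^ k \<le> (2 * (d * real N)) * (2 * l) ^ k"
        using dN N by (intro mult_right_mono) auto
      also have "\<dots> = 2 ^ (k + 1) * (real N * l ^ p)" using lp by (simp add: power_mult_distrib lk d_def)
      finally show ?thesis .
    qed
    have KL: "2 * K * (2 * real N) / L \<le> 8 * K * (real N * l ^ p)"
    proof -
      have "2 * K * (2 * real N) / L \<le> 2 * K * (2 * real N) / (d / 2)"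
        using L d K by (intro divide_left_mono) auto
      also have "\<dots> = 8 * K * (real N * l ^ p)" using lp by (simp add: d_def)
      finally show ?thesis .
    qed
    have up: "W (real N) - U (real N) \<le> B * (real N * l ^ p)"
    proof -
      define y where "y = real N * (1 + d)"
      have y: "real N \<le> y" "y \<le> 2 * real N" using d by (auto simp: y_def mult_left_le distrib_left)
      have yN: "ln (y / real N) = L" using N by (simp add: y_def L_def)
      have "W (real N) * L \<le> U y * L + 2 * K * y" using core(1)[of "real N" y] N y yN by simp
      also have "\<dots> \<le> U y * L + 2 * K * (2 * real N)" using y K by (intro add_left_mono mult_left_mono) auto
      finally have "W (real N) \<le> U y + 2 * K * (2 * real N) / L" using Lpos by (simp add: field_simps)
      moreover have "U y - U (real N) \<le> (y - real N + 1) * (2 * l) ^ k" using N y by (intro Udiff) auto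
      moreover have "y - real N + 1 = d * real N + 1" by (simp add: y_def algebra_simps)
      ultimately have "W (real N) - U (real N) \<le> (d * real N + 1) * (2 * l) ^ k + 2 * K * (2 * real N) / L" by simp
      also have "\<dots> \<le> 2 ^ (k + 1) * (real N * l ^ p) + 8 * K * (real N * l ^ p)" using Ub KL by (rule add_mono)
      also have "\<dots> = B * (real N * l ^ p)" by (simp add: B_def algebra_simps)
      finally show ?thesis .
    qed
    have low: "U (real N) - W (real N) \<le> B * (real N * l ^ p)"
    proof -
      define x where "x = real N / (1 + d)"
      have x: "x \<le> real N" "real N / 2 \<le> x" using d N unfolding x_def by (auto simp: field_simps)
      hence xe: "exp 2 \<le> x" using N by simp
      have x1: "1 \<le> x" using xe one_le_exp_iff[of 2] by linarith
      have yN: "ln (real N / x) = L" using N d by (simp add: x_def L_def)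
      have "U x * L \<le> W (real N) * L + 2 * K * real N" using core(2)[of x "real N"] xe x yN by simp
      also have "\<dots> \<le> W (real N) * L + 2 * K * (2 * real N)" using K by (intro add_left_mono mult_left_mono) auto
      finally have "U x \<le> W (real N) + 2 * K * (2 * real N) / L" using Lpos by (simp add: field_simps)
      moreover have "U (real N) - U x \<le> (real N - x + 1) * (2 * l) ^ k" using x x1 by (intro Udiff) auto
      moreover have "(real N - x + 1) * (2 * l) ^ k \<le> (d * real N + 1) * (2 * l) ^ k"
      proof (rule mult_right_mono)
        have "real N - x = d * x" using d by (simp add: x_def field_simps)
        also have "\<dots> \<le> d * real N" using x d by (intro mult_left_mono) auto
        finally show "real N - x + 1 \<le> d * real N + 1" by simp
      qed (use N in simp)
      ultimately have "U (real N) - W (real N) \<le> (d * real N + 1) * (2 * l) ^ k + 2 * K * (2 * real N) / L" by linarith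
      also have "\<dots> \<le> 2 ^ (k + 1) * (real N * l ^ p) + 8 * K * (real N * l ^ p)" using Ub KL by (rule add_mono)
      also have "\<dots> = B * (real N * l ^ p)" by (simp add: B_def algebra_simps)
      finally show ?thesis .
    qed
    have "(\<Sum>n=1..N. (mangoldt n - 1) * ln (real n) ^ (2 * p)) = W (real N) - U (real N)"
      by (simp add: W_def U_def sum_subtractf[symmetric] left_diff_distrib k_def)
    thus ?thesis using up low by (simp add: l_def mult.assoc abs_le_iff)
  qed
  moreover have "B > 0" using K by (simp add: B_def add_pos_pos)
  ultimately show ?thesis by blast
qed

section \<open>Removing the logarithmic weight\<close>

lemma abel_summation:
  fixes b v :: "nat \<Rightarrow> 'a::comm_ring"
  shows "(\<Sum>i<n. b i * v i) = (\<Sum>i<n. b i) * v n + (\<Sum>i<n. (\<Sum>j<Suc i. b j) * (v i - v (Suc i)))"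
  by (induction n) (simp_all add: algebra_simps)

text \<open>The variation of \<open>v\<close> telescopes to \<open>v 0 - v n\<close>, and the
  boundary term adds \<open>v n\<close> back.\<close>

lemma abel_inequality:
  fixes b v :: "nat \<Rightarrow> real"
  assumes B: "\<And>m. m \<le> n \<Longrightarrow> \<bar>\<Sum>i<m. b i\<bar> \<le> B" and v: "\<And>i. i \<le> n \<Longrightarrow> v i \<ge> 0" "\<And>i. i < n \<Longrightarrow> v (Suc i) \<le> v i"
  shows "\<bar>\<Sum>i<n. b i * v i\<bar> \<le> B * v 0"
proof -
  have "\<bar>\<Sum>i<n. b i * v i\<bar> \<le> \<bar>(\<Sum>i<n. b i) * v n\<bar> + \<bar>\<Sum>i<n. (\<Sum>j<Suc i. b j) * (v i - v (Suc i))\<bar>"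
    unfolding abel_summation[of b v n] by (rule abs_triangle_ineq)
  also have "\<dots> \<le> B * v n + (\<Sum>i<n. B * (v i - v (Suc i)))"
  proof (rule add_mono)
    show "\<bar>(\<Sum>i<n. b i) * v n\<bar> \<le> B * v n" unfolding abs_mult using B[of n] v(1)[of n] by (simp add: mult_right_mono)
    show "\<bar>\<Sum>i<n. (\<Sum>j<Suc i. b j) * (v i - v (Suc i))\<bar> \<le> (\<Sum>i<n. B * (v i - v (Suc i)))"
    proof (rule order.trans[OF sum_abs], rule sum_mono)
      fix i assume i: "i \<in> {..<n}"
      thus "\<bar>(\<Sum>j<Suc i. b j) * (v i - v (Suc i))\<bar> \<le> B * (v i - v (Suc i))"
        unfolding abs_mult using B[of "Suc i"] v(2)[of i] by (simp add: mult_right_mono del: sum.lessThan_Suc)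
    qed
  qed
  also have "(\<Sum>i<n. B * (v i - v (Suc i))) = B * (v 0 - v n)"
    unfolding sum_distrib_left[symmetric] by (simp add: sum_lessThan_telescope')
  finally show ?thesis by (simp add: algebra_simps)
qed

text \<open>Used below \<open>sqrt N\<close>, where a factor \<open>ln N\<close> is
  harmless.\<close>

lemma mangoldt_sum_trivial:
  assumes "n \<le> m" "m \<ge> 1"
  shows "\<bar>(\<Sum>i=1..n. mangoldt i) - real n\<bar> \<le> real n * (ln (real m) + 1)"
proof -
  have "\<bar>(\<Sum>i=1..n. mangoldt i) - real n\<bar> = \<bar>\<Sum>i=1..n. (mangoldt i - 1)\<bar>" by (simp add: sum_subtractf)
  also have "\<dots> \<le> (\<Sum>i=1..n. ln (real m) + 1)"
  proof (rule order.trans[OF sum_abs], rule sum_mono)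
    fix i assume i: "i \<in> {1..n}"
    have "mangoldt i \<le> ln (real i)" using i by (intro mangoldt_le) auto
    moreover have "ln (real i) \<le> ln (real m)" using i assms by simp
    ultimately show "\<bar>mangoldt i - 1\<bar> \<le> ln (real m) + 1" using mangoldt_nonneg[of i] by linarith
  qed
  also have "\<dots> = real n * (ln (real m) + 1)" by simp
  finally show ?thesis .
qed

text \<open>Above \<open>sqrt N\<close> the weight \<open>ln n ^ (2 * p)\<close> is at least
  \<open>ln N ^ (2 * p) / 4 ^ p\<close> and is removed by partial summation; below, the trivial
  bound is small enough. The error is measured by \<open>N\<close> for all \<open>n \<le> N\<close>
  at once, as the later partial summation at small frequencies requires.\<close>

theorem prime_number_theorem_log_power:
  "\<exists>C N0. C > 0 \<and> (\<forall>N\<ge>N0. \<forall>n\<le>N. \<bar>(\<Sum>i=1..n. mangoldt i) - real n\<bar> \<le> C * real N / ln (real N) ^ p)"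
proof -
  obtain C N0 where C: "C > 0" and bd: "\<And>N. N \<ge> N0 \<Longrightarrow> \<bar>\<Sum>n=1..N. (mangoldt n - 1) * ln (real n) ^ (2 * p)\<bar> \<le> C * real N * ln (real N) ^ p"
    using mangoldt_ln_power_sum[of p] by blast
  define D where "D = 2 * C * 4 ^ p + 1"
  have "eventually (\<lambda>N. sqrt (real N) \<ge> real N0 + 1 \<and> sqrt (real N) * (ln (real N) + 1) \<le> real N / ln (real N) ^ p \<and> ln (real N) \<ge> 1 \<and> real N \<ge> 1) sequentially"
    by (intro eventually_conj) real_asymp+
  then obtain N1 where N1: "\<And>N. N \<ge> N1 \<Longrightarrow> sqrt (real N) \<ge> real N0 + 1 \<and> sqrt (real N) * (ln (real N) + 1) \<le> real N / ln (real N) ^ p \<and> ln (real N) \<ge> 1 \<and> real N \<ge> 1"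
    unfolding eventually_sequentially by blast
  have "\<bar>(\<Sum>i=1..n. mangoldt i) - real n\<bar> \<le> D * real N / ln (real N) ^ p" if "N \<ge> N1" "n \<le> N" for N n
  proof -
    define l where "l = ln (real N)"
    have N: "sqrt (real N) \<ge> real N0 + 1" "sqrt (real N) * (l + 1) \<le> real N / l ^ p" "l \<ge> 1" "real N \<ge> 1"
      using N1[OF that(1)] by (auto simp: l_def)
    define q where "q = nat \<lfloor>sqrt (real N)\<rfloor>"
    have q: "real q \<le> sqrt (real N)" "sqrt (real N) < real q + 1" unfolding q_def using N by linarith+
    have qN: "q \<le> N"
    proof -
      have "sqrt (real N) \<le> real N" using N sqrt_le_D by (metis real_sqrt_le_iff real_sqrt_pow2 power2_eq_square mult_right_mono mult_1 of_nat_0_le_iff real_sqrt_ge_one real_sqrt_ge_zero)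
      thus ?thesis using q by linarith
    qed
    have qN0: "q \<ge> N0" using q N by linarith
    have small: "\<bar>(\<Sum>i=1..m. mangoldt i) - real m\<bar> \<le> real N / l ^ p" if "m \<le> q" for m
    proof -
      have "\<bar>(\<Sum>i=1..m. mangoldt i) - real m\<bar> \<le> real m * (ln (real N) + 1)"
        using that qN N by (intro mangoldt_sum_trivial) auto
      also have "\<dots> \<le> sqrt (real N) * (l + 1)" using that q N unfolding l_def by (intro mult_right_mono) auto
      finally show ?thesis using N by linarith
    qed
    show ?thesis
    proof (cases "n \<le> q")
      case True
      have "real N / l ^ p \<le> D * real N / l ^ p" using C N by (intro divide_right_mono) (auto simp: D_def mult_le_cancel_right1)
      thus ?thesis using small[OF True] by (simp add: l_def)
    next
      case False
      define b where "b i = (mangoldt (q + 1 + i) - 1) * ln (real (q + 1 + i)) ^ (2 * p)" for i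
      define v where "v i = 1 / ln (real (q + 1 + i)) ^ (2 * p)" for i
      have lnq: "ln (real (q + 1)) \<ge> l / 2"
      proof -
        have "ln (sqrt (real N)) \<le> ln (real (q + 1))" using q N by (intro ln_mono) auto
        thus ?thesis using N by (simp add: ln_sqrt l_def)
      qed
      have lni: "ln (real (q + 1 + i)) \<ge> l / 2" for i
      proof -
        have "ln (real (q + 1)) \<le> ln (real (q + 1 + i))" by simp
        thus ?thesis using lnq by linarith
      qed
      have lnpos: "ln (real (q + 1 + i)) > 0" for i using lni[of i] N(3) by linarith
      have shift: "(\<Sum>i<m. g (q + 1 + i)) = (\<Sum>i=1..q+m. g i) - (\<Sum>i=1..q. g i)" for g :: "nat \<Rightarrow> real" and m
        by (induction m) (simp_all add: algebra_simps)
      \<comment> \<open>Sums over \<open>q < i \<le> q + m\<close> are differences of two full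
        partial sums, hence the factor 2.\<close>
      have "\<bar>\<Sum>i<n-q. b i * v i\<bar> \<le> (2 * C * real N * l ^ p) * v 0"
      proof (rule abel_inequality)
        fix m assume m: "m \<le> n - q"
        have Bb: "\<bar>\<Sum>i=1..r. (mangoldt i - 1) * ln (real i) ^ (2 * p)\<bar> \<le> C * real N * l ^ p" if r: "q \<le> r" "r \<le> N" for r
        proof -
          have "\<bar>\<Sum>i=1..r. (mangoldt i - 1) * ln (real i) ^ (2 * p)\<bar> \<le> C * real r * ln (real r) ^ p"
            using r qN0 by (intro bd) auto
          also have "\<dots> \<le> C * real N * l ^ p"
          proof (cases "r = 0")
            case False
            thus ?thesis using C r unfolding l_def by (intro mult_mono power_mono) auto
          qed (use C N in simp)
          finally show ?thesis .
        qed
        have "(\<Sum>i<m. b i) = (\<Sum>i=1..q+m. (mangoldt i - 1) * ln (real i) ^ (2 * p)) - (\<Sum>i=1..q. (mangoldt i - 1) * ln (real i) ^ (2 * p))"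
          unfolding b_def by (rule shift)
        moreover have "q + m \<le> N" using m \<open>n \<le> N\<close> False by linarith
        ultimately show "\<bar>\<Sum>i<m. b i\<bar> \<le> 2 * C * real N * l ^ p"
          using Bb[of "q + m"] Bb[of q] qN by linarith
      next
        fix i show "v i \<ge> 0" using lnpos[of i] by (simp add: v_def)
        show "v (Suc i) \<le> v i" unfolding v_def using lnpos[of i] lnpos[of "Suc i"]
          by (intro divide_left_mono power_mono mult_pos_pos zero_less_power) auto
      qed
      also have "(\<Sum>i<n-q. b i * v i) = (\<Sum>i<n-q. mangoldt (q + 1 + i) - 1)"
      proof (rule sum.cong[OF refl])
        fix i
        have "ln (real (q + 1 + i)) ^ (2 * p) \<noteq> 0" using lnpos[of i] by simp
        thus "b i * v i = mangoldt (q + 1 + i) - 1" unfolding b_def v_def by simp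
      qed
      also have "\<dots> = (\<Sum>i=1..n. mangoldt i - 1) - (\<Sum>i=1..q. mangoldt i - 1)"
        using shift[of "\<lambda>i. mangoldt i - 1" "n - q"] False by simp
      finally have 1: "\<bar>((\<Sum>i=1..n. mangoldt i) - real n) - ((\<Sum>i=1..q. mangoldt i) - real q)\<bar> \<le> (2 * C * real N * l ^ p) * v 0"
        by (simp add: sum_subtractf)
      have v0: "v 0 \<le> 4 ^ p / l ^ (2 * p)"
      proof -
        have "(l / 2) ^ (2 * p) \<le> ln (real (q + 1 + 0)) ^ (2 * p)" using lni[of 0] N by (intro power_mono) auto
        hence "v 0 \<le> 1 / (l / 2) ^ (2 * p)" unfolding v_def using N lnpos[of 0] by (intro divide_left_mono mult_pos_pos zero_less_power) auto
        also have "\<dots> = 4 ^ p / l ^ (2 * p)" by (simp add: power_divide power_mult)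
        finally show ?thesis .
      qed
      have "(2 * C * real N * l ^ p) * v 0 \<le> (2 * C * real N * l ^ p) * (4 ^ p / l ^ (2 * p))"
        using v0 C N by (intro mult_left_mono) auto
      also have "\<dots> = 2 * C * 4 ^ p * real N / l ^ p"
      proof -
        have "l ^ (2 * p) = l ^ p * l ^ p" by (simp only: mult_2 power_add)
        moreover have "l ^ p \<noteq> 0" using N by simp
        ultimately show ?thesis using N(3) by simp
      qed
      finally have "\<bar>(\<Sum>i=1..n. mangoldt i) - real n\<bar> \<le> 2 * C * 4 ^ p * real N / l ^ p + real N / l ^ p"
        using 1 small[of q] by linarith
      also have "\<dots> = D * real N / l ^ p" by (simp add: D_def add_divide_distrib distrib_right)
      finally show ?thesis by (simp add: l_def)
    qed
  qed
  moreover have "D > 0" using C by (simp add: D_def add_pos_pos)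
  ultimately show ?thesis by blast
qed

section \<open>The circle method\<close>

text \<open>The numerators \<open>\<bar>a\<bar> \<le> 2 * N\<close> form a full set of residues
  modulo the odd number \<open>q = 4 * N + 1\<close>, placed symmetrically so that every
  \<open>a / q\<close> has absolute value below 1/2. The shift by \<open>2 * N\<close> contributes
  only a constant phase.\<close>

lemma sum_ee_symmetric:
  fixes j :: int
  assumes "\<bar>j\<bar> \<le> 4 * int N"
  defines "q \<equiv> 4 * real N + 1"
  shows "(\<Sum>a\<in>{- 2 * int N..2 * int N}. ee (of_int a * (of_int j / q))) = (if j = 0 then of_real q else 0)"
proof (cases "j = 0")
  case True
  thus ?thesis by (simp add: q_def)
next
  case False
  define Q where "Q = 4 * N + 1"
  have Q: "q = real Q" by (simp add: q_def Q_def)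
  have "(\<Sum>a\<in>{- 2 * int N..2 * int N}. ee (of_int a * (of_int j / q))) =
     (\<Sum>r<Q. ee (of_int (int r - 2 * int N) * (of_int j / q)))"
    by (rule sum.reindex_bij_witness[of _ "\<lambda>r. int r - 2 * int N" "\<lambda>a. nat (a + 2 * int N)"]) (auto simp: Q_def)
  also have "\<dots> = (\<Sum>r<Q. ee (of_int j * (real r / real Q)) * ee (- 2 * real N * (of_int j / q)))"
    by (intro sum.cong refl) (simp add: Q ee_add[symmetric] algebra_simps diff_divide_distrib)
  also have "\<dots> = (\<Sum>r<Q. ee (of_int j * (real r / real Q))) * ee (- 2 * real N * (of_int j / q))"
    by (simp only: sum_distrib_right)
  also have "(\<Sum>r<Q. ee (of_int j * (real r / real Q))) = 0"
  proof (rule sum_ee_roots)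
    show "\<not> int Q dvd j"
    proof
      assume "int Q dvd j"
      hence "int Q dvd \<bar>j\<bar>" by simp
      hence "int Q \<le> \<bar>j\<bar>" using False by (intro zdvd_imp_le) auto
      thus False using assms by (simp add: Q_def)
    qed
  qed (simp add: Q_def)
  finally show ?thesis using False by simp
qed

text \<open>\<open>L \<le> 2 * N\<close> keeps all differences \<open>n - m\<close> in the range
  where \<open>sum_ee_symmetric\<close> is an exact orthogonality relation.\<close>

lemma parseval_discrete:
  fixes z :: "nat \<Rightarrow> real"
  assumes L: "L \<le> 2 * N"
  defines "q \<equiv> 4 * real N + 1"
  shows "(\<Sum>a\<in>{- 2 * int N..2 * int N}. (norm (\<Sum>n=1..L. of_real (z n) * ee (of_int a / q * real n)))\<^sup>2) = q * (\<Sum>n=1..L. (z n)\<^sup>2)"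
proof -
  let ?A = "{- 2 * int N..2 * int N}"
  have "of_real (\<Sum>a\<in>?A. (norm (\<Sum>n=1..L. of_real (z n) * ee (of_int a / q * real n)))\<^sup>2) =
    (\<Sum>a\<in>?A. \<Sum>n=1..L. \<Sum>m=1..L. (of_real (z n) * ee (of_int a / q * real n)) * cnj (of_real (z m) * ee (of_int a / q * real m)))"
    by (simp only: of_real_sum complex_norm_square cnj_sum sum_product)
  also have "\<dots> = (\<Sum>a\<in>?A. \<Sum>n=1..L. \<Sum>m=1..L. of_real (z n * z m) * ee (of_int a * (of_int (int n - int m) / q)))"
  proof (intro sum.cong refl)
    fix a n m
    have "of_int a * (of_int (int n - int m) / q) = of_int a / q * real n - of_int a / q * real m"
      by (simp add: diff_divide_distrib algebra_simps)
    hence "ee (of_int a * (of_int (int n - int m) / q)) = ee (of_int a / q * real n) * cnj (ee (of_int a / q * real m))"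
      by (simp only: ee_diff)
    thus "(of_real (z n) * ee (of_int a / q * real n)) * cnj (of_real (z m) * ee (of_int a / q * real m)) = of_real (z n * z m) * ee (of_int a * (of_int (int n - int m) / q))"
      by simp
  qed
  also have "\<dots> = (\<Sum>n=1..L. \<Sum>m=1..L. \<Sum>a\<in>?A. of_real (z n * z m) * ee (of_int a * (of_int (int n - int m) / q)))"
    by (subst sum.swap, rule sum.cong[OF refl], rule sum.swap)
  also have "\<dots> = (\<Sum>n=1..L. \<Sum>m=1..L. of_real (z n * z m) * (if m = n then of_real q else 0))"
  proof (intro sum.cong refl)
    fix n m assume "n \<in> {1..L}" "m \<in> {1..L}"
    hence "\<bar>int n - int m\<bar> \<le> 4 * int N" using L by auto
    from sum_ee_symmetric[OF this]
    have "(\<Sum>a\<in>?A. ee (of_int a * (of_int (int n - int m) / q))) = (if m = n then of_real q else 0)"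
      unfolding q_def by auto
    thus "(\<Sum>a\<in>?A. of_real (z n * z m) * ee (of_int a * (of_int (int n - int m) / q))) = of_real (z n * z m) * (if m = n then of_real q else 0)"
      by (simp only: sum_distrib_left[symmetric])
  qed
  also have "\<dots> = (\<Sum>n=1..L. of_real (z n * z n) * of_real q)"
    by (intro sum.cong refl) (simp add: if_distrib cong: if_cong)
  also have "\<dots> = of_real (q * (\<Sum>n=1..L. (z n)\<^sup>2))"
    by (simp add: sum_distrib_left power2_eq_square mult_ac)
  finally show ?thesis by (simp only: of_real_eq_iff)
qed

text \<open>All values \<open>k - n - h m\<close> are at most \<open>4 * N\<close> in absolute
  value, so orthogonality modulo \<open>q\<close> detects the equation \<open>k = n + h m\<close>
  itself, without wrap-around. The range \<open>k \<le> 2 * N\<close> contains every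
  \<open>n + h m\<close>.\<close>

lemma correlation_fourier:
  fixes f g :: "nat \<Rightarrow> real" and h :: "nat \<Rightarrow> nat"
  assumes h: "\<And>m. m \<in> A \<Longrightarrow> h m \<le> N"
  defines "q \<equiv> 4 * real N + 1"
  shows "of_real (q * (\<Sum>m\<in>A. \<Sum>n=1..N. f n * g (n + h m))) =
    (\<Sum>a\<in>{- 2 * int N..2 * int N}. cnj (\<Sum>n=1..N. of_real (f n) * ee (of_int a / q * real n)) *
       (\<Sum>k=1..2*N. of_real (g k) * ee (of_int a / q * real k)) * cnj (\<Sum>m\<in>A. ee (of_int a / q * real (h m))))"
proof -
  let ?A = "{- 2 * int N..2 * int N}"
  have "(\<Sum>a\<in>?A. cnj (\<Sum>n=1..N. of_real (f n) * ee (of_int a / q * real n)) *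
       (\<Sum>k=1..2*N. of_real (g k) * ee (of_int a / q * real k)) * cnj (\<Sum>m\<in>A. ee (of_int a / q * real (h m)))) =
    (\<Sum>a\<in>?A. \<Sum>m\<in>A. \<Sum>n=1..N. \<Sum>k=1..2*N. of_real (f n * g k) * ee (of_int a * (of_int (int k - int n - int (h m)) / q)))"
  proof (rule sum.cong[OF refl])
    fix a
    have e: "ee (of_int a * (of_int (int k - int n - int (h m)) / q)) = cnj (ee (of_int a / q * real n)) * ee (of_int a / q * real k) * cnj (ee (of_int a / q * real (h m)))" for k n m
    proof -
      have "of_int a * (of_int (int k - int n - int (h m)) / q) = of_int a / q * real k - of_int a / q * real n - of_int a / q * real (h m)"
        by (simp add: diff_divide_distrib add_divide_distrib algebra_simps)
      thus ?thesis by (simp only: ee_diff mult_ac)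
    qed
    have "cnj (\<Sum>n=1..N. of_real (f n) * ee (of_int a / q * real n)) * (\<Sum>k=1..2*N. of_real (g k) * ee (of_int a / q * real k)) * cnj (\<Sum>m\<in>A. ee (of_int a / q * real (h m)))
       = (\<Sum>m\<in>A. (\<Sum>n=1..N. \<Sum>k=1..2*N. (of_real (f n) * cnj (ee (of_int a / q * real n))) * (of_real (g k) * ee (of_int a / q * real k))) * cnj (ee (of_int a / q * real (h m))))"
      by (simp only: cnj_sum complex_cnj_mult complex_cnj_complex_of_real sum_product sum_distrib_left[symmetric])
    also have "\<dots> = (\<Sum>m\<in>A. \<Sum>n=1..N. \<Sum>k=1..2*N. of_real (f n * g k) * ee (of_int a * (of_int (int k - int n - int (h m)) / q)))"
      unfolding e by (simp only: sum_distrib_right of_real_mult) (simp only: mult_ac)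
    finally show "cnj (\<Sum>n=1..N. of_real (f n) * ee (of_int a / q * real n)) * (\<Sum>k=1..2*N. of_real (g k) * ee (of_int a / q * real k)) * cnj (\<Sum>m\<in>A. ee (of_int a / q * real (h m)))
       = (\<Sum>m\<in>A. \<Sum>n=1..N. \<Sum>k=1..2*N. of_real (f n * g k) * ee (of_int a * (of_int (int k - int n - int (h m)) / q)))" .
  qed
  also have "\<dots> = (\<Sum>m\<in>A. \<Sum>n=1..N. \<Sum>k=1..2*N. \<Sum>a\<in>?A. of_real (f n * g k) * ee (of_int a * (of_int (int k - int n - int (h m)) / q)))"
    by (subst sum.swap, rule sum.cong[OF refl], subst sum.swap, rule sum.cong[OF refl], rule sum.swap)
  also have "\<dots> = (\<Sum>m\<in>A. \<Sum>n=1..N. \<Sum>k=1..2*N. of_real (f n * g k) * (if k = n + h m then of_real q else 0))"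
  proof (intro sum.cong refl)
    fix m n k assume "m \<in> A" "n \<in> {1..N}" "k \<in> {1..2*N}"
    hence "\<bar>int k - int n - int (h m)\<bar> \<le> 4 * int N" using h[of m] by auto
    from sum_ee_symmetric[OF this]
    have "(\<Sum>a\<in>?A. ee (of_int a * (of_int (int k - int n - int (h m)) / q))) = (if int k - int n - int (h m) = 0 then of_real q else 0)"
      unfolding q_def .
    moreover have "int k - int n - int (h m) = 0 \<longleftrightarrow> k = n + h m" by auto
    ultimately have "(\<Sum>a\<in>?A. ee (of_int a * (of_int (int k - int n - int (h m)) / q))) = (if k = n + h m then of_real q else 0)" by simp
    thus "(\<Sum>a\<in>?A. of_real (f n * g k) * ee (of_int a * (of_int (int k - int n - int (h m)) / q))) = of_real (f n * g k) * (if k = n + h m then of_real q else 0)"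
      by (simp only: sum_distrib_left[symmetric])
  qed
  also have "\<dots> = (\<Sum>m\<in>A. \<Sum>n=1..N. of_real (f n * g (n + h m)) * of_real q)"
  proof (intro sum.cong refl)
    fix m n assume mn: "m \<in> A" "n \<in> {1..N}"
    have "(\<Sum>k=1..2*N. of_real (f n * g k) * (if k = n + h m then of_real q else 0)) = (\<Sum>k=1..2*N. if k = n + h m then of_real (f n * g k) * complex_of_real q else 0)"
      by (intro sum.cong refl) auto
    also have "\<dots> = of_real (f n * g (n + h m)) * of_real q" using mn h[of m] by simp
    finally show "(\<Sum>k=1..2*N. of_real (f n * g k) * (if k = n + h m then of_real q else 0)) = of_real (f n * g (n + h m)) * complex_of_real q" .
  qed
  also have "\<dots> = of_real (q * (\<Sum>m\<in>A. \<Sum>n=1..N. f n * g (n + h m)))"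
    by (simp add: sum_distrib_left mult_ac)
  finally show ?thesis by simp
qed

text \<open>Consecutive phases differ by at most \<open>2 * pi * \<bar>t\<bar>\<close>, so as long
  as \<open>\<bar>t\<bar> * L\<close> is a power of the logarithm, only such a power is
  lost.\<close>

lemma exponential_sum_partial_summation:
  fixes f :: "nat \<Rightarrow> real"
  assumes E: "\<And>m. m \<le> L \<Longrightarrow> \<bar>\<Sum>k=1..m. f k\<bar> \<le> E"
  shows "norm (\<Sum>k=1..L. of_real (f k) * ee (t * real k)) \<le> E * (1 + real L * (2 * pi * \<bar>t\<bar>))"
proof -
  define b v where "b i = complex_of_real (f (Suc i))" and "v i = ee (t * real (Suc i))" for i
  have E0: "E \<ge> 0" using E[of 0] by simp
  have B: "norm (\<Sum>i<m. b i) \<le> E" if "m \<le> L" for m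
  proof -
    have "(\<Sum>i<m. b i) = of_real (\<Sum>k=1..m. f k)"
      unfolding b_def by (simp add: sum.atLeast1_atMost_eq)
    thus ?thesis using E[OF that] by (simp only: norm_of_real)
  qed
  have "(\<Sum>k=1..L. of_real (f k) * ee (t * real k)) = (\<Sum>i<L. b i * v i)"
    unfolding b_def v_def by (simp add: sum.atLeast1_atMost_eq)
  also have "\<dots> = (\<Sum>i<L. b i) * v L + (\<Sum>i<L. (\<Sum>j<Suc i. b j) * (v i - v (Suc i)))" by (rule abel_summation)
  also have "norm \<dots> \<le> E * 1 + (\<Sum>i<L. E * (2 * pi * \<bar>t\<bar>))"
  proof (rule norm_triangle_mono)
    show "norm ((\<Sum>i<L. b i) * v L) \<le> E * 1" unfolding norm_mult using B[of L] by (simp add: v_def)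
    show "norm (\<Sum>i<L. (\<Sum>j<Suc i. b j) * (v i - v (Suc i))) \<le> (\<Sum>i<L. E * (2 * pi * \<bar>t\<bar>))"
    proof (rule order.trans[OF norm_sum], rule sum_mono)
      fix i assume i: "i \<in> {..<L}"
      have "norm (v i - v (Suc i)) \<le> 2 * pi * \<bar>t * real (Suc i) - t * real (Suc (Suc i))\<bar>"
        unfolding v_def by (rule norm_ee_diff_le)
      also have "t * real (Suc i) - t * real (Suc (Suc i)) = - t" by (simp add: algebra_simps)
      finally have "norm (v i - v (Suc i)) \<le> 2 * pi * \<bar>t\<bar>" by simp
      thus "norm ((\<Sum>j<Suc i. b j) * (v i - v (Suc i))) \<le> E * (2 * pi * \<bar>t\<bar>)"
        unfolding norm_mult using i E0 by (intro mult_mono B) auto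
    qed
  qed
  also have "\<dots> = E * (1 + real L * (2 * pi * \<bar>t\<bar>))" by (simp add: algebra_simps)
  finally show ?thesis .
qed

text \<open>The circle method on the grid \<open>a / q\<close>: near \<open>0\<close> the sum over \<open>g\<close> is small by its mean-value
  bound \<open>E\<close>, elsewhere the sum over the shifts saves a factor \<open>\<tau>\<close> and Parseval handles the rest.\<close>
lemma shifted_correlation_bound:
  fixes f g :: "nat \<Rightarrow> real" and h :: "nat \<Rightarrow> nat"
  assumes h: "\<And>m. m \<in> A \<Longrightarrow> h m \<le> N" and N: "N > 0"
    and f0: "\<And>n. f n \<ge> 0" and f1: "(\<Sum>n=1..N. f n) \<le> 2 * real N"
    and f2: "(\<Sum>n=1..N. (f n)\<^sup>2) \<le> V" and g2: "(\<Sum>n=1..2*N. (g n)\<^sup>2) \<le> V"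
    and E: "\<And>m. m \<le> 2 * N \<Longrightarrow> \<bar>\<Sum>k=1..m. g k\<bar> \<le> E"
    and \<theta>: "\<theta> * real N \<ge> 1" and \<tau>: "\<tau> \<ge> 0"
    and minor: "\<And>t. \<theta> \<le> \<bar>t\<bar> \<Longrightarrow> \<bar>t\<bar> \<le> 1/2 \<Longrightarrow> norm (\<Sum>m\<in>A. ee (t * real (h m))) \<le> \<tau> * real (card A)"
  shows "\<bar>\<Sum>m\<in>A. \<Sum>n=1..N. f n * g (n + h m)\<bar> \<le> real (card A) * (\<tau> * V + 84 * E * (\<theta> * real N)\<^sup>2)"
proof -
  define q where "q = 4 * real N + 1"
  define I where "I = {- 2 * int N..2 * int N}"
  define S where "S a = (\<Sum>n=1..N. of_real (f n) * ee (of_int a / q * real n))" for a :: int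
  define G where "G a = (\<Sum>k=1..2*N. of_real (g k) * ee (of_int a / q * real k))" for a :: int
  define T where "T a = (\<Sum>m\<in>A. ee (of_int a / q * real (h m)))" for a :: int
  define X where "X = (\<Sum>m\<in>A. \<Sum>n=1..N. f n * g (n + h m))"
  \<comment> \<open>A single major arc: only frequencies around 0 are exceptional.\<close>
  define Ma where "Ma = {a \<in> I. \<bar>of_int a / q\<bar> < \<theta>}"
  define c where "c = real (card A)"
  have q: "q > 0" "q \<ge> 1" by (auto simp: q_def)
  have qN: "real N \<le> q" "2 * real N / q \<le> 1/2" using q by (auto simp: q_def field_simps)
  have th: "\<theta> > 0" using \<theta> N by (smt (verit) mult_nonpos_nonneg of_nat_0_le_iff)
  have E0: "E \<ge> 0" using E[of 0] by simp
  have V0: "V \<ge> 0" using f2 by (smt (verit) sum_nonneg zero_le_power2)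
  have finI: "finite I" by (simp add: I_def)
  have eq: "of_real (q * X) = (\<Sum>a\<in>I. cnj (S a) * G a * cnj (T a))"
    unfolding X_def S_def G_def T_def I_def q_def by (rule correlation_fourier[OF h])
  have "q * \<bar>X\<bar> = norm (complex_of_real (q * X))" using q by (simp only: norm_of_real abs_mult)
  also have "\<dots> \<le> (\<Sum>a\<in>I. norm (S a) * norm (G a) * norm (T a))"
    unfolding eq by (rule order.trans[OF norm_sum]) (simp add: norm_mult)
  also have "\<dots> = (\<Sum>a\<in>Ma. norm (S a) * norm (G a) * norm (T a)) + (\<Sum>a\<in>I-Ma. norm (S a) * norm (G a) * norm (T a))"
    using sum.subset_diff[of Ma I "\<lambda>a. norm (S a) * norm (G a) * norm (T a)"] finI by (simp add: Ma_def add.commute)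
  also have "(\<Sum>a\<in>I-Ma. norm (S a) * norm (G a) * norm (T a)) \<le> q * (c * (\<tau> * V))"
  proof -
    have "(\<Sum>a\<in>I-Ma. norm (S a) * norm (G a) * norm (T a)) \<le> (\<Sum>a\<in>I-Ma. norm (S a) * norm (G a) * (\<tau> * c))"
    proof (intro sum_mono mult_left_mono)
      fix a assume a: "a \<in> I - Ma"
      hence a1: "\<theta> \<le> \<bar>of_int a / q\<bar>" by (auto simp: Ma_def)
      have "\<bar>real_of_int a\<bar> \<le> 2 * real N" using a by (auto simp: I_def)
      hence "\<bar>of_int a / q\<bar> \<le> 2 * real N / q" using q by (simp add: divide_right_mono)
      hence a2: "\<bar>of_int a / q\<bar> \<le> 1/2" using qN by linarith
      show "norm (T a) \<le> \<tau> * c" unfolding T_def c_def by (rule minor[OF a1 a2])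
    qed auto
    also have "\<dots> = (\<Sum>a\<in>I-Ma. norm (S a) * norm (G a)) * (\<tau> * c)" by (simp only: sum_distrib_right)
    \<comment> \<open>The major frequencies are put back, so that Parseval covers the full
      grid.\<close>
    also have "\<dots> \<le> (\<Sum>a\<in>I. norm (S a) * norm (G a)) * (\<tau> * c)"
      using \<tau> finI by (intro mult_right_mono sum_mono2) (auto simp: c_def)
    also have "(\<Sum>a\<in>I. norm (S a) * norm (G a)) \<le> q * V"
    proof (rule power2_le_imp_le)
      have "(\<Sum>a\<in>I. norm (S a) * norm (G a))\<^sup>2 \<le> (\<Sum>a\<in>I. (norm (S a))\<^sup>2) * (\<Sum>a\<in>I. (norm (G a))\<^sup>2)"
        by (rule Cauchy_Schwarz_ineq_sum)
      also have "(\<Sum>a\<in>I. (norm (S a))\<^sup>2) = q * (\<Sum>n=1..N. (f n)\<^sup>2)"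
        unfolding S_def I_def q_def by (rule parseval_discrete) simp
      also have "(\<Sum>a\<in>I. (norm (G a))\<^sup>2) = q * (\<Sum>n=1..2*N. (g n)\<^sup>2)"
        unfolding G_def I_def q_def by (rule parseval_discrete) simp
      also have "q * (\<Sum>n=1..N. (f n)\<^sup>2) * (q * (\<Sum>n=1..2*N. (g n)\<^sup>2)) \<le> (q * V) * (q * V)"
        using q V0 f2 g2 by (intro mult_mono mult_left_mono) (auto intro!: mult_nonneg_nonneg sum_nonneg)
      finally show "(\<Sum>a\<in>I. norm (S a) * norm (G a))\<^sup>2 \<le> (q * V)\<^sup>2" by (simp add: power2_eq_square)
    qed (use q V0 in auto)
    hence "(\<Sum>a\<in>I. norm (S a) * norm (G a)) * (\<tau> * c) \<le> (q * V) * (\<tau> * c)"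
      using \<tau> by (intro mult_right_mono) (auto simp: c_def)
    finally show ?thesis by (simp add: mult_ac)
  qed
  also have "(\<Sum>a\<in>Ma. norm (S a) * norm (G a) * norm (T a)) \<le> q * (c * (84 * E * (\<theta> * real N)\<^sup>2))"
  proof -
    define y where "y = \<theta> * real N"
    have y: "y \<ge> 1" using \<theta> by (simp add: y_def)
    \<comment> \<open>Nothing is saved on \<open>S\<close> and \<open>T\<close> here. The 14 comes
      from \<open>1 + 4 * pi * y\<close> with \<open>y \<ge> 1\<close>.\<close>
    have each: "norm (S a) * norm (G a) * norm (T a) \<le> (2 * real N) * (14 * E * y) * c" if a: "a \<in> Ma" for a
    proof (intro mult_mono)
      have "norm (S a) \<le> (\<Sum>n=1..N. norm (of_real (f n) * ee (of_int a / q * real n)))"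
        unfolding S_def by (rule norm_sum)
      also have "\<dots> = (\<Sum>n=1..N. f n)" using f0 by (simp add: norm_mult)
      finally show "norm (S a) \<le> 2 * real N" using f1 by linarith
      have "norm (G a) \<le> E * (1 + real (2 * N) * (2 * pi * \<bar>of_int a / q\<bar>))"
        unfolding G_def by (rule exponential_sum_partial_summation[OF E])
      also have "\<dots> \<le> E * (14 * y)"
      proof (rule mult_left_mono[OF _ E0])
        have "real (2 * N) * (2 * pi * \<bar>of_int a / q\<bar>) \<le> real (2 * N) * (2 * 3.2 * \<theta>)"
          using a pi_approx by (intro mult_left_mono mult_mono) (auto simp: Ma_def)
        also have "\<dots> = 12.8 * y" by (simp add: y_def)
        finally show "1 + real (2 * N) * (2 * pi * \<bar>of_int a / q\<bar>) \<le> 14 * y" using y by linarith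
      qed
      finally show "norm (G a) \<le> 14 * E * y" by (simp add: mult_ac)
      have "norm (T a) \<le> (\<Sum>m\<in>A. norm (ee (of_int a / q * real (h m))))" unfolding T_def by (rule norm_sum)
      thus "norm (T a) \<le> c" by (simp add: c_def)
    qed (use E0 y in \<open>auto simp: c_def\<close>)
    \<comment> \<open>At most \<open>2 * \<theta> * q + 1\<close> integers, and
      \<open>\<theta> * q \<ge> 1\<close>. With the preceding estimate this makes
      \<open>84 = 3 * 2 * 14\<close>.\<close>
    have cardM: "real (card Ma) \<le> 3 * (\<theta> * q)"
    proof -
      define b where "b = \<lfloor>\<theta> * q\<rfloor>"
      have tq: "\<theta> * q \<ge> 1" using \<theta> th qN mult_left_mono[of "real N" q \<theta>] by linarith
      have "Ma \<subseteq> {-b..b}"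
      proof
        fix a assume "a \<in> Ma"
        hence "\<bar>of_int a / q\<bar> < \<theta>" by (simp add: Ma_def)
        hence "\<bar>real_of_int a\<bar> < \<theta> * q" using q by (simp add: abs_divide field_simps)
        hence "of_int a \<le> \<theta> * q" "of_int (- a) \<le> \<theta> * q" by auto
        hence "a \<le> b" "- a \<le> b" unfolding b_def by (simp_all only: le_floor_iff)
        thus "a \<in> {-b..b}" by auto
      qed
      hence "card Ma \<le> card {-b..b}" by (intro card_mono) auto
      also have "card {-b..b} = nat (2 * b + 1)" by simp
      finally have "real (card Ma) \<le> real (nat (2 * b + 1))" by simp
      also have "\<dots> \<le> 2 * (\<theta> * q) + 1"
      proof -
        have "b \<ge> 0" using tq by (simp add: b_def)
        hence "real (nat (2 * b + 1)) = 2 * of_int b + 1" by simp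
        thus ?thesis unfolding b_def by linarith
      qed
      finally show ?thesis using tq by linarith
    qed
    have "(\<Sum>a\<in>Ma. norm (S a) * norm (G a) * norm (T a)) \<le> real (card Ma) * ((2 * real N) * (14 * E * y) * c)"
      using sum_bounded_above[OF each, of Ma] by simp
    also have "\<dots> \<le> (3 * (\<theta> * q)) * ((2 * real N) * (14 * E * y) * c)"
      using cardM E0 y by (intro mult_right_mono) (auto simp: c_def intro!: mult_nonneg_nonneg)
    also have "\<dots> = q * (c * (84 * E * (\<theta> * real N)\<^sup>2))" by (simp add: y_def power2_eq_square)
    finally show ?thesis .
  qed
  finally have "q * \<bar>X\<bar> \<le> q * (c * (\<tau> * V + 84 * E * (\<theta> * real N)\<^sup>2))"
    by (simp add: algebra_simps)
  thus ?thesis using q by (simp add: X_def c_def)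
qed

section \<open>Choice of parameters and conclusion\<close>

lemma sum_mangoldt_square_le:
  assumes "L \<ge> 1"
  shows "(\<Sum>n=1..L. (mangoldt n)\<^sup>2) \<le> ln (real L) * (\<Sum>n=1..L. mangoldt n :: real)"
  unfolding sum_distrib_left
proof (rule sum_mono)
  fix n assume n: "n \<in> {1..L}"
  have "mangoldt n \<le> ln (real n)" using n by (intro mangoldt_le) auto
  also have "\<dots> \<le> ln (real L)" using n by simp
  finally show "(mangoldt n)\<^sup>2 \<le> ln (real L) * (mangoldt n :: real)"
    unfolding power2_eq_square by (intro mult_right_mono mangoldt_nonneg)
qed

text \<open>Parseval loses one logarithm, so the exponential sum has to save
  \<open>R = ln X powr (A + 1)\<close>. It does so from the frequency
  \<open>R powr E1 / M powr c\<close> on, and \<open>M powr c\<close> is about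
  \<open>X / ln X powr (A + 2)\<close>. Allowing all \<open>M\<close> within a factor 2 leaves room
  for rounding the upper limit of the average.\<close>

lemma mangoldt_correlation_bound:
  fixes c A :: real
  assumes c: "c > 1" "c \<notin> \<int>" and A: "A \<ge> 1"
  shows "\<exists>C. eventually (\<lambda>X. \<forall>M::nat. real M \<le> X powr (1/c) / ln X powr ((A+2)/c) \<longrightarrow> 2 * real M \<ge> X powr (1/c) / ln X powr ((A+2)/c) \<longrightarrow>
      \<bar>\<Sum>m=1..M. \<Sum>n=1..nat \<lfloor>X\<rfloor>. mangoldt n * (mangoldt (n + nat \<lfloor>real m powr c\<rfloor>) - 1)\<bar> \<le> C * real M * real (nat \<lfloor>X\<rfloor>) / ln X powr A \<and>
      \<bar>(\<Sum>n=1..nat \<lfloor>X\<rfloor>. mangoldt n) - real (nat \<lfloor>X\<rfloor>)\<bar> \<le> C * real (nat \<lfloor>X\<rfloor>) / ln X powr A) at_top"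
proof -
  obtain C1 E1 where C1: "C1 > 0" "E1 \<ge> 1" and es: "\<And>R (M::nat) a. R \<ge> 2 \<Longrightarrow> real M \<ge> R powr E1 \<Longrightarrow>
      R powr E1 / real M powr c \<le> \<bar>a\<bar> \<Longrightarrow> \<bar>a\<bar> \<le> 1/2 \<Longrightarrow>
      norm (\<Sum>m=1..M. ee (a * of_int \<lfloor>real m powr c\<rfloor>)) \<le> C1 * real M / R"
    using exponential_sum_floor_bound[OF c] by blast
  \<comment> \<open>\<open>R powr E1\<close> will be \<open>ln X powr D\<close>.\<close>
  define D where "D = (A + 1) * E1"
  \<comment> \<open>\<open>A + 2\<close> is the logarithmic gap between \<open>X\<close> and
    \<open>M powr c\<close>; one further logarithm absorbs the constant
    \<open>2 powr c\<close>.\<close>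
  define K where "K = D + A + 3"
  have D: "D > 0" "K > 0" using A C1 by (auto simp: D_def K_def intro!: mult_pos_pos add_pos_pos)
  \<comment> \<open>The major arc costs \<open>(ln X powr K)\<^sup>2\<close>, after which
    \<open>ln X powr A\<close> must still be saved.\<close>
  define p where "p = nat \<lceil>2 * K + A\<rceil>"
  have p: "real p \<ge> 2 * K + A" unfolding p_def by linarith
  obtain C2 N2 where C2: "C2 > 0" and pnt: "\<And>N n. N \<ge> N2 \<Longrightarrow> n \<le> N \<Longrightarrow> \<bar>(\<Sum>i=1..n. mangoldt i) - real n\<bar> \<le> C2 * real N / ln (real N) ^ p"
    using prime_number_theorem_log_power[of p] by blast
  define C where "C = 10 * C1 + 168 * C2 + 2 * C2"
  define Y where "Y X = X powr (1/c) / ln X powr ((A+2)/c)" for X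
  have cpos: "c > 0" using c by simp
  have ev: "eventually (\<lambda>X. X \<ge> 2 \<and> X \<ge> real N2 + 1 \<and> ln X \<ge> 2 powr (c + 1) \<and> ln X \<ge> 2 * C2 \<and> ln X \<ge> 2 \<and> Y X \<ge> 2 * ln X powr D) at_top"
  proof (intro eventually_conj)
    show "eventually (\<lambda>X. Y X \<ge> 2 * ln X powr D) at_top"
      unfolding Y_def using cpos A D by real_asymp
  qed real_asymp+
  show ?thesis
  proof (rule exI[of _ C], rule eventually_mono[OF ev], safe)
    fix X :: real and M :: nat
    assume X: "X \<ge> 2" "X \<ge> real N2 + 1" "ln X \<ge> 2 powr (c + 1)" "ln X \<ge> 2 * C2" "ln X \<ge> 2" "Y X \<ge> 2 * ln X powr D"
      and M0: "real M \<le> X powr (1/c) / ln X powr ((A+2)/c)" "2 * real M \<ge> X powr (1/c) / ln X powr ((A+2)/c)"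
    have M: "real M \<le> Y X" "2 * real M \<ge> Y X" using M0 by (auto simp: Y_def)
    define l where "l = ln X"
    define N where "N = nat \<lfloor>X\<rfloor>"
    have N: "real N \<le> X" "X < real N + 1" "N \<ge> 1" "X \<le> 2 * real N" unfolding N_def using X by linarith+
    have NN2: "N \<ge> N2" using N X by linarith
    have l: "l \<ge> 2" "l \<ge> 2 powr (c + 1)" "l \<ge> 2 * C2" using X by (auto simp: l_def)
    have l2N: "ln (real (2 * N)) \<ge> l" using N X unfolding l_def by (intro ln_mono) auto
    have l2N': "ln (real (2 * N)) \<le> 2 * l"
    proof -
      have "real (2 * N) \<le> X * X" using N X mult_mono[of 2 X "real N" X] by simp
      hence "ln (real (2 * N)) \<le> ln (X * X)" using N by (intro ln_mono) auto
      thus ?thesis using X by (simp add: ln_mult l_def)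
    qed
    have Yc: "Y X powr c = X / l powr (A + 2)"
      unfolding Y_def l_def using cpos X by (simp add: powr_divide powr_powr)
    have lp: "l powr y \<le> l powr z" if "y \<le> z" for y z using l that by (intro powr_mono) auto
    have l0: "l powr 0 = 1" using l by simp
    have M1: "real M \<ge> l powr D" using M X by (simp add: l_def)
    have Mpos: "real M \<ge> 1" using M1 lp[of 0 D] l0 D by linarith
    have hN: "nat \<lfloor>real m powr c\<rfloor> \<le> N" if "m \<in> {1..M}" for m
    proof -
      have "real m powr c \<le> Y X powr c" using that M cpos by (intro powr_mono2) auto
      also have "\<dots> \<le> X"
      proof -
        have "l powr (A + 2) \<ge> 1" using lp[of 0 "A + 2"] l0 A by simp
        hence "X / l powr (A + 2) \<le> X / 1" using X by (intro divide_left_mono) auto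
        thus ?thesis unfolding Yc by simp
      qed
      finally show ?thesis unfolding N_def by (intro nat_mono floor_mono)
    qed
    have pntE: "\<bar>(\<Sum>i=1..n. mangoldt i) - real n\<bar> \<le> 2 * C2 * real N / l ^ p" if "n \<le> 2 * N" for n
    proof -
      have "\<bar>(\<Sum>i=1..n. mangoldt i) - real n\<bar> \<le> C2 * real (2 * N) / ln (real (2 * N)) ^ p"
        using that NN2 by (intro pnt) auto
      also have "\<dots> \<le> C2 * real (2 * N) / l ^ p"
        using l2N l C2 by (intro divide_left_mono power_mono mult_pos_pos zero_less_power) auto
      finally show ?thesis by (simp add: mult_ac)
    qed
    have lpp: "l ^ p = l powr real p" using l by (simp add: powr_realpow)
    have lppK: "l powr (2 * K + A) \<le> l ^ p" unfolding lpp by (rule lp[OF p])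
    have pinv: "1 / l ^ p \<le> 1 / l powr A" unfolding lpp using lp[of A "real p"] p D l by (intro divide_left_mono) auto
    have psi: "(\<Sum>i=1..n. mangoldt i) \<le> 2 * real n" if "n \<in> {N, 2 * N}" for n
    proof -
      have "2 * C2 * real N / l ^ p \<le> 2 * C2 * real N / l"
      proof (rule divide_left_mono)
        have "l powr 1 \<le> l powr real p" using lp[of 1 "real p"] p D A by linarith
        thus "l \<le> l ^ p" using l unfolding lpp by simp
      qed (use C2 l in auto)
      also have "\<dots> \<le> real N" using l C2 mult_right_mono[of "2 * C2" l "real N"] by (simp add: field_simps)
      finally have "2 * C2 * real N / l ^ p \<le> real n" using that by auto
      thus ?thesis using pntE[of n] that by auto
    qed
    \<comment> \<open>The squares of \<open>mangoldt\<close> take up 8 of the 10; passing to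
      \<open>mangoldt - 1\<close> adds at most 2.\<close>
    define V where "V = 10 * (l * real N)"
    have sq: "(\<Sum>n=1..n0. (mangoldt n)\<^sup>2) \<le> 8 * (l * real N)" if "n0 \<in> {N, 2 * N}" for n0
    proof -
      have "(\<Sum>n=1..n0. (mangoldt n)\<^sup>2) \<le> ln (real n0) * (\<Sum>n=1..n0. mangoldt n :: real)"
        using that N by (intro sum_mangoldt_square_le) auto
      also have "\<dots> \<le> (2 * l) * (2 * (2 * real N))"
      proof (rule mult_mono)
        have "ln (real n0) \<le> ln (real (2 * N))" using that N by (intro ln_mono) auto
        thus "ln (real n0) \<le> 2 * l" using l2N' by linarith
        show "(\<Sum>n=1..n0. mangoldt n) \<le> 2 * (2 * real N)" using psi[OF that] that by auto
      qed (use l in \<open>auto intro!: sum_nonneg mangoldt_nonneg\<close>)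
      finally show ?thesis by simp
    qed
    define R where "R = l powr (A + 1)"
    have R: "R \<ge> 2" using lp[of 1 "A + 1"] l A by (simp add: R_def)
    have RE: "R powr E1 = l powr D" by (simp add: R_def powr_powr D_def)
    define \<theta> where "\<theta> = l powr K / real N"
    have tN: "\<theta> * real N = l powr K" using N by (simp add: \<theta>_def)
    have "\<bar>\<Sum>m\<in>{1..M}. \<Sum>n=1..N. mangoldt n * (mangoldt (n + nat \<lfloor>real m powr c\<rfloor>) - 1)\<bar>
      \<le> real (card {1..M}) * ((C1 / R) * V + 84 * (2 * C2 * real N / l ^ p) * (\<theta> * real N)\<^sup>2)"
    proof (rule shifted_correlation_bound[where f = mangoldt and g = "\<lambda>k. mangoldt k - 1"])
      show "(\<Sum>n=1..N. mangoldt n) \<le> 2 * real N" by (rule psi) simp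
      show "(\<Sum>n=1..N. (mangoldt n)\<^sup>2) \<le> V"
      proof -
        have "0 \<le> l * real N" using l by simp
        thus ?thesis using sq[of N] unfolding V_def by simp
      qed
      show "(\<Sum>n=1..2*N. (mangoldt n - 1)\<^sup>2) \<le> V"
      proof -
        \<comment> \<open>The cross term is nonpositive and is dropped.\<close>
        have "(\<Sum>n=1..2*N. (mangoldt n - 1)\<^sup>2) \<le> (\<Sum>n=1..2*N. (mangoldt n)\<^sup>2 + 1 :: real)"
          by (intro sum_mono) (use mangoldt_nonneg in \<open>auto simp: power2_diff\<close>)
        also have "\<dots> = (\<Sum>n=1..2*N. (mangoldt n)\<^sup>2) + 2 * real N" by (simp add: sum.distrib)
        also have "\<dots> \<le> 8 * (l * real N) + 2 * (l * real N)"
          using sq[of "2 * N"] l mult_right_mono[of 1 l "real N"] by simp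
        finally show ?thesis by (simp add: V_def)
      qed
      show "\<bar>\<Sum>k=1..m. mangoldt k - 1\<bar> \<le> 2 * C2 * real N / l ^ p" if "m \<le> 2 * N" for m
        using pntE[OF that] by (simp add: sum_subtractf)
      show "1 \<le> \<theta> * real N" unfolding tN using lp[of 0 K] l0 D by simp
      show "0 \<le> C1 / R" using C1 R by simp
      fix t :: real assume t: "\<theta> \<le> \<bar>t\<bar>" "\<bar>t\<bar> \<le> 1/2"
      have fl: "real (nat \<lfloor>real m powr c\<rfloor>) = of_int \<lfloor>real m powr c\<rfloor>" for m by simp
      have "norm (\<Sum>m=1..M. ee (t * of_int \<lfloor>real m powr c\<rfloor>)) \<le> C1 * real M / R"
      proof (rule es[OF R _ _ t(2)])
        show "R powr E1 \<le> real M" unfolding RE by (rule M1)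
        have "R powr E1 / real M powr c \<le> \<theta>"
        proof -
          \<comment> \<open>\<open>M\<close> may be as small as half of \<open>Y X\<close>; this is
            the source of the factor \<open>2 powr c\<close>.\<close>
          have "X / l powr (A + 2) \<le> (2 * real M) powr c"
            unfolding Yc[symmetric] using M cpos by (intro powr_mono2) (auto simp: Y_def)
          also have "\<dots> = 2 powr c * real M powr c" by (simp add: powr_mult)
          finally have "X \<le> 2 powr c * l powr (A + 2) * real M powr c"
            using l by (simp add: field_simps)
          hence "l powr D * real N \<le> l powr D * (2 powr c * l powr (A + 2) * real M powr c)"
            using N by (intro mult_left_mono) auto
          also have "\<dots> = (2 powr c * (l powr D * l powr (A + 2))) * real M powr c" by simp
          also have "2 powr c * (l powr D * l powr (A + 2)) \<le> l * (l powr D * l powr (A + 2))"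
          proof (rule mult_right_mono)
            have "2 powr c \<le> 2 powr (c + 1)" by simp
            thus "2 powr c \<le> l" using l by linarith
          qed simp
          also have "l * (l powr D * l powr (A + 2)) = l powr K"
            using l unfolding K_def by (simp add: powr_add[symmetric] powr_mult_base) (simp add: add_ac)
          finally have "l powr D * real N \<le> l powr K * real M powr c" by (simp add: mult_right_mono)
          thus ?thesis unfolding RE \<theta>_def using N Mpos by (simp add: field_simps)
        qed
        thus "R powr E1 / real M powr c \<le> \<bar>t\<bar>" using t by linarith
      qed
      thus "norm (\<Sum>m\<in>{1..M}. ee (t * real (nat \<lfloor>real m powr c\<rfloor>))) \<le> C1 / R * real (card {1..M})"
        unfolding fl by simp
    qed (use hN N in \<open>auto intro: mangoldt_nonneg\<close>)
    also have "\<dots> = real M * ((C1 / R) * V + 168 * C2 * real N * ((l powr K)\<^sup>2 / l ^ p))"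
      unfolding tN by simp
    also have "\<dots> \<le> real M * (10 * C1 * real N / l powr A + 168 * C2 * real N * (1 / l powr A))"
    proof (intro mult_left_mono add_mono)
      have "l powr (A + 1) = l powr A * l" using l by (simp add: powr_add)
      thus "(C1 / R) * V \<le> 10 * C1 * real N / l powr A" using l by (simp add: R_def V_def field_simps)
      have "(l powr K)\<^sup>2 * l powr A = l powr (2 * K + A)"
        by (simp add: power2_eq_square powr_add[symmetric])
      hence "(l powr K)\<^sup>2 * l powr A \<le> l ^ p" using lppK by simp
      thus "(l powr K)\<^sup>2 / l ^ p \<le> 1 / l powr A" using l by (simp add: field_simps)
    qed (use C2 in auto)
    also have "\<dots> = (10 * C1 + 168 * C2) * (real M * real N / l powr A)"
      by (simp only: divide_inverse) (simp add: algebra_simps)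
    also have "\<dots> \<le> C * (real M * real N / l powr A)" using C2 unfolding C_def by (intro mult_right_mono) auto
    finally show "\<bar>\<Sum>m=1..M. \<Sum>n=1..nat \<lfloor>X\<rfloor>. mangoldt n * (mangoldt (n + nat \<lfloor>real m powr c\<rfloor>) - 1)\<bar> \<le> C * real M * real (nat \<lfloor>X\<rfloor>) / ln X powr A"
      by (simp add: N_def l_def mult_ac)
    have "\<bar>(\<Sum>n=1..N. mangoldt n) - real N\<bar> \<le> 2 * C2 * real N * (1 / l ^ p)" using pntE[of N] by simp
    also have "\<dots> \<le> 2 * C2 * real N * (1 / l powr A)" using pinv C2 by (intro mult_left_mono) auto
    also have "\<dots> \<le> C * real N * (1 / l powr A)" using C1 C2 unfolding C_def by (intro mult_right_mono) auto
    finally show "\<bar>(\<Sum>n=1..nat \<lfloor>X\<rfloor>. mangoldt n) - real (nat \<lfloor>X\<rfloor>)\<bar> \<le> C * real (nat \<lfloor>X\<rfloor>) / ln X powr A"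
      by (simp add: N_def l_def)
  qed
qed

theorem theorem1p1:
  fixes c A B :: real and M :: "real \<Rightarrow> real"
  assumes "c > 2" and "c \<notin> \<int>"
    and "A \<ge> 1"
    and "B = (A + 2) / c"
    and "\<And>N. M N = N powr (1 / c) / (ln N) powr B"
  shows "(\<lambda>N. cesaro (M N) (\<lambda>m. cesaro N (\<lambda>n.
             mangoldt n * mangoldt (n + nat \<lfloor>real m powr c\<rfloor>))) - 1)
         \<in> O[at_top](\<lambda>N. 1 / (ln N) powr A)"
proof -
  have c: "c > 1" "c > 0" using assms by auto
  obtain C where C: "eventually (\<lambda>X. \<forall>M::nat. real M \<le> X powr (1/c) / ln X powr ((A+2)/c) \<longrightarrow> 2 * real M \<ge> X powr (1/c) / ln X powr ((A+2)/c) \<longrightarrow>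
      \<bar>\<Sum>m=1..M. \<Sum>n=1..nat \<lfloor>X\<rfloor>. mangoldt n * (mangoldt (n + nat \<lfloor>real m powr c\<rfloor>) - 1)\<bar> \<le> C * real M * real (nat \<lfloor>X\<rfloor>) / ln X powr A \<and>
      \<bar>(\<Sum>n=1..nat \<lfloor>X\<rfloor>. mangoldt n) - real (nat \<lfloor>X\<rfloor>)\<bar> \<le> C * real (nat \<lfloor>X\<rfloor>) / ln X powr A) at_top"
    using mangoldt_correlation_bound[OF c(1) assms(2,3)] by blast
  have "eventually (\<lambda>X. X powr (1/c) / ln X powr ((A+2)/c) \<ge> 1) at_top"
    using c assms(3) by real_asymp
  hence ev1: "eventually (\<lambda>X. M X \<ge> 1) at_top" by (simp add: assms)
  have "eventually (\<lambda>X. norm (cesaro (M X) (\<lambda>m. cesaro X (\<lambda>n.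
             mangoldt n * mangoldt (n + nat \<lfloor>real m powr c\<rfloor>))) - 1) \<le> (2 * C) * norm (1 / (ln X) powr A)) at_top"
    using C ev1 eventually_ge_at_top[of 2]
  proof eventually_elim
    case (elim X)
    define N where "N = nat \<lfloor>X\<rfloor>"
    \<comment> \<open>Rounding down loses at most a factor 2 once \<open>M X \<ge> 1\<close>, which
      is what \<open>mangoldt_correlation_bound\<close> asks of the upper limit.\<close>
    define K where "K = nat \<lfloor>M X\<rfloor>"
    define h where "h m = nat \<lfloor>real m powr c\<rfloor>" for m :: nat
    define r where "r = C / ln X powr A"
    have N: "real N = of_int \<lfloor>X\<rfloor>" "N \<ge> 1" using elim(3) unfolding N_def by linarith+
    have K: "real K = of_int \<lfloor>M X\<rfloor>" "K \<ge> 1" "real K \<le> M X" "M X \<le> 2 * real K"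
    proof -
      have "1 \<le> \<lfloor>M X\<rfloor>" using elim(2) by (simp add: le_floor_iff)
      thus "real K = of_int \<lfloor>M X\<rfloor>" "K \<ge> 1" "real K \<le> M X" "M X \<le> 2 * real K" unfolding K_def by linarith+
    qed
    have b: "\<bar>\<Sum>m=1..K. \<Sum>n=1..N. mangoldt n * (mangoldt (n + h m) - 1)\<bar> \<le> r * real K * real N"
      "\<bar>(\<Sum>n=1..N. mangoldt n) - real N\<bar> \<le> r * real N"
      using elim(1)[rule_format, of K] K(3,4) unfolding N_def[symmetric] h_def[symmetric] r_def by (simp_all add: assms)
    define Z where "Z = (\<Sum>m=1..K. \<Sum>n=1..N. mangoldt n * mangoldt (n + h m) :: real)"
    have "cesaro (M X) (\<lambda>m. cesaro X (\<lambda>n. mangoldt n * mangoldt (n + h m))) = Z / (real K * real N)"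
      unfolding cesaro_def N_def[symmetric] K_def[symmetric] N(1)[symmetric] K(1)[symmetric] Z_def
      by (simp add: sum_divide_distrib[symmetric] sum_distrib_left[symmetric])
    \<comment> \<open>The part without \<open>mangoldt - 1\<close> does not depend on the shift, so
      the prime number theorem settles it for all \<open>m\<close> at once.\<close>
    also have "Z = (\<Sum>m=1..K. \<Sum>n=1..N. mangoldt n * (mangoldt (n + h m) - 1)) + real K * (\<Sum>n=1..N. mangoldt n)"
      unfolding Z_def by (simp add: right_diff_distrib sum_subtractf)
    finally have "cesaro (M X) (\<lambda>m. cesaro X (\<lambda>n. mangoldt n * mangoldt (n + h m))) - 1 =
       ((\<Sum>m=1..K. \<Sum>n=1..N. mangoldt n * (mangoldt (n + h m) - 1)) + real K * ((\<Sum>n=1..N. mangoldt n) - real N)) / (real K * real N)"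
      using N K by (simp add: field_simps)
    hence "\<bar>cesaro (M X) (\<lambda>m. cesaro X (\<lambda>n. mangoldt n * mangoldt (n + h m))) - 1\<bar> =
      \<bar>(\<Sum>m=1..K. \<Sum>n=1..N. mangoldt n * (mangoldt (n + h m) - 1)) + real K * ((\<Sum>n=1..N. mangoldt n) - real N)\<bar> / (real K * real N)"
      by (simp add: abs_divide)
    also have "\<dots> \<le> (r * real K * real N + real K * (r * real N)) / (real K * real N)"
    proof (rule divide_right_mono)
      have "\<bar>real K * ((\<Sum>n=1..N. mangoldt n) - real N)\<bar> \<le> real K * (r * real N)"
        unfolding abs_mult using b(2) by (simp add: mult_left_mono)
      thus "\<bar>(\<Sum>m=1..K. \<Sum>n=1..N. mangoldt n * (mangoldt (n + h m) - 1)) + real K * ((\<Sum>n=1..N. mangoldt n) - real N)\<bar> \<le> r * real K * real N + real K * (r * real N)"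
        using b(1) by linarith
    qed simp
    also have "\<dots> = 2 * r" using N K by (simp add: field_simps)
    finally show ?case unfolding h_def r_def by simp
  qed
  thus ?thesis by (rule bigoI)
qed

end
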